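(* Consider the polynomial on $\mathbb R^{2n}$ $$P(x,y)=ic_0+2i(-vx+uy)+i\sum_{k=1}^nb_k(x_k^2+y_k^2)$$ where $c_0\in\mathbb R$, $u,v\in\mathbb R^n$ and $b_k\in\mathbb R$ with $b_k\ne0$ and $b_k\notin\tfrac\pi2+\pi\mathbb Z$ for $k=1,\dots,n$. Then $$\begin{aligned}\exp_{\ast_M}(P)(x,y)=\;&e^{ic_0}\left(\prod_{k=1}^n\cos(b_k)\right)^{-1}\exp\left(i\sum_{k=1}^n(u_k^2+v_k^2)\left(\tfrac1{b_k^2}\tan(b_k)-\tfrac1{b_k}\right)\right)\\ &\times\exp\left(i\sum_{k=1}^n(x_k^2+y_k^2)\tan(b_k)\right)\exp\left(2i\sum_{k=1}^n\tfrac1{b_k}\tan(b_k)(y_ku_k-v_kx_k)\right).\end{aligned}$$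
   Context: For $x,y\in\mathbb R^n$, $xy:=\sum_kx_ky_k$. The classical Weyl correspondence $\mathcal W$ maps $f\in\mathcal S(\mathbb R^{2n})$ to the operator on $L^2(\mathbb R^n)$ $$(\mathcal W(f)\phi)(x)=(2\pi)^{-n}\int_{\mathbb R^{2n}}e^{iyt}f(x+\tfrac12y,t)\,\phi(x+y)\,dy\,dt$$ (note the sign convention); it extends to tempered distributions $f$ (as a bijection onto continuous operators $\mathcal S(\mathbb R^n)\to\mathcal S'(\mathbb R^n)$) and in particular to polynomials: if $f(x,y)=p(x)y^s$ with $p$ a polynomial and $s$ a multi-index, then $(\mathcal W(f)\phi)(x)=\left(i\frac{\partial}{\partial y}\right)^s\left(p(x+\tfrac12y)\phi(x+y)\right)\big|_{y=0}$. $\mathcal W$ is a bijection from polynomials on $\mathbb R^{2n}$ onto differential operators on $\mathbb R^n$ with polynomial coefficients. The Moyal product is defined by $\mathcal W(f\ast_Mg)=\mathcal W(f)\mathcal W(g)$. The star exponential is formally $\exp_{\ast_M}(f)=\sum_{k\ge0}\frac1{k!}f^{\ast_M,k}$ with $f^{\ast_M,k}=f\ast_M\cdots\ast_Mf$ ($k$ times), and is understood as the Weyl symbol of the exponential of $\mathcal W(f)$, i.e. $\mathcal W(\exp_{\ast_M}(f))=\exp(\mathcal W(f))$. For the polynomials $P$ considered here, $\mathcal W(P)$ is essentially skew-adjoint on $\mathcal S(\mathbb R^n)$ and $\exp(\mathcal W(P))$ is the unitary operator generated (at time $1$) by its closure. *)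

theory Defs
  imports "HOL-Analysis.Analysis" "HOL-Library.Poly_Mapping"
begin

section \<open>Schwartz functions and tempered distributions\<close>

definition partial :: "'a::euclidean_space \<Rightarrow> ('a \<Rightarrow> complex) \<Rightarrow> 'a \<Rightarrow> complex" where
  "partial d g x = vector_derivative (\<lambda>h::real. g (x + h *\<^sub>R d)) (at 0)"

primrec iter_partial :: "'a::euclidean_space list \<Rightarrow> ('a \<Rightarrow> complex) \<Rightarrow> 'a \<Rightarrow> complex" where
  "iter_partial [] g = g"
| "iter_partial (d # ds) g = partial d (iter_partial ds g)"

text \<open>Smoothness is expressed by (Frechet) differentiability of all iterated partial derivatives.\<close>

definition schwartz :: "('a::euclidean_space \<Rightarrow> complex) \<Rightarrow> bool" where
  "schwartz \<phi> \<longleftrightarrow>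
     (\<forall>ds \<in> lists Basis.
        (\<forall>x. iter_partial ds \<phi> differentiable (at x)) \<and>
        (\<forall>N::nat. bounded (range (\<lambda>x. (1 + norm x) ^ N *\<^sub>R iter_partial ds \<phi> x))))"

text \<open>
  A distribution is a functional on functions, of which only the values on Schwartz functions
  matter.  Continuity: the value is controlled by finitely many of the seminorms
  \<open>sup\<^sub>x (1 + |x|)\<^sup>N |\<partial>\<^sup>s \<phi> x|\<close>; the number \<open>B\<close> is an arbitrary common bound for these.
\<close>

definition tempered_distribution :: "(('a::euclidean_space \<Rightarrow> complex) \<Rightarrow> complex) \<Rightarrow> bool" where
  "tempered_distribution T \<longleftrightarrow>
     (\<forall>\<phi> \<psi> a b. schwartz \<phi> \<longrightarrow> schwartz \<psi> \<longrightarrow>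
        T (\<lambda>x. a * \<phi> x + b * \<psi> x) = a * T \<phi> + b * T \<psi>) \<and>
     (\<exists>C N. \<forall>\<phi> B. schwartz \<phi> \<longrightarrow>
        (\<forall>ds \<in> lists Basis. length ds \<le> N \<longrightarrow>
           (\<forall>x. (1 + norm x) ^ N * norm (iter_partial ds \<phi> x) \<le> B)) \<longrightarrow>
        norm (T \<phi>) \<le> C * B)"

definition distribution_of :: "('a::euclidean_space \<Rightarrow> complex) \<Rightarrow> ('a \<Rightarrow> complex) \<Rightarrow> complex" where
  "distribution_of F \<phi> = (LINT x|lborel. F x * \<phi> x)"


section \<open>The Weyl correspondence for tempered distributions\<close>

text \<open>
  Pairing \<open>\<W>(f) \<phi>\<close> (bilinearly, without complex conjugation) with a test function \<open>\<psi>\<close> gives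
  \<open>(2\<pi>)\<^sup>-\<^sup>n \<integral>\<integral>\<integral> e\<^sup>i\<^sup>y\<^sup>t f(x + y/2, t) \<phi>(x + y) \<psi>(x) dy dt dx\<close>.  The substitution \<open>q = x + y/2\<close> turns
  this into the pairing of \<open>f\<close> with the Schwartz function \<open>cross_wigner \<phi> \<psi>\<close> of \<open>(q, t)\<close>, which
  makes sense for any tempered distribution \<open>f\<close>.
\<close>

definition cross_wigner ::
  "(real^'n::finite \<Rightarrow> complex) \<Rightarrow> (real^'n \<Rightarrow> complex) \<Rightarrow> (real^'n) \<times> (real^'n) \<Rightarrow> complex" where
  "cross_wigner \<phi> \<psi> = (\<lambda>(q, t).
     complex_of_real (1 / (2 * pi) ^ CARD('n)) *
       (LINT y|lborel. exp (\<i> * complex_of_real (y \<bullet> t)) *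
          \<phi> (q + (1/2) *\<^sub>R y) * \<psi> (q - (1/2) *\<^sub>R y)))"

definition weyl_pairing ::
  "(((real^'n::finite) \<times> (real^'n) \<Rightarrow> complex) \<Rightarrow> complex) \<Rightarrow>
   (real^'n \<Rightarrow> complex) \<Rightarrow> (real^'n \<Rightarrow> complex) \<Rightarrow> complex" where
  "weyl_pairing T \<phi> \<psi> = T (cross_wigner \<phi> \<psi>)"


section \<open>The Weyl correspondence for polynomials\<close>

text \<open>
  Complex polynomials on \<open>\<real>\<^sup>2\<^sup>n\<close>, as finitely supported families of coefficients indexed by exponents.
  The index \<open>Inl k\<close> stands for the variable \<open>x\<^sub>k\<close> and \<open>Inr k\<close> for the variable \<open>y\<^sub>k\<close>.
\<close>

type_synonym 'n symbol_poly = "(('n + 'n) \<Rightarrow>\<^sub>0 nat) \<Rightarrow>\<^sub>0 complex"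

definition X :: "'n \<Rightarrow> 'n symbol_poly" where
  "X k = Poly_Mapping.single (Poly_Mapping.single (Inl k) 1) 1"

definition Y :: "'n \<Rightarrow> 'n symbol_poly" where
  "Y k = Poly_Mapping.single (Poly_Mapping.single (Inr k) 1) 1"

definition Const :: "complex \<Rightarrow> 'n symbol_poly" where
  "Const c = Poly_Mapping.single 0 c"

definition x_monomial :: "(('n::finite + 'n) \<Rightarrow>\<^sub>0 nat) \<Rightarrow> real^'n \<Rightarrow> complex" where
  "x_monomial m x = (\<Prod>k\<in>UNIV. complex_of_real (x $ k) ^ Poly_Mapping.lookup m (Inl k))"

definition y_monomial :: "(('n::finite + 'n) \<Rightarrow>\<^sub>0 nat) \<Rightarrow> real^'n \<Rightarrow> complex" where
  "y_monomial m y = (\<Prod>k\<in>UNIV. complex_of_real (y $ k) ^ Poly_Mapping.lookup m (Inr k))"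

definition symbol_eval :: "'n::finite symbol_poly \<Rightarrow> real^'n \<Rightarrow> real^'n \<Rightarrow> complex" where
  "symbol_eval p x y =
     (\<Sum>m\<in>Poly_Mapping.keys p. Poly_Mapping.lookup p m * x_monomial m x * y_monomial m y)"

text \<open>
  \<open>\<partial>\<^sup>s\<close> for a multi-index \<open>s\<close>: the index type carries no order, so some enumeration of the
  directions is chosen.  On smooth functions the result does not depend on it.
\<close>

definition multi_partial :: "('n::finite \<Rightarrow> nat) \<Rightarrow> (real^'n \<Rightarrow> complex) \<Rightarrow> real^'n \<Rightarrow> complex" where
  "multi_partial s = iter_partial
     (map (\<lambda>k. axis k 1) (SOME ks. \<forall>k. count_list ks k = s k))"

text \<open>
  Linear extension of: the symbol \<open>p(x) y\<^sup>s\<close> goes to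
  \<open>\<phi> \<mapsto> (\<lambda>x. (\<i> \<partial>/\<partial>y)\<^sup>s (p(x + y/2) \<phi>(x + y))) |\<^sub>y\<^sub>=\<^sub>0\<close>.
\<close>

definition weyl_op ::
  "'n::finite symbol_poly \<Rightarrow> (real^'n \<Rightarrow> complex) \<Rightarrow> real^'n \<Rightarrow> complex" where
  "weyl_op p \<phi> x =
     (\<Sum>m\<in>Poly_Mapping.keys p.
        let s = (\<lambda>k. Poly_Mapping.lookup m (Inr k)) in
        Poly_Mapping.lookup p m * \<i> ^ (\<Sum>k\<in>UNIV. s k) *
        multi_partial s (\<lambda>y. x_monomial m (x + (1/2) *\<^sub>R y) * \<phi> (x + y)) 0)"


section \<open>Unitary groups on \<open>L\<^sup>2\<close> and their generators\<close>

text \<open>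
  Elements of \<open>L\<^sup>2\<close> are represented by square integrable functions; all notions below are
  invariant under changes on null sets.
\<close>

definition L2 :: "('a::euclidean_space \<Rightarrow> complex) set" where
  "L2 = {f. f \<in> borel_measurable lborel \<and> integrable lborel (\<lambda>x. (norm (f x))\<^sup>2)}"

definition L2_norm :: "('a::euclidean_space \<Rightarrow> complex) \<Rightarrow> real" where
  "L2_norm f = sqrt (LINT x|lborel. (norm (f x))\<^sup>2)"

text \<open>
  Strongly continuous one-parameter group of linear isometries of \<open>L\<^sup>2\<close>; by the group law each
  \<open>U t\<close> is invertible, hence unitary.
\<close>

definition unitary_group ::
  "(real \<Rightarrow> ('a::euclidean_space \<Rightarrow> complex) \<Rightarrow> 'a \<Rightarrow> complex) \<Rightarrow> bool" where
  "unitary_group U \<longleftrightarrow>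
     (\<forall>t. \<forall>f\<in>L2. U t f \<in> L2 \<and> L2_norm (U t f) = L2_norm f) \<and>
     (\<forall>t a b. \<forall>f\<in>L2. \<forall>g\<in>L2.
        AE x in lborel. U t (\<lambda>x. a * f x + b * g x) x = a * U t f x + b * U t g x) \<and>
     (\<forall>f\<in>L2. AE x in lborel. U 0 f x = f x) \<and>
     (\<forall>s t. \<forall>f\<in>L2. AE x in lborel. U (s + t) f x = U s (U t f) x) \<and>
     (\<forall>f\<in>L2. ((\<lambda>t. L2_norm (\<lambda>x. U t f x - f x)) \<longlongrightarrow> 0) (at 0))"

text \<open>The infinitesimal generator \<open>d/dt U\<^sub>t\<close> at \<open>t = 0\<close>, as a graph.\<close>

definition generator_graph ::
  "(real \<Rightarrow> ('a::euclidean_space \<Rightarrow> complex) \<Rightarrow> 'a \<Rightarrow> complex) \<Rightarrow>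
   (('a \<Rightarrow> complex) \<times> ('a \<Rightarrow> complex)) set" where
  "generator_graph U = {(f, g). f \<in> L2 \<and> g \<in> L2 \<and>
     ((\<lambda>t. L2_norm (\<lambda>x. (U t f x - f x) / complex_of_real t - g x)) \<longlongrightarrow> 0) (at 0)}"

text \<open>The closure in \<open>L\<^sup>2 \<times> L\<^sup>2\<close> of the graph of \<open>A\<close> with domain the Schwartz functions.\<close>

definition closure_graph ::
  "(('a::euclidean_space \<Rightarrow> complex) \<Rightarrow> 'a \<Rightarrow> complex) \<Rightarrow>
   (('a \<Rightarrow> complex) \<times> ('a \<Rightarrow> complex)) set" where
  "closure_graph A = {(f, g). f \<in> L2 \<and> g \<in> L2 \<and>
     (\<exists>\<phi>. (\<forall>j::nat. schwartz (\<phi> j) \<and> A (\<phi> j) \<in> L2) \<and>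
        (\<lambda>j. L2_norm (\<lambda>x. \<phi> j x - f x)) \<longlonglongrightarrow> 0 \<and>
        (\<lambda>j. L2_norm (\<lambda>x. A (\<phi> j) x - g x)) \<longlonglongrightarrow> 0)}"

text \<open>
  \<open>V\<close> is \<open>exp A\<close>: the time one value of the unitary group generated by the closure of \<open>A\<close>.  By
  Stone's theorem such a group exists iff \<open>A\<close> is essentially skew-adjoint, and it is then unique.
\<close>

definition is_operator_exp ::
  "(('a::euclidean_space \<Rightarrow> complex) \<Rightarrow> 'a \<Rightarrow> complex) \<Rightarrow>
   (('a \<Rightarrow> complex) \<Rightarrow> 'a \<Rightarrow> complex) \<Rightarrow> bool" where
  "is_operator_exp A V \<longleftrightarrow>
     (\<forall>\<phi>. schwartz \<phi> \<longrightarrow> A \<phi> \<in> L2) \<and>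
     (\<exists>U. unitary_group U \<and> generator_graph U = closure_graph A \<and> V = U 1)"


section \<open>The star exponential\<close>

text \<open>
  \<open>T\<close> is the Weyl symbol of \<open>exp(\<W>(p))\<close>: \<open>\<W>(T) = exp(\<W>(p))\<close> as operators from Schwartz functions
  to tempered distributions.  As the Weyl correspondence is injective on tempered distributions,
  this determines \<open>T\<close> on Schwartz functions.
\<close>

definition is_moyal_star_exp ::
  "'n::finite symbol_poly \<Rightarrow> (((real^'n) \<times> (real^'n) \<Rightarrow> complex) \<Rightarrow> complex) \<Rightarrow> bool" where
  "is_moyal_star_exp p T \<longleftrightarrow>
     tempered_distribution T \<and>
     (\<exists>V. is_operator_exp (weyl_op p) V \<and>
        (\<forall>\<phi> \<psi>. schwartz \<phi> \<longrightarrow> schwartz \<psi> \<longrightarrow>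
           weyl_pairing T \<phi> \<psi> = distribution_of (V \<phi>) \<psi>))"


section \<open>The quadratic symbol\<close>

definition quadratic_symbol ::
  "real \<Rightarrow> real^'n::finite \<Rightarrow> real^'n \<Rightarrow> real^'n \<Rightarrow> 'n symbol_poly" where
  "quadratic_symbol c u v b =
     Const (\<i> * c)
     + Const (2 * \<i>) * (\<Sum>k\<in>UNIV. - (Const (v $ k) * X k) + Const (u $ k) * Y k)
     + Const \<i> * (\<Sum>k\<in>UNIV. Const (b $ k) * (X k ^ 2 + Y k ^ 2))"

lemma symbol_eval_superset:
  assumes "finite S" "Poly_Mapping.keys p \<subseteq> S"
  shows "symbol_eval p x y =
    (\<Sum>m\<in>S. Poly_Mapping.lookup p m * x_monomial m x * y_monomial m y)"
  unfolding symbol_eval_def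
  by (rule sum.mono_neutral_left) (use assms in \<open>auto simp: in_keys_iff\<close>)

lemma symbol_eval_add: "symbol_eval (p + q) x y = symbol_eval p x y + symbol_eval q x y"
proof -
  let ?S = "Poly_Mapping.keys p \<union> Poly_Mapping.keys q"
  have "symbol_eval r x y =
      (\<Sum>m\<in>?S. Poly_Mapping.lookup r m * x_monomial m x * y_monomial m y)"
    if "Poly_Mapping.keys r \<subseteq> ?S" for r
    using that by (intro symbol_eval_superset) auto
  then show ?thesis
    using Poly_Mapping.keys_add[of p q]
    by (simp add: lookup_add algebra_simps sum.distrib)
qed

lemma symbol_eval_zero: "symbol_eval 0 x y = 0"
  by (simp add: symbol_eval_def)

lemma symbol_eval_uminus: "symbol_eval (- p) x y = - symbol_eval p x y"
  using symbol_eval_add[of p "- p" x y] by (simp add: symbol_eval_zero add_eq_0_iff)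

lemma symbol_eval_diff: "symbol_eval (p - q) x y = symbol_eval p x y - symbol_eval q x y"
  using symbol_eval_add[of p "- q" x y] by (simp add: symbol_eval_uminus)

lemma symbol_eval_sum: "symbol_eval (\<Sum>k\<in>A. p k) x y = (\<Sum>k\<in>A. symbol_eval (p k) x y)"
  by (induction A rule: infinite_finite_induct) (simp_all add: symbol_eval_zero symbol_eval_add)

lemma symbol_eval_single:
  "symbol_eval (Poly_Mapping.single m c) x y = c * x_monomial m x * y_monomial m y"
  by (subst symbol_eval_superset[of "{m}"]) auto

lemma monomial_add:
  "x_monomial (m + m') x = x_monomial m x * x_monomial m' x"
  "y_monomial (m + m') y = y_monomial m y * y_monomial m' y"
  by (simp_all add: x_monomial_def y_monomial_def lookup_add power_add prod.distrib)

lemma symbol_eval_mult: "symbol_eval (p * q) x y = symbol_eval p x y * symbol_eval q x y"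
proof -
  have repr: "r = (\<Sum>m\<in>Poly_Mapping.keys r. Poly_Mapping.single m (Poly_Mapping.lookup r m))"
    for r :: "'n symbol_poly"
    by (rule poly_mapping_eqI)
       (auto simp: lookup_sum lookup_single when_def in_keys_iff sum.delta)
  have "symbol_eval (p * q) x y = symbol_eval
     ((\<Sum>m\<in>Poly_Mapping.keys p. Poly_Mapping.single m (Poly_Mapping.lookup p m)) *
      (\<Sum>m\<in>Poly_Mapping.keys q. Poly_Mapping.single m (Poly_Mapping.lookup q m))) x y"
    using repr[of p] repr[of q] by simp
  also have "\<dots> = symbol_eval p x y * symbol_eval q x y"
    unfolding symbol_eval_def[of p] symbol_eval_def[of q] sum_product symbol_eval_sum
    by (simp add: symbol_eval_single mult_single monomial_add algebra_simps)
  finally show ?thesis .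
qed

lemma symbol_eval_generators:
  "symbol_eval (Const c) x y = c"
  "symbol_eval (X k) x y = complex_of_real (x $ k)"
  "symbol_eval (Y k) x y = complex_of_real (y $ k)"
  by (simp_all add: Const_def X_def Y_def symbol_eval_single x_monomial_def y_monomial_def
      lookup_single when_def if_distrib[of "\<lambda>n. _ ^ n"] prod.delta' cong: if_cong)

lemma symbol_eval_quadratic_symbol:
  "symbol_eval (quadratic_symbol c u v b) x y =
     \<i> * c + 2 * \<i> * (- (v \<bullet> x) + u \<bullet> y)
     + \<i> * (\<Sum>k\<in>UNIV. b $ k * ((x $ k)\<^sup>2 + (y $ k)\<^sup>2))"
  by (simp add: quadratic_symbol_def symbol_eval_add symbol_eval_mult symbol_eval_sum
      symbol_eval_uminus symbol_eval_diff symbol_eval_generators power2_eq_square inner_vec_def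
      sum_subtractf)

end

theory Submission
  imports Defs "HOL-Probability.Probability" "HOL-Real_Asymp.Real_Asymp"
begin

text \<open>
  Completing the square writes \<open>\<W>(P)\<close> as \<open>\<i> (c + \<Sum>\<^sub>k b\<^sub>k a\<^sub>k\<^sup>* a\<^sub>k)\<close> with displaced ladder
  operators, so that it is diagonal in an orthonormal basis of displaced Hermite functions.  As these
  are Schwartz functions and total in \<open>L\<^sup>2\<close>, the closure of \<open>\<W>(P)\<close> generates the diagonal unitary
  group with the same eigenvectors.

  To identify the Weyl symbol at time one, replace the unimodular numbers \<open>e\<^sub>k = exp(\<i> b\<^sub>k)\<close> by
  \<open>r e\<^sub>k\<close> with \<open>r < 1\<close>.  The candidate symbol becomes an integrable Gaussian and the diagonal operator a
  contraction, and both define bounded bilinear forms on \<open>L\<^sup>2\<close>.  These forms agree on Gaussian wave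
  packets, where everything is an explicit Gaussian integral, and hence everywhere because the wave
  packets are total.  Letting \<open>r\<close> tend to 1 gives the claim on Schwartz functions, whose cross Wigner
  functions are integrable; no oscillatory integral and no singular time has to be treated.
\<close>

section \<open>Integration on Euclidean spaces\<close>

text \<open>The damping acts on the numbers \<open>e_k\<close> and not on the time: the spectrum
  contains \<open>b_k (2 \<alpha>_k + 1)\<close> for every mode and is unbounded in both directions
  when the \<open>b_k\<close> differ in sign, so no complex time makes the exponential bounded,
  whereas \<open>e_k^(2 \<alpha>_k + 1)\<close> with \<open>norm e_k < 1\<close> contracts each mode
  for either sign of \<open>b_k\<close>. Wave packets are the right test vectors because they are
  eigenvectors of the lowering operators: their Hermite coefficients are essentially powers, and a
  diagonal operator with entries \<open>e^(2 \<alpha> + 1)\<close> just moves the parameter of the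
  packet, up to a scalar. This takes the place of a summation of Mehler's kernel. Totality enters
  twice. Injectivity of the Fourier transform makes the wave packets total; expanding an exponential
  then makes the displaced Hermite functions total.\<close>

lemma integrable_lborel_prod:
  fixes f :: "'a::euclidean_space \<Rightarrow> real \<Rightarrow>
      'b::{real_normed_field,banach,second_countable_topology}"
  assumes "\<And>b. b \<in> Basis \<Longrightarrow> integrable lborel (f b)"
  shows "integrable lborel (\<lambda>x. \<Prod>b\<in>Basis. f b (x \<bullet> b))"
    and "(LINT x|lborel. (\<Prod>b\<in>Basis. f b (x \<bullet> b))) = (\<Prod>b\<in>Basis. (LINT x|lborel. f b x))"
proof -
  interpret product_sigma_finite "\<lambda>_::'a. lborel :: real measure" ..
  let ?P = "\<Pi>\<^sub>M b\<in>(Basis::'a set). (lborel :: real measure)"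
  let ?T = "\<lambda>f. \<Sum>b\<in>(Basis::'a set). f b *\<^sub>R b"
  have [measurable]: "f b \<in> borel_measurable borel" if "b \<in> Basis" for b
    using assms[OF that] by (simp add: integrable_iff_bounded)
  have T[measurable]: "?T \<in> measurable ?P borel"
    by measurable
  have coord: "(\<Sum>b\<in>(Basis::'a set). y b *\<^sub>R b) \<bullet> c = y c" if "c \<in> Basis" for y ::
      "'a \<Rightarrow> real" and c
    using that by (simp add: inner_sum_left inner_Basis if_distrib cong: if_cong)
  have meas: "(\<lambda>x. \<Prod>b\<in>Basis. f b (x \<bullet> b)) \<in> borel_measurable borel"
    by measurable
  have i: "integrable ?P (\<lambda>y. \<Prod>b\<in>Basis. f b (y b))"
    by (rule product_integrable_prod) (auto simp: assms)
  show "integrable lborel (\<lambda>x. \<Prod>b\<in>Basis. f b (x \<bullet> b))"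
    by (subst lborel_eq, subst integrable_distr_eq[OF T meas]) (use i in \<open>simp add: coord\<close>)
  have "(LINT x|lborel. (\<Prod>b\<in>Basis. f b (x \<bullet> b))) = (LINT y|?P. (\<Prod>b\<in>Basis. f b (y b)))"
    by (subst lborel_eq, subst integral_distr[OF T meas]) (simp add: coord)
  also have "\<dots> = (\<Prod>b\<in>Basis. (LINT x|lborel. f b x))"
    by (rule product_integral_prod) (auto simp: assms)
  finally show "(LINT x|lborel. (\<Prod>b\<in>Basis. f b (x \<bullet> b))) = (\<Prod>b\<in>Basis. (LINT
      x|lborel. f b x))" .
qed

lemma prod_Basis_vec:
  "(\<Prod>b\<in>(Basis :: (real^'n) set). g b) = (\<Prod>k\<in>(UNIV :: 'n::finite set). g (axis k 1))"
proof -
  have "(Basis :: (real^'n) set) = range (\<lambda>k. axis k 1)"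
    by (auto simp: Basis_vec_def)
  moreover have "inj (\<lambda>k::'n. axis k (1::real))"
    by (auto simp: inj_on_def axis_eq_axis)
  ultimately show ?thesis
    using prod.reindex[of "\<lambda>k::'n. axis k (1::real)" UNIV g] by (simp only: comp_def)
qed

lemma integrable_lborel_prod_vec:
  fixes f :: "'n::finite \<Rightarrow> real \<Rightarrow> 'b::{real_normed_field,banach,second_countable_topology}"
  assumes "\<And>k. integrable lborel (f k)"
  shows "integrable lborel (\<lambda>x::real^'n. \<Prod>k\<in>UNIV. f k (x $ k))"
    and "(LINT x|lborel. (\<Prod>k\<in>UNIV. f k ((x :: real^'n) $ k))) = (\<Prod>k\<in>UNIV. (LINT x|lborel. f k x))"
proof -
  \<comment> \<open>\<open>THE\<close> inverts \<open>k \<mapsto> axis k 1\<close>, so that a family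
    indexed by coordinates becomes one indexed by \<open>Basis\<close>.\<close>
  define g where "g b = f (THE k. b = axis k 1)" for b :: "real^'n"
  have g: "g (axis k 1) = f k" for k
    by (simp add: g_def axis_eq_axis)
  have "integrable lborel (g b)" if "b \<in> Basis" for b
    using that assms by (auto simp: Basis_vec_def g)
  from integrable_lborel_prod[of g, OF this]
  show "integrable lborel (\<lambda>x::real^'n. \<Prod>k\<in>UNIV. f k (x $ k))"
    "(LINT x|lborel. (\<Prod>k\<in>UNIV. f k ((x :: real^'n) $ k))) = (\<Prod>k\<in>UNIV. (LINT x|lborel. f k x))"
    by (simp_all add: prod_Basis_vec g inner_axis)
qed

lemma integrable_one_plus_square: "integrable lborel (\<lambda>x::real. 1 / (1 + x\<^sup>2))"
  using integrable_inverse_1_plus_square by (simp add: set_integrable_def inverse_eq_divide)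

text \<open>The exponent \<open>2 * DIM('a)\<close> provides a factor \<open>(1 + norm x)^2\<close>
  for every coordinate, which dominates \<open>1 + (x \<bullet> b)^2\<close>; the comparison
  function is a product of integrable functions of one variable.\<close>

lemma integrable_polynomial_decay:
  "integrable lborel (\<lambda>x::'a::euclidean_space. 1 / (1 + norm x) ^ (2 * DIM('a)))"
proof (rule Bochner_Integration.integrable_bound)
  show "integrable lborel (\<lambda>x::'a. \<Prod>b\<in>Basis. 1 / (1 + (x \<bullet> b)\<^sup>2))"
    by (rule integrable_lborel_prod) (rule integrable_one_plus_square)
  show "AE x in lborel. norm (1 / (1 + norm (x::'a)) ^ (2 * DIM('a))) \<le> norm (\<Prod>b\<in>Basis. 1 / (1 +
      (x \<bullet> b)\<^sup>2))"
  proof (rule AE_I2)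
    fix x :: 'a
    have "(\<Prod>b\<in>(Basis::'a set). 1 + (x \<bullet> b)\<^sup>2) \<le> (\<Prod>b\<in>(Basis::'a set). (1 +
        norm x)\<^sup>2)"
    proof (rule prod_mono, safe)
      fix b :: 'a assume "b \<in> Basis"
      then have "\<bar>x \<bullet> b\<bar> \<le> norm x"
        by (rule Basis_le_norm)
      then have "(x \<bullet> b)\<^sup>2 \<le> (norm x)\<^sup>2"
        by (rule power2_le_iff_abs_le[THEN iffD2, rotated]) simp
      then show "1 + (x \<bullet> b)\<^sup>2 \<le> (1 + norm x)\<^sup>2"
        by (simp add: power2_sum add_increasing2)
    qed simp
    then have *: "(\<Prod>b\<in>(Basis::'a set). 1 + (x \<bullet> b)\<^sup>2) \<le> (1 + norm x) ^ (2 * DIM('a))"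
      by (simp add: power_mult)
    have "0 < (\<Prod>b\<in>(Basis::'a set). 1 + (x \<bullet> b)\<^sup>2)"
      by (rule prod_pos) (simp add: add_pos_nonneg)
    with * show "norm (1 / (1 + norm x) ^ (2 * DIM('a))) \<le> norm (\<Prod>b\<in>Basis. 1 / (1 + (x \<bullet>
        b)\<^sup>2))"
      by (simp add: prod_dividef frac_le)
  qed
qed simp

text \<open>The bound in the second part is linear in \<open>C\<close>, the form in which continuity
  of a tempered distribution is stated.\<close>

lemma integrable_decay:
  fixes f :: "'a::euclidean_space \<Rightarrow> 'b::{banach,second_countable_topology}"
  assumes "f \<in> borel_measurable borel" and "\<And>x. (1 + norm x) ^ (2 * DIM('a)) * norm (f x) \<le> C"
  shows "integrable lborel f"
    and "norm (LINT x|lborel. f x) \<le> C * (LINT x|lborel. 1 / (1 + norm (x::'a)) ^ (2 * DIM('a)))"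
proof -
  have bound: "norm (f x) \<le> C * (1 / (1 + norm x) ^ (2 * DIM('a)))" for x
    using assms(2)[of x] by (simp add: field_simps add_pos_nonneg)
  have i: "integrable lborel (\<lambda>x::'a. C * (1 / (1 + norm x) ^ (2 * DIM('a))))"
    using integrable_polynomial_decay by (rule integrable_mult_right)
  show f: "integrable lborel f"
    by (rule Bochner_Integration.integrable_bound[OF i])
       (use assms(1) in \<open>auto intro!: AE_I2 order_trans[OF bound] divide_right_mono\<close>)
  have "norm (LINT x|lborel. f x) \<le> (LINT x|lborel. C * (1 / (1 + norm (x::'a)) ^ (2 * DIM('a))))"
    by (rule Bochner_Integration.integral_norm_bound_integral[OF f i]) (rule bound)
  then show "norm (LINT x|lborel. f x) \<le> C * (LINT x|lborel. 1 / (1 + norm (x::'a)) ^ (2 * DIM('a)))"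
    by (simp only: integral_mult_right_zero)
qed

lemma lborel_integral_affine:
  fixes f :: "'a::euclidean_space \<Rightarrow> 'b::{banach,second_countable_topology}"
  assumes c: "c \<noteq> 0" and f[measurable]: "f \<in> borel_measurable borel"
  shows "integrable lborel (\<lambda>x. f (t + c *\<^sub>R x)) \<longleftrightarrow> integrable lborel f"
    and "(LINT x|lborel. f x) = \<bar>c\<bar> ^ DIM('a) *\<^sub>R (LINT x|lborel. f (t + c *\<^sub>R x))"
proof -
  have "integrable lborel f \<longleftrightarrow> integrable lborel (\<lambda>x. \<bar>c\<bar> ^ DIM('a)
      *\<^sub>R f (t + c *\<^sub>R x))"
    by (subst lborel_affine[OF c, of t])
       (simp add: integrable_density integrable_distr_eq ennreal_power)
  moreover have "integrable lborel (\<lambda>x. f (t + c *\<^sub>R x))"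
    if "integrable lborel (\<lambda>x. \<bar>c\<bar> ^ DIM('a) *\<^sub>R f (t + c *\<^sub>R x))"
    using integrable_scaleR_right[OF that, of "inverse (\<bar>c\<bar> ^ DIM('a))"] c by simp
  ultimately show "integrable lborel (\<lambda>x. f (t + c *\<^sub>R x)) \<longleftrightarrow> integrable lborel f"
    by (auto intro: integrable_scaleR_right)
  show "(LINT x|lborel. f x) = \<bar>c\<bar> ^ DIM('a) *\<^sub>R (LINT x|lborel. f (t + c *\<^sub>R x))"
    by (subst lborel_affine[OF c, of t])
       (simp add: integral_density integral_distr ennreal_power)
qed

section \<open>Differentiation under the integral sign; integrals of derivatives\<close>

lemma has_vector_derivative_iff_tendsto:
  "(f has_vector_derivative D) (at s) \<longleftrightarrow>
    ((\<lambda>t. (f t - f s) /\<^sub>R (t - s)) \<longlongrightarrow> D) (at s)"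
proof -
  have eq: "norm ((f t - f s) /\<^sub>R (t - s) - D) = norm ((f t - f s - (t - s) *\<^sub>R D) /\<^sub>R norm (t - s))"
    if "t \<noteq> s" for t
  proof -
    have "(f t - f s) /\<^sub>R (t - s) - D = (f t - f s - (t - s) *\<^sub>R D) /\<^sub>R (t - s)"
      using that by (simp add: scaleR_diff_right)
    then show ?thesis by simp
  qed
  have "((\<lambda>t. (f t - f s) /\<^sub>R (t - s)) \<longlongrightarrow> D) (at s) \<longleftrightarrow>
      ((\<lambda>t. norm ((f t - f s) /\<^sub>R (t - s) - D)) \<longlongrightarrow> 0) (at s)"
    by (simp only: tendsto_norm_zero_iff LIM_zero_iff)
  also have "\<dots> \<longleftrightarrow> ((\<lambda>t. norm ((f t - f s - (t - s) *\<^sub>R D) /\<^sub>R norm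
      (t - s))) \<longlongrightarrow> 0) (at s)"
    by (rule filterlim_cong) (auto simp: eventually_at_filter eq simp del: norm_scaleR)
  also have "\<dots> \<longleftrightarrow> (f has_vector_derivative D) (at s)"
    unfolding tendsto_norm_zero_iff
    by (simp add: has_vector_derivative_def has_derivative_at_within bounded_linear_scaleR_left)
  finally show ?thesis ..
qed

text \<open>The mean value inequality bounds the difference quotients by \<open>g\<close>, so that
  dominated convergence applies to them.\<close>

lemma has_vector_derivative_integral:
  fixes f :: "real \<Rightarrow> 'a \<Rightarrow> 'b::{banach,second_countable_topology}"
  assumes \<delta>: "\<delta> > 0"
    and der: "\<And>s x. \<bar>s - s0\<bar> < \<delta> \<Longrightarrow> x \<in> space M \<Longrightarrow>
      ((\<lambda>s. f s x) has_vector_derivative f' s x) (at s)"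
    and int: "\<And>s. \<bar>s - s0\<bar> < \<delta> \<Longrightarrow> integrable M (f s)"
    and meas: "f' s0 \<in> borel_measurable M"
    and bound: "\<And>s x. \<bar>s - s0\<bar> < \<delta> \<Longrightarrow> x \<in> space M \<Longrightarrow>
        norm (f' s x) \<le> g x"
    and g: "integrable M g"
  shows "((\<lambda>s. LINT x|M. f s x) has_vector_derivative (LINT x|M. f' s0 x)) (at s0)"
proof -
  have lip: "norm (f s x - f s0 x) \<le> g x * \<bar>s - s0\<bar>" if s: "\<bar>s - s0\<bar> < \<delta>" and x:
      "x \<in> space M" for s x
  proof -
    have "norm (f s x - f s0 x) \<le> g x * norm (s - s0)"
    proof (rule differentiable_bound[where S="{s0 - \<delta><..<s0 + \<delta>}" and f'="\<lambda>s h. h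
        *\<^sub>R f' s x"])
      fix t assume t: "t \<in> {s0 - \<delta><..<s0 + \<delta>}"
      then have "\<bar>t - s0\<bar> < \<delta>" by auto
      then show "((\<lambda>s. f s x) has_derivative (\<lambda>h. h *\<^sub>R f' t x)) (at t within {s0 -
          \<delta><..<s0 + \<delta>})"
        using der[of t x] x by (auto simp: has_vector_derivative_def intro: has_derivative_at_withinI)
      show "onorm (\<lambda>h. h *\<^sub>R f' t x) \<le> g x"
        using bound[OF \<open>\<bar>t - s0\<bar> < \<delta>\<close> x] onorm_scaleR_left[OF
            bounded_linear_ident, of "f' t x"]
        by (simp add: onorm_id)
    qed (use s in \<open>auto\<close>)
    then show ?thesis by simp
  qed
  have "((\<lambda>s. ((LINT x|M. f s x) - (LINT x|M. f s0 x)) /\<^sub>R (s - s0)) \<longlongrightarrow> (LINT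
      x|M. f' s0 x)) (at s0)"
    unfolding tendsto_at_iff_sequentially
  proof (intro allI impI)
    \<comment> \<open>Dominated convergence concerns sequences: the limit is tested along an
      arbitrary \<open>X\<close>, started at an index \<open>N\<close> from which it stays within
      \<open>\<delta>\<close> of \<open>s0\<close>.\<close>
    fix X :: "nat \<Rightarrow> real" assume X: "\<forall>i. X i \<in> UNIV - {s0}" "X \<longlonglongrightarrow> s0"
    have ev: "\<forall>\<^sub>F n in sequentially. \<bar>X n - s0\<bar> < \<delta>"
      using tendstoD[OF X(2) \<delta>] by (simp add: dist_real_def)
    then obtain N where N: "\<And>n. n \<ge> N \<Longrightarrow> \<bar>X n - s0\<bar> < \<delta>"
      by (auto simp: eventually_sequentially)
    have "(\<lambda>n. LINT x|M. (f (X (n + N)) x - f s0 x) /\<^sub>R (X (n + N) - s0))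
        \<longlonglongrightarrow> (LINT x|M. f' s0 x)"
    proof (rule integral_dominated_convergence[where w=g])
      show "(\<lambda>x. (f (X (n + N)) x - f s0 x) /\<^sub>R (X (n + N) - s0)) \<in> borel_measurable M" for n
        using int[OF N[of "n + N"]] int[of s0] \<delta> by (auto simp: integrable_iff_bounded)
      show "AE x in M. (\<lambda>n. (f (X (n + N)) x - f s0 x) /\<^sub>R (X (n + N) - s0))
          \<longlonglongrightarrow> f' s0 x"
      proof (rule AE_I2)
        fix x assume x: "x \<in> space M"
        have "((\<lambda>s. (f s x - f s0 x) /\<^sub>R (s - s0)) \<longlongrightarrow> f' s0 x) (at s0)"
          using der[of s0 x] x \<delta> by (simp add: has_vector_derivative_iff_tendsto)
        then have "((\<lambda>s. (f s x - f s0 x) /\<^sub>R (s - s0)) \<circ> X) \<longlonglongrightarrow> f' s0 x"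
          using X unfolding tendsto_at_iff_sequentially by blast
        from LIMSEQ_ignore_initial_segment[OF this, of N]
        show "(\<lambda>n. (f (X (n + N)) x - f s0 x) /\<^sub>R (X (n + N) - s0)) \<longlonglongrightarrow> f' s0 x"
          by (simp add: o_def)
      qed
      show "AE x in M. norm ((f (X (n + N)) x - f s0 x) /\<^sub>R (X (n + N) - s0)) \<le> g x" for n
        using lip[OF N[of "n + N"]] X(1) by (intro AE_I2) (simp add: divide_simps mult.commute)
    qed (use meas g in auto)
    moreover have "(LINT x|M. (f (X (n + N)) x - f s0 x) /\<^sub>R (X (n + N) - s0)) =
        ((LINT x|M. f (X (n + N)) x) - (LINT x|M. f s0 x)) /\<^sub>R (X (n + N) - s0)" for n
      using int[OF N[of "n + N"]] int[of s0] \<delta>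
      by (subst integral_scaleR_right) (simp add: Bochner_Integration.integral_diff)
    ultimately have "(\<lambda>n. (((\<lambda>s. ((LINT x|M. f s x) - (LINT x|M. f s0 x)) /\<^sub>R (s - s0))
        \<circ> X) (n + N)))
        \<longlonglongrightarrow> (LINT x|M. f' s0 x)"
      by (simp only: o_def)
    then show "((\<lambda>s. ((LINT x|M. f s x) - (LINT x|M. f s0 x)) /\<^sub>R (s - s0)) \<circ> X)
        \<longlonglongrightarrow> (LINT x|M. f' s0 x)"
      by (rule LIMSEQ_offset)
  qed
  then show ?thesis
    by (simp add: has_vector_derivative_iff_tendsto)
qed

lemma decay_iff: "(1 + norm x) ^ N * y \<le> C \<longleftrightarrow> y \<le> C * (1 / (1 + norm x) ^ N)" for x
    :: "'a::real_normed_vector" and y C :: real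
proof -
  have "0 < (1 + norm x) ^ N" by (simp add: add_pos_nonneg)
  then show ?thesis by (simp add: pos_le_divide_eq mult.commute)
qed

text \<open>By translation invariance the integral of \<open>f (x + s *\<^sub>R d)\<close> is
  constant in \<open>s\<close>; its derivative at 0, taken under the integral sign, is the integral
  of \<open>f'\<close>.\<close>

lemma integral_directional_derivative_eq_0:
  fixes f f' :: "'a::euclidean_space \<Rightarrow> complex"
  assumes der: "\<And>x. ((\<lambda>h. f (x + h *\<^sub>R d)) has_vector_derivative f' x) (at 0)"
    and f[measurable]: "f \<in> borel_measurable borel" and f'[measurable]: "f' \<in> borel_measurable borel"
    and bound: "\<And>x. (1 + norm x) ^ (2 * DIM('a)) * norm (f x) \<le> C"
    and bound': "\<And>x. (1 + norm x) ^ (2 * DIM('a)) * norm (f' x) \<le> C'"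
  shows "(LINT x|lborel. f' x) = 0"
proof -
  have int: "integrable lborel f"
    using integrable_decay(1)[OF f bound] .
  have shift: "(LINT x|lborel. f (x + s *\<^sub>R d)) = (LINT x|lborel. f x)" for s
    using lborel_integral_affine(2)[of 1 f "s *\<^sub>R d"] by (simp add: add.commute)
  have "((\<lambda>s. LINT x|lborel. f (x + s *\<^sub>R d)) has_vector_derivative (LINT x|lborel. f' (x + 0
      *\<^sub>R d))) (at 0)"
  proof (rule has_vector_derivative_integral[where \<delta>=1 and
      f'="\<lambda>s x. f' (x + s *\<^sub>R d)" and g="\<lambda>x. C' * (1 + norm d) ^ (2 * DIM('a)) * (1 / (1
          + norm x) ^ (2 * DIM('a)))"])
    fix s :: real and x :: 'a
    have "((\<lambda>k. f (x + s *\<^sub>R d + k *\<^sub>R d)) \<circ> (\<lambda>t. t - s)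
        has_vector_derivative 1 *\<^sub>R f' (x + s *\<^sub>R d)) (at s)"
      by (rule vector_diff_chain_at) (auto intro!: derivative_eq_intros der)
    then show "((\<lambda>s. f (x + s *\<^sub>R d)) has_vector_derivative f' (x + s *\<^sub>R d)) (at s)"
      by (simp add: o_def scaleR_left_diff_distrib algebra_simps)
    show "integrable lborel (\<lambda>x. f (x + s *\<^sub>R d))"
      using lborel_integral_affine(1)[of 1 f "s *\<^sub>R d"] int by (simp add: add.commute)
    assume s: "\<bar>s - 0\<bar> < 1"
    \<comment> \<open>The dominating function must not depend on \<open>s\<close>. For
      \<open>\<bar>s\<bar> < 1\<close> passing from the weight at \<open>x + s *\<^sub>R d\<close>
      to the one at \<open>x\<close> costs at most a factor \<open>1 + norm d\<close>, before powers
      are taken.\<close>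
    have "norm x = norm (x + s *\<^sub>R d - s *\<^sub>R d)" by simp
    also have "\<dots> \<le> norm (x + s *\<^sub>R d) + norm (s *\<^sub>R d)"
      by (rule norm_triangle_ineq4)
    also have "norm (s *\<^sub>R d) \<le> 1 * norm d"
      unfolding norm_scaleR by (rule mult_right_mono) (use s in auto)
    finally have "1 + norm x \<le> 1 + norm (x + s *\<^sub>R d) + norm d" by simp
    also have "\<dots> \<le> (1 + norm (x + s *\<^sub>R d)) * (1 + norm d)"
      by (simp add: algebra_simps)
    finally have "(1 + norm x) ^ (2 * DIM('a)) \<le> ((1 + norm (x + s *\<^sub>R d)) * (1 + norm d)) ^ (2 * DIM('a))"
      by (rule power_mono) simp
    then have "(1 + norm x) ^ (2 * DIM('a)) * norm (f' (x + s *\<^sub>R d))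
        \<le> ((1 + norm (x + s *\<^sub>R d)) * (1 + norm d)) ^ (2 * DIM('a)) * norm (f' (x + s *\<^sub>R d))"
      by (rule mult_right_mono) simp
    also have "\<dots> = ((1 + norm (x + s *\<^sub>R d)) ^ (2 * DIM('a)) * norm (f' (x + s *\<^sub>R d))) * (1
        + norm d) ^ (2 * DIM('a))"
      by (simp add: power_mult_distrib)
    also have "\<dots> \<le> C' * (1 + norm d) ^ (2 * DIM('a))"
      by (rule mult_right_mono[OF bound']) simp
    finally show "norm (f' (x + s *\<^sub>R d)) \<le> C' * (1 + norm d) ^ (2 * DIM('a)) * (1 / (1 + norm x) ^
        (2 * DIM('a)))"
      by (simp add: field_simps add_pos_nonneg)
  next
    show "integrable lborel (\<lambda>x::'a. C' * (1 + norm d) ^ (2 * DIM('a)) * (1 / (1 + norm x) ^ (2 * DIM('a))))"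
      by (intro integrable_mult_right integrable_polynomial_decay)
  qed auto
  then have "((\<lambda>s::real. LINT x|lborel. f x) has_vector_derivative (LINT x|lborel. f' x)) (at 0)"
    by (simp add: shift)
  moreover have "((\<lambda>s::real. LINT x|lborel. f x) has_vector_derivative 0) (at 0)"
    by (rule has_vector_derivative_const)
  ultimately show ?thesis
    by (rule vector_derivative_unique_at)
qed


section \<open>Gaussian integrals\<close>

text \<open>\<open>1 + r \<le> exp r\<close> absorbs the polynomial into the linear part of the
  exponent; completing the square leaves an explicit maximum.\<close>

lemma gaussian_decay:
  fixes a c :: real
  assumes "0 < a"
  obtains C where "\<And>x::'a::real_normed_vector. (1 + norm x) ^ N * exp (c * norm x - a * (norm x)\<^sup>2) \<le> C"
proof
  fix x :: 'a
  let ?r = "norm x"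
  have "(1 + ?r) ^ N \<le> exp ?r ^ N"
    by (rule power_mono) auto
  then have "(1 + ?r) ^ N * exp (c * ?r - a * ?r\<^sup>2) \<le> exp ?r ^ N * exp (c * ?r - a * ?r\<^sup>2)"
    by (rule mult_right_mono) simp
  also have "\<dots> = exp ((N + c) * ?r - a * ?r\<^sup>2)"
    by (simp add: exp_of_nat_mult[symmetric] exp_add[symmetric] algebra_simps)
  also have "(N + c) * ?r - a * ?r\<^sup>2 = (N + c)\<^sup>2 / (4 * a) - a * (?r - (N + c) / (2 * a))\<^sup>2"
    using assms by (simp add: field_simps power2_eq_square)
  also have "exp \<dots> \<le> exp ((N + c)\<^sup>2 / (4 * a))"
    using assms by simp
  finally show "(1 + norm x) ^ N * exp (c * norm x - a * (norm x)\<^sup>2) \<le> exp ((N + c)\<^sup>2 / (4 * a))" .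
qed

text \<open>Reduces a derivative in a real parameter to a complex derivative of the same expression,
  to which the usual derivative rules apply.\<close>

lemma has_vector_derivative_complex_of_real:
  assumes "(f has_field_derivative f') (at (complex_of_real s))"
  shows "((\<lambda>x. f (complex_of_real x)) has_vector_derivative f') (at s)"
  using field_vector_diff_chain_at[of complex_of_real 1 s f f'] assms
    has_vector_derivative_of_real[OF DERIV_ident, of "at s"] by (simp add: o_def)

text \<open>
  Only the square of \<open>gauss a\<close> is needed for complex \<open>a\<close>: position and momentum contribute equal
  factors.  This avoids choosing a branch of the square root of \<open>pi / a\<close>.
\<close>

definition gauss :: "complex \<Rightarrow> complex" where
  "gauss a = (LINT x|lborel. exp (- a * complex_of_real x ^ 2))"

lemma norm_gaussian: "norm (exp (- a * complex_of_real x ^ 2 + b * complex_of_real x)) = exp (Re b * x - Re a *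
    x\<^sup>2)"
  by (simp add: Re_power2)

text \<open>The bound is uniform in \<open>a\<close> and \<open>b\<close>; it supplies the
  dominating functions for differentiating Gaussian integrals in these parameters.\<close>

lemma power_gaussian_decay:
  assumes "0 < \<alpha>"
  obtains C where "\<And>a b x. \<alpha> \<le> Re a \<Longrightarrow> norm b \<le> \<beta> \<Longrightarrow>
    (1 + norm x) ^ N * norm (complex_of_real x ^ k * exp (- a * complex_of_real x ^ 2 + b * complex_of_real x)) \<le> C"
proof -
  obtain C where C: "\<And>x::real. (1 + norm x) ^ (N + k) * exp (\<beta> * norm x - \<alpha> * (norm
      x)\<^sup>2) \<le> C"
    using gaussian_decay[OF assms, of "N + k" \<beta>, where 'a=real] by blast
  show ?thesis
  proof
    fix a b :: complex and x :: real assume a: "\<alpha> \<le> Re a" and b: "norm b \<le> \<beta>"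
    have "Re b * x \<le> \<bar>Re b\<bar> * \<bar>x\<bar>"
      by (metis abs_ge_self abs_mult)
    also have "\<dots> \<le> \<beta> * norm x"
      using b abs_Re_le_cmod[of b] by (intro mult_mono) auto
    finally have 1: "Re b * x - Re a * x\<^sup>2 \<le> \<beta> * norm x - \<alpha> * (norm x)\<^sup>2"
      using mult_right_mono[OF a, of "x\<^sup>2"] by simp
    have "\<bar>x\<bar> ^ k \<le> (1 + \<bar>x\<bar>) ^ k"
      by (rule power_mono) auto
    then have "(1 + norm x) ^ N * norm (complex_of_real x ^ k * exp (- a * complex_of_real x ^ 2 + b *
        complex_of_real x))
        \<le> (1 + norm x) ^ N * ((1 + norm x) ^ k * exp (\<beta> * norm x - \<alpha> * (norm x)\<^sup>2))"
      unfolding norm_mult norm_gaussian using 1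
      by (intro mult_left_mono mult_mono) (auto simp: norm_power)
    also have "\<dots> \<le> C"
      using C[of x] by (simp add: power_add mult.assoc)
    finally show "(1 + norm x) ^ N * norm (complex_of_real x ^ k * exp (- a * complex_of_real x ^ 2 + b *
        complex_of_real x)) \<le> C" .
  qed
qed

lemma integrable_power_gaussian:
  assumes "0 < Re a"
  shows "integrable lborel (\<lambda>x. complex_of_real x ^ k * exp (- a * complex_of_real x ^ 2 + b *
      complex_of_real x))"
proof -
  obtain C where "\<And>x. (1 + norm x) ^ 2 * norm (complex_of_real x ^ k * exp (- a * complex_of_real x ^ 2 +
      b * complex_of_real x)) \<le> C"
    using power_gaussian_decay[OF assms, of "norm b" 2 k] by (metis order_refl)
  then show ?thesis
    by (intro integrable_decay(1)) auto
qed

lemma integrable_gaussian: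
  assumes "0 < Re a"
  shows "integrable lborel (\<lambda>x. exp (- a * complex_of_real x ^ 2 + b * complex_of_real x))"
  using integrable_power_gaussian[OF assms, of 0 b] by simp

text \<open>The derivative of \<open>x^k * exp (- a * x^2 + b * x)\<close> has integral 0. The cases
  \<open>k = 0\<close> and \<open>k = 1\<close> give the first and the second moment; for
  \<open>k = 0\<close> the truncated \<open>k - 1\<close> is multiplied by 0.\<close>

lemma gaussian_moment_recursion:
  assumes a: "0 < Re a"
  shows "of_nat k * (LINT x|lborel. complex_of_real x ^ (k - 1) * exp (- a * complex_of_real x ^ 2 + b *
      complex_of_real x))
    - 2 * a * (LINT x|lborel. complex_of_real x ^ Suc k * exp (- a * complex_of_real x ^ 2 + b * complex_of_real x))
    + b * (LINT x|lborel. complex_of_real x ^ k * exp (- a * complex_of_real x ^ 2 + b * complex_of_real x)) = 0"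
proof -
  define g where "g = (\<lambda>k x. complex_of_real x ^ k * exp (- a * complex_of_real x ^ 2 + b * complex_of_real x))"
  have int: "integrable lborel (g k)" for k
    unfolding g_def by (rule integrable_power_gaussian[OF a])
  have dec: "\<exists>C. \<forall>x. (1 + norm x) ^ 2 * norm (g k x) \<le> C" for k
    unfolding g_def using power_gaussian_decay[OF a, of "norm b" 2 k] by (metis order_refl)
  obtain C where C: "(1 + norm x) ^ 2 * norm (g k x) \<le> C" for x
    using dec by blast
  obtain C1 C2 C3 where C': "(1 + norm x) ^ 2 * norm (g (k - 1) x) \<le> C1"
    "(1 + norm x) ^ 2 * norm (g (Suc k) x) \<le> C2" "(1 + norm x) ^ 2 * norm (g k x) \<le> C3" for x
    using dec by metis
  have "(LINT x|lborel. of_nat k * g (k - 1) x - 2 * a * g (Suc k) x + b * g k x) = 0"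
  proof (rule integral_directional_derivative_eq_0[where f="g k" and d=1 and C=C and
      C'="of_nat k * C1 + norm (2 * a) * C2 + norm b * C3"])
    fix x :: real
    show "((\<lambda>h. g k (x + h *\<^sub>R 1)) has_vector_derivative
        (of_nat k * g (k - 1) x - 2 * a * g (Suc k) x + b * g k x)) (at 0)"
    proof -
      have "((\<lambda>h. (complex_of_real x + h) ^ k * exp (- a * (complex_of_real x + h) ^ 2 + b *
          (complex_of_real x + h)))
          has_field_derivative of_nat k * g (k - 1) x - 2 * a * g (Suc k) x + b * g k x) (at (complex_of_real 0))"
        unfolding g_def by (auto intro!: derivative_eq_intros simp: algebra_simps)
      from has_vector_derivative_complex_of_real[OF this] show ?thesis
        by (simp add: g_def)
    qed
    have "(1 + norm x) ^ 2 * norm (of_nat k * g (k - 1) x - 2 * a * g (Suc k) x + b * g k x)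
      \<le> (1 + norm x) ^ 2 * (of_nat k * norm (g (k - 1) x) + norm (2 * a) * norm (g (Suc k) x) + norm b *
          norm (g k x))"
      by (intro mult_left_mono order_trans[OF norm_triangle_ineq] add_mono order_trans[OF norm_triangle_ineq4])
         (auto simp: norm_mult)
    also have "\<dots> = of_nat k * ((1 + norm x) ^ 2 * norm (g (k - 1) x)) +
        norm (2 * a) * ((1 + norm x) ^ 2 * norm (g (Suc k) x)) + norm b * ((1 + norm x) ^ 2 * norm (g k x))"
      by (simp add: algebra_simps)
    also have "\<dots> \<le> of_nat k * C1 + norm (2 * a) * C2 + norm b * C3"
      by (intro add_mono mult_left_mono C') auto
    finally show "(1 + norm x) ^ (2 * DIM(real)) * norm (of_nat k * g (k - 1) x - 2 * a * g (Suc k) x + b * g k x)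
       \<le> of_nat k * C1 + norm (2 * a) * C2 + norm b * C3" by simp
    show "(1 + norm x) ^ (2 * DIM(real)) * norm (g k x) \<le> C"
      using C by simp
  qed (auto simp: g_def)
  moreover have "(LINT x|lborel. of_nat k * g (k - 1) x - 2 * a * g (Suc k) x + b * g k x) =
      of_nat k * (LINT x|lborel. g (k - 1) x) - 2 * a * (LINT x|lborel. g (Suc k) x) + b * (LINT x|lborel. g k x)"
    using int by (simp add: Bochner_Integration.integral_add Bochner_Integration.integral_diff)
  ultimately show ?thesis
    unfolding g_def by simp
qed

text \<open>With \<open>b\<close> scaled by a real \<open>s\<close>, the moment recursion turns the
  derivative of the integral \<open>K\<close> into the linear equation
  \<open>K' = s * b^2 / (2 * a) * K\<close>. Dividing by its explicit solution leaves a constant,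
  which is compared at 0 and 1. No contour is shifted.\<close>

lemma gaussian_integral_linear:
  assumes a: "0 < Re a"
  shows "(LINT x|lborel. exp (- a * complex_of_real x ^ 2 + b * complex_of_real x)) = gauss a * exp (b ^ 2 / (4 * a))"
proof -
  have a0: "a \<noteq> 0" using a by auto
  define K where "K s = (LINT x|lborel. exp (- a * complex_of_real x ^ 2 + (complex_of_real s * b) *
      complex_of_real x))" for s :: real
  have K': "(K has_vector_derivative (complex_of_real s * b ^ 2 / (2 * a)) * K s) (at s)" for s
  proof -
    obtain C where C: "\<And>c x. norm c \<le> (\<bar>s\<bar> + 1) * norm b \<Longrightarrow>
        (1 + norm x) ^ 2 * norm (complex_of_real x ^ 1 * exp (- a * complex_of_real x ^ 2 + c * complex_of_real
            x)) \<le> C"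
      using power_gaussian_decay[OF a, of "(\<bar>s\<bar> + 1) * norm b" 2 1] by (metis order_refl)
    have "(K has_vector_derivative (LINT x|lborel. b * (complex_of_real x ^ 1 * exp (- a * complex_of_real x ^
        2 + (complex_of_real s * b) * complex_of_real x)))) (at s)"
      unfolding K_def[abs_def]
    proof (rule has_vector_derivative_integral[where \<delta>=1 and g="\<lambda>x. norm b * C * (1 / (1 + norm
        x) ^ (2 * DIM(real)))"
         and f'="\<lambda>s x. b * (complex_of_real x ^ 1 * exp (- a * complex_of_real x ^ 2 + (complex_of_real
             s * b) * complex_of_real x))"])
      fix t x :: real
      have "((\<lambda>t. exp (- a * complex_of_real x ^ 2 + t * b * complex_of_real x)) has_field_derivative
         b * (complex_of_real x ^ 1 * exp (- a * complex_of_real x ^ 2 + (complex_of_real t * b) *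
             complex_of_real x))) (at (complex_of_real t))"
        by (auto intro!: derivative_eq_intros simp: algebra_simps)
      from has_vector_derivative_complex_of_real[OF this]
      show "((\<lambda>t. exp (- a * complex_of_real x ^ 2 + (complex_of_real t * b) * complex_of_real x))
          has_vector_derivative
         b * (complex_of_real x ^ 1 * exp (- a * complex_of_real x ^ 2 + (complex_of_real t * b) *
             complex_of_real x))) (at t)" .
      show "integrable lborel (\<lambda>x. exp (- a * complex_of_real x ^ 2 + (complex_of_real t * b) *
          complex_of_real x))"
        by (rule integrable_gaussian[OF a])
      assume t: "\<bar>t - s\<bar> < 1"
      have "norm (complex_of_real t * b) \<le> (\<bar>s\<bar> + 1) * norm b"
        unfolding norm_mult by (rule mult_right_mono) (use t in auto)
      from mult_left_mono[OF C[OF this, of x] norm_ge_zero[of b]]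
      show "norm (b * (complex_of_real x ^ 1 * exp (- a * complex_of_real x ^ 2 + (complex_of_real t * b) *
          complex_of_real x)))
          \<le> norm b * C * (1 / (1 + norm x) ^ (2 * DIM(real)))"
        unfolding decay_iff[symmetric] by (simp add: norm_mult mult.assoc mult.left_commute)
    next
      show "integrable lborel (\<lambda>x::real. norm b * C * (1 / (1 + norm x) ^ (2 * DIM(real))))"
        by (intro integrable_mult_right integrable_polynomial_decay)
    qed auto
    moreover have "(LINT x|lborel. b * (complex_of_real x ^ 1 * exp (- a * complex_of_real x ^ 2 +
        (complex_of_real s * b) * complex_of_real x)))
        = (complex_of_real s * b ^ 2 / (2 * a)) * K s"
      using gaussian_moment_recursion[OF a, of 0 "complex_of_real s * b"] a0
      by (simp add: K_def field_simps power2_eq_square)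
    ultimately show ?thesis by simp
  qed
  define L where "L s = K s * exp (- (complex_of_real s ^ 2 * b ^ 2 / (4 * a)))" for s
  have "(L has_vector_derivative 0) (at s within UNIV)" for s
  proof -
    have "((\<lambda>s. exp (- (complex_of_real s ^ 2 * b ^ 2 / (4 * a)))) has_vector_derivative
        - (complex_of_real s * b ^ 2 / (2 * a)) * exp (- (complex_of_real s ^ 2 * b ^ 2 / (4 * a)))) (at s)"
      by (rule has_vector_derivative_complex_of_real) (auto intro!: derivative_eq_intros simp: a0 field_simps)
    from has_vector_derivative_mult[OF K' this]
    show ?thesis unfolding L_def[abs_def] by (simp add: algebra_simps)
  qed
  from has_vector_derivative_zero_constant[OF convex_UNIV this]
  obtain c where c: "\<And>s. L s = c" by auto
  have "L 1 = L 0" by (simp add: c)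
  then show ?thesis
    by (simp add: L_def K_def gauss_def exp_minus field_simps)
qed

lemma gauss_of_1: "gauss 1 = complex_of_real (sqrt pi)"
proof -
  have "has_bochner_integral lborel (\<lambda>x. exp (- x\<^sup>2) :: real) (sqrt pi)"
    using has_bochner_integral_even_function[OF gaussian_moment_0] by simp
  then have "(LINT x|lborel. exp (- x\<^sup>2 :: real)) = sqrt pi"
    by (rule has_bochner_integral_integral_eq)
  then show ?thesis
    unfolding gauss_def
    by (subst integral_complex_of_real[symmetric, of lborel "\<lambda>x. exp (- x\<^sup>2)", THEN trans[rotated]])
       (simp_all add: exp_of_real[symmetric])
qed

text \<open>Along the segment from 1 to \<open>a\<close> the product of \<open>\<gamma>\<close> and \<open>(gauss \<gamma>)\<^sup>2\<close> has derivative zero.\<close>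

lemma gauss_square:
  assumes a: "0 < Re a"
  shows "gauss a ^ 2 = of_real pi / a"
proof -
  define \<gamma> where "\<gamma> s = 1 + complex_of_real s * (a - 1)" for s
  \<comment> \<open>\<open>2 * \<alpha>\<close> is the least real part on the segment. The
    derivatives at its end points are two-sided, so \<open>\<delta>\<close> is chosen to keep
    \<open>Re (\<gamma> t)\<close> above \<open>\<alpha>\<close> slightly beyond them.\<close>
  define \<alpha> where "\<alpha> = min 1 (Re a) / 2"
  have \<alpha>: "0 < \<alpha>" using a by (simp add: \<alpha>_def)
  obtain \<delta> where \<delta>: "0 < \<delta>" "\<delta> * \<bar>Re a - 1\<bar> \<le> \<alpha>"
  proof
    show "0 < \<alpha> / (\<bar>Re a - 1\<bar> + 1)" using \<alpha> by simp
    show "\<alpha> / (\<bar>Re a - 1\<bar> + 1) * \<bar>Re a - 1\<bar> \<le> \<alpha>" using \<alpha> by (simp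
        add: field_simps)
  qed
  have Re\<gamma>: "\<alpha> \<le> Re (\<gamma> t)" if t: "\<bar>t - s\<bar> < \<delta>" and s: "0 \<le> s" "s
      \<le> 1" for s t
  proof -
    have "2 * \<alpha> \<le> (1 - s) * 1 + s * Re a"
    proof -
      have "(1 - s) * (2 * \<alpha>) + s * (2 * \<alpha>) \<le> (1 - s) * 1 + s * Re a"
        using s by (intro add_mono mult_left_mono) (auto simp: \<alpha>_def)
      then show ?thesis by (simp add: algebra_simps)
    qed
    moreover have "\<bar>(t - s) * (Re a - 1)\<bar> \<le> \<alpha>"
      unfolding abs_mult using t \<delta> by (intro order_trans[OF mult_right_mono \<delta>(2)]) auto
    ultimately show ?thesis
      by (simp add: \<gamma>_def algebra_simps)
  qed
  have G': "((\<lambda>s. gauss (\<gamma> s)) has_vector_derivative - (a - 1) / (2 * \<gamma> s) * gauss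
      (\<gamma> s)) (at s)"
    if s: "0 \<le> s" "s \<le> 1" for s
  proof -
    have R: "0 < Re (\<gamma> s)" using Re\<gamma>[of s s] s \<delta> \<alpha> by simp
    then have \<gamma>0: "\<gamma> s \<noteq> 0" by auto
    obtain C where C: "\<And>a x. \<alpha> \<le> Re a \<Longrightarrow>
        (1 + norm x) ^ 2 * norm (complex_of_real x ^ 2 * exp (- a * complex_of_real x ^ 2 + 0 * complex_of_real
            x)) \<le> C"
      using power_gaussian_decay[OF \<alpha>, of 0 2 2] by (metis order_refl norm_zero)
    have "((\<lambda>s. gauss (\<gamma> s)) has_vector_derivative
      (LINT x|lborel. - (a - 1) * (complex_of_real x ^ 2 * exp (- \<gamma> s * complex_of_real x ^ 2)))) (at s)"
      unfolding gauss_def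
    proof (rule has_vector_derivative_integral[where \<delta>=\<delta> and g="\<lambda>x. norm (a - 1) * C * (1
        / (1 + norm x) ^ (2 * DIM(real)))"
         and f'="\<lambda>s x. - (a - 1) * (complex_of_real x ^ 2 * exp (- \<gamma> s * complex_of_real x ^ 2))"])
      fix t x :: real
      show "((\<lambda>t. exp (- \<gamma> t * complex_of_real x ^ 2)) has_vector_derivative
         - (a - 1) * (complex_of_real x ^ 2 * exp (- \<gamma> t * complex_of_real x ^ 2))) (at t)"
        unfolding \<gamma>_def
        by (rule has_vector_derivative_complex_of_real) (auto intro!: derivative_eq_intros simp: algebra_simps)
      assume t: "\<bar>t - s\<bar> < \<delta>"
      have Rt: "\<alpha> \<le> Re (\<gamma> t)" by (rule Re\<gamma>[OF t s])
      show "integrable lborel (\<lambda>x. exp (- \<gamma> t * complex_of_real x ^ 2))"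
        using integrable_gaussian[of "\<gamma> t" 0] Rt \<alpha> by simp
      from mult_left_mono[OF C[OF Rt, of x] norm_ge_zero[of "a - 1"]]
      show "norm (- (a - 1) * (complex_of_real x ^ 2 * exp (- \<gamma> t * complex_of_real x ^ 2)))
          \<le> norm (a - 1) * C * (1 / (1 + norm x) ^ (2 * DIM(real)))"
        unfolding decay_iff[symmetric]
        by (simp add: norm_mult norm_minus_commute mult.assoc mult.left_commute)
    next
      show "integrable lborel (\<lambda>x::real. norm (a - 1) * C * (1 / (1 + norm x) ^ (2 * DIM(real))))"
        by (intro integrable_mult_right integrable_polynomial_decay)
    qed (use \<delta> in auto)
    moreover have "(LINT x|lborel. - (a - 1) * (complex_of_real x ^ 2 * exp (- \<gamma> s * complex_of_real x ^ 2)))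
        = - (a - 1) / (2 * \<gamma> s) * gauss (\<gamma> s)"
    proof -
      have "(LINT x|lborel. complex_of_real x ^ 2 * exp (- \<gamma> s * complex_of_real x ^ 2)) = gauss
          (\<gamma> s) / (2 * \<gamma> s)"
      proof -
        have "gauss (\<gamma> s) - 2 * \<gamma> s * (LINT x|lborel. complex_of_real x ^ 2 * exp (- \<gamma> s *
            complex_of_real x ^ 2)) = 0"
          using gaussian_moment_recursion[OF R, of 1 0] by (simp add: gauss_def power2_eq_square)
        moreover have "M = G / (2 * c)" if "G - 2 * c * M = 0" "c \<noteq> 0" for M G c :: complex
          using that by (simp add: field_simps)
        ultimately show ?thesis
          using \<gamma>0 by blast
      qed
      then show ?thesis
        unfolding integral_mult_right_zero by simp
    qed
    ultimately show ?thesis by simp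
  qed
  have "((\<lambda>s. \<gamma> s * gauss (\<gamma> s) ^ 2) has_vector_derivative 0) (at s within {0..1})" if s:
      "s \<in> {0..1}" for s
  proof -
    have s': "0 \<le> s" "s \<le> 1" using s by auto
    have "\<gamma> s \<noteq> 0" using Re\<gamma>[of s s] s \<delta> \<alpha> by auto
    have "(\<gamma> has_vector_derivative (a - 1)) (at s)"
      unfolding \<gamma>_def by (rule has_vector_derivative_complex_of_real) (auto intro!: derivative_eq_intros)
    note der = has_vector_derivative_mult[OF this has_vector_derivative_mult[OF G'[OF s'] G'[OF s']]]
    have "((\<lambda>s. \<gamma> s * (gauss (\<gamma> s) * gauss (\<gamma> s))) has_vector_derivative 0) (at s)"
    proof (rule has_vector_derivative_eq_rhs[OF der])
      have "c * (g * (- (a - 1) / (2 * c) * g) + - (a - 1) / (2 * c) * g * g) + (a - 1) * (g * g) = 0"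
        if "c \<noteq> 0" for c g :: complex
        using that by (simp add: divide_simps) (simp add: algebra_simps)
      then show "\<gamma> s * (gauss (\<gamma> s) * (- (a - 1) / (2 * \<gamma> s) * gauss (\<gamma> s)) + - (a
          - 1) / (2 * \<gamma> s) * gauss (\<gamma> s) * gauss (\<gamma> s))
          + (a - 1) * (gauss (\<gamma> s) * gauss (\<gamma> s)) = 0"
        using \<open>\<gamma> s \<noteq> 0\<close> by blast
    qed
    then show ?thesis
      unfolding power2_eq_square by (rule has_vector_derivative_at_within)
  qed
  from has_vector_derivative_zero_constant[OF _ this]
  obtain c where c: "\<And>s. s \<in> {0..1} \<Longrightarrow> \<gamma> s * gauss (\<gamma> s) ^ 2 = c"
    by auto
  have "\<gamma> 1 * gauss (\<gamma> 1) ^ 2 = \<gamma> 0 * gauss (\<gamma> 0) ^ 2"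
    using c[of 0] c[of 1] by simp
  then show ?thesis
  proof -
    have "a * gauss a ^ 2 = complex_of_real (sqrt pi) ^ 2"
      using \<open>\<gamma> 1 * gauss (\<gamma> 1) ^ 2 = \<gamma> 0 * gauss (\<gamma> 0) ^ 2\<close> by (simp
          add: \<gamma>_def gauss_of_1)
    also have "complex_of_real (sqrt pi) ^ 2 = complex_of_real ((sqrt pi) ^ 2)"
      by (rule of_real_power[symmetric])
    also have "(sqrt pi) ^ 2 = pi" by simp
    finally show ?thesis
      using a by (auto simp: eq_divide_eq mult.commute)
  qed
qed

text \<open>Positivity of the integrand selects the root of \<open>gauss_square\<close>.\<close>

lemma gauss_of_real:
  assumes "0 < r"
  shows "gauss (complex_of_real r) = complex_of_real (sqrt (pi / r))"
proof -
  define I :: real where "I = (LINT x|lborel. exp (- r * x\<^sup>2))"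
  have g: "gauss (complex_of_real r) = complex_of_real I"
    unfolding gauss_def I_def
    by (subst integral_complex_of_real[symmetric, of lborel "\<lambda>x. exp (- r * x\<^sup>2)", THEN trans[rotated]])
       (simp_all add: exp_of_real[symmetric])
  have "0 \<le> I" unfolding I_def by (rule Bochner_Integration.integral_nonneg) simp
  moreover have "I ^ 2 = pi / r"
    using gauss_square[of "complex_of_real r"] assms unfolding g
    by (metis Re_complex_of_real of_real_divide of_real_eq_iff of_real_power)
  ultimately show ?thesis
    unfolding g by (metis real_sqrt_unique)
qed

section \<open>Schwartz functions\<close>

definition rapidly_decreasing :: "('a::real_normed_vector \<Rightarrow> complex) \<Rightarrow> bool" where
  "rapidly_decreasing f \<longleftrightarrow> (\<forall>N. \<exists>C. \<forall>x. (1 + norm x) ^ N * norm (f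
      x) \<le> C)"

lemma rapidly_decreasingD:
  assumes "rapidly_decreasing f"
  obtains C where "0 \<le> C" "\<And>x. (1 + norm x) ^ N * norm (f x) \<le> C"
proof -
  obtain C where C: "\<And>x. (1 + norm x) ^ N * norm (f x) \<le> C"
    using assms by (auto simp: rapidly_decreasing_def)
  have "0 \<le> C" by (rule order_trans[OF _ C[of 0]]) simp
  with C show ?thesis using that by blast
qed

lemma schwartz_iff:
  "schwartz \<phi> \<longleftrightarrow> (\<forall>ds \<in> lists Basis. (\<forall>x. iter_partial ds \<phi>
      differentiable (at x)) \<and>
     rapidly_decreasing (iter_partial ds \<phi>))"
proof -
  have "bounded (range (\<lambda>x. (1 + norm x) ^ N *\<^sub>R f x)) \<longleftrightarrow> (\<exists>C.
      \<forall>x. (1 + norm x) ^ N * norm (f x) \<le> C)"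
    for f :: "'a \<Rightarrow> complex" and N
    by (auto simp: bounded_iff abs_of_nonneg)
  then show ?thesis
    unfolding schwartz_def rapidly_decreasing_def by simp
qed

lemma rapidly_decreasing_add:
  assumes "rapidly_decreasing f" "rapidly_decreasing g"
  shows "rapidly_decreasing (\<lambda>x. f x + g x)"
  unfolding rapidly_decreasing_def
proof
  fix N
  obtain C D where "\<And>x. (1 + norm x) ^ N * norm (f x) \<le> C" "\<And>x. (1 + norm x) ^ N * norm (g x) \<le> D"
    using assms by (meson rapidly_decreasingD)
  then have "(1 + norm x) ^ N * norm (f x + g x) \<le> C + D" for x
    using mult_left_mono[OF norm_triangle_ineq[of "f x" "g x"], of "(1 + norm x) ^ N"]
    by (smt (verit, best) distrib_left norm_ge_zero zero_le_power)
  then show "\<exists>C. \<forall>x. (1 + norm x) ^ N * norm (f x + g x) \<le> C" by blast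
qed

lemma rapidly_decreasing_bound:
  assumes f: "rapidly_decreasing f" and g: "\<And>x. norm (g x) \<le> K * (1 + norm x) ^ k * norm (f x)"
  shows "rapidly_decreasing g"
  unfolding rapidly_decreasing_def
proof
  fix N
  obtain C where C: "\<And>x. (1 + norm x) ^ (N + k) * norm (f x) \<le> C"
    using rapidly_decreasingD[OF f] by metis
  have "(1 + norm x) ^ N * norm (g x) \<le> \<bar>K\<bar> * C" for x
  proof -
    have "(1 + norm x) ^ N * norm (g x) \<le> (1 + norm x) ^ N * (K * (1 + norm x) ^ k * norm (f x))"
      by (intro mult_left_mono g) simp
    also have "\<dots> = K * ((1 + norm x) ^ (N + k) * norm (f x))"
      by (simp add: power_add)
    also have "\<dots> \<le> \<bar>K\<bar> * ((1 + norm x) ^ (N + k) * norm (f x))"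
      by (intro mult_right_mono) auto
    also have "\<dots> \<le> \<bar>K\<bar> * C"
      by (intro mult_left_mono C) simp
    finally show ?thesis .
  qed
  then show "\<exists>C. \<forall>x. (1 + norm x) ^ N * norm (g x) \<le> C" by blast
qed

section \<open>Partial derivatives and closure properties of the Schwartz class\<close>

lemma has_partial:
  assumes "f differentiable (at x)"
  shows "((\<lambda>h. f (x + h *\<^sub>R d)) has_vector_derivative partial d f x) (at 0)"
proof -
  have "(\<lambda>h. f (x + h *\<^sub>R d)) differentiable (at 0)"
  proof (rule differentiable_compose[of f])
    show "(\<lambda>h. x + h *\<^sub>R d) differentiable (at (0::real))"
      by (intro derivative_intros)
  qed (use assms in simp)
  then show ?thesis
    unfolding partial_def by (simp add: vector_derivative_works)
qed

lemma partialI: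
  "((\<lambda>h. f (x + h *\<^sub>R d)) has_vector_derivative D) (at 0) \<Longrightarrow> partial d f x = D"
  unfolding partial_def by (rule vector_derivative_at)

lemma iter_partial_append: "iter_partial (ds @ es) f = iter_partial ds (iter_partial es f)"
  by (induction ds) auto

text \<open>Replaces formulas for iterated derivatives by a class of functions that is stable under
  single partial derivatives.\<close>

lemma schwartz_coinduct:
  assumes "\<phi> \<in> S"
    and "\<And>f x. f \<in> S \<Longrightarrow> f differentiable (at x)"
    and "\<And>f. f \<in> S \<Longrightarrow> rapidly_decreasing f"
    and "\<And>f d. f \<in> S \<Longrightarrow> d \<in> Basis \<Longrightarrow> partial d f \<in> S"
  shows "schwartz \<phi>"
proof -
  have "iter_partial ds \<phi> \<in> S" if "ds \<in> lists Basis" for ds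
    using that by (induction ds) (auto simp: assms)
  then show ?thesis
    using assms(2,3) by (auto simp: schwartz_iff)
qed

lemma schwartz_differentiable: "schwartz \<phi> \<Longrightarrow> \<phi> differentiable (at x)"
  by (force simp: schwartz_iff dest: bspec[of _ _ "[]"])

lemma schwartz_rapidly_decreasing: "schwartz \<phi> \<Longrightarrow> rapidly_decreasing \<phi>"
  by (force simp: schwartz_iff dest: bspec[of _ _ "[]"])

lemma schwartz_partial:
  assumes "schwartz \<phi>" "d \<in> Basis"
  shows "schwartz (partial d \<phi>)"
  unfolding schwartz_iff
proof
  fix ds :: "'a list" assume "ds \<in> lists Basis"
  then have "ds @ [d] \<in> lists Basis" using assms by auto
  with assms(1) have "(\<forall>x. iter_partial (ds @ [d]) \<phi> differentiable (at x)) \<and>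
      rapidly_decreasing (iter_partial (ds @ [d]) \<phi>)"
    unfolding schwartz_iff by blast
  then show "(\<forall>x. iter_partial ds (partial d \<phi>) differentiable (at x)) \<and> rapidly_decreasing
      (iter_partial ds (partial d \<phi>))"
    by (simp add: iter_partial_append)
qed

text \<open>Polynomial multiples of \<open>B\<close> and their sums: the class to which
  \<open>schwartz_coinduct\<close> is applied, both for one Gaussian and for the set of all Schwartz
  functions.\<close>

inductive_set polynomial_hull :: "('a::euclidean_space \<Rightarrow> complex) set \<Rightarrow> ('a
    \<Rightarrow> complex) set"
  for B where
  base: "f \<in> B \<Longrightarrow> f \<in> polynomial_hull B"
| coord: "f \<in> polynomial_hull B \<Longrightarrow> d \<in> Basis \<Longrightarrow> (\<lambda>x.
    complex_of_real (x \<bullet> d) * f x) \<in> polynomial_hull B"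
| add: "f \<in> polynomial_hull B \<Longrightarrow> g \<in> polynomial_hull B \<Longrightarrow> (\<lambda>x. f
    x + g x) \<in> polynomial_hull B"
| scale: "f \<in> polynomial_hull B \<Longrightarrow> (\<lambda>x. c * f x) \<in> polynomial_hull B"

lemma partial_add:
  assumes "f differentiable (at x)" "g differentiable (at x)"
  shows "partial d (\<lambda>x. f x + g x) x = partial d f x + partial d g x"
  by (intro partialI has_vector_derivative_add has_partial assms)

lemma partial_cmult:
  assumes "f differentiable (at x)"
  shows "partial d (\<lambda>x. c * f x) x = c * partial d f x"
  by (intro partialI has_vector_derivative_mult_right has_partial assms)

lemma partial_mult:
  assumes "f differentiable (at x)" "g differentiable (at x)"
  shows "partial d (\<lambda>x. f x * g x) x = f x * partial d g x + partial d f x * g x"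
  using has_vector_derivative_mult[OF has_partial[OF assms(1)] has_partial[OF assms(2)]]
  by (intro partialI) simp

lemma partial_inner:
  "partial e (\<lambda>x. complex_of_real (x \<bullet> d)) x = complex_of_real (e \<bullet> d)"
proof (rule partialI)
  have "((\<lambda>h. complex_of_real (x \<bullet> d) + h * complex_of_real (e \<bullet> d))
      has_field_derivative complex_of_real (e \<bullet> d)) (at (complex_of_real 0))"
    by (auto intro!: derivative_eq_intros)
  from has_vector_derivative_complex_of_real[OF this]
  show "((\<lambda>h. complex_of_real ((x + h *\<^sub>R e) \<bullet> d)) has_vector_derivative complex_of_real
      (e \<bullet> d)) (at 0)"
    by (simp add: inner_simps)
qed

lemma differentiable_of_real_inner:
  "(\<lambda>x. complex_of_real (x \<bullet> d)) differentiable (at x)"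
  by (rule bounded_linear_imp_differentiable)
     (intro bounded_linear_compose[OF bounded_linear_of_real] bounded_linear_inner_left)

text \<open>By the product rule the hull is stable under partial derivatives as soon as the
  derivatives of its generators lie in it. For a Gaussian these are the Gaussian times a linear
  polynomial.\<close>

lemma polynomial_hull_schwartz:
  assumes B: "\<And>f x. f \<in> B \<Longrightarrow> f differentiable (at x)" "\<And>f. f \<in> B
      \<Longrightarrow> rapidly_decreasing f"
    "\<And>f d. f \<in> B \<Longrightarrow> d \<in> Basis \<Longrightarrow> partial d f \<in> polynomial_hull B"
    and \<phi>: "\<phi> \<in> polynomial_hull B"
  shows "schwartz \<phi>"
proof (rule schwartz_coinduct[OF \<phi>])
  have diff: "f differentiable (at x)" if "f \<in> polynomial_hull B" for f x
    using that
    by induction (auto intro: B(1) differentiable_mult differentiable_add differentiable_of_real_inner)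
  then show "f differentiable (at x)" if "f \<in> polynomial_hull B" for f x
    using that by blast
  show "rapidly_decreasing f" if "f \<in> polynomial_hull B" for f
    using that
  proof induction
    case (coord f d)
    then show ?case
    proof (intro rapidly_decreasing_bound[OF coord.IH, where K=1 and k=1])
      fix x
      have "\<bar>x \<bullet> d\<bar> \<le> 1 + norm x"
        using Basis_le_norm[OF coord.hyps(2), of x] by simp
      then show "norm (complex_of_real (x \<bullet> d) * f x) \<le> 1 * (1 + norm x) ^ 1 * norm (f x)"
        by (simp add: norm_mult mult_right_mono)
    qed
  next
    case (scale f c)
    then show ?case
      by (intro rapidly_decreasing_bound[OF scale.IH, where K="norm c" and k=0]) (simp add: norm_mult)
  qed (auto intro: B rapidly_decreasing_add)
  show "partial d f \<in> polynomial_hull B" if "f \<in> polynomial_hull B" "d \<in> Basis" for f d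
    using that(1)
  proof induction
    case (coord f e)
    have "partial d (\<lambda>x. complex_of_real (x \<bullet> e) * f x) = (\<lambda>x. complex_of_real (x
        \<bullet> e) * partial d f x + complex_of_real (d \<bullet> e) * f x)"
      by (rule ext) (simp add: partial_mult diff coord differentiable_of_real_inner partial_inner)
    then show ?case
      using coord by (auto intro!: polynomial_hull.add polynomial_hull.coord polynomial_hull.scale)
  next
    case (add f g)
    have "partial d (\<lambda>x. f x + g x) = (\<lambda>x. partial d f x + partial d g x)"
      by (rule ext) (simp add: partial_add diff add)
    then show ?case using add by (auto intro!: polynomial_hull.add)
  next
    case (scale f c)
    have "partial d (\<lambda>x. c * f x) = (\<lambda>x. c * partial d f x)"
      by (rule ext) (simp add: partial_cmult diff scale)
    then show ?case using scale by (auto intro!: polynomial_hull.scale)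
  qed (use that B in auto)
qed

text \<open>With all Schwartz functions as generators this gives stability under coordinates, sums
  and scalars at once.\<close>

lemma polynomial_hull_schwartz_eq:
  assumes "\<phi> \<in> polynomial_hull (Collect schwartz)"
  shows "schwartz \<phi>"
  by (rule polynomial_hull_schwartz[OF _ _ _ assms])
     (auto intro: schwartz_differentiable schwartz_rapidly_decreasing schwartz_partial polynomial_hull.base)

lemma schwartz_coord: "schwartz \<phi> \<Longrightarrow> d \<in> Basis \<Longrightarrow> schwartz (\<lambda>x.
    complex_of_real (x \<bullet> d) * \<phi> x)"
  and schwartz_add: "schwartz \<phi> \<Longrightarrow> schwartz \<psi> \<Longrightarrow> schwartz (\<lambda>x.
      \<phi> x + \<psi> x)"
  and schwartz_cmult: "schwartz \<phi> \<Longrightarrow> schwartz (\<lambda>x. c * \<phi> x)"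
  by (intro polynomial_hull_schwartz_eq polynomial_hull.coord polynomial_hull.add polynomial_hull.scale
      polynomial_hull.base; simp)+

lemma schwartz_diff: "schwartz \<phi> \<Longrightarrow> schwartz \<psi> \<Longrightarrow> schwartz (\<lambda>x.
    \<phi> x - \<psi> x)"
  using schwartz_add[of \<phi> "\<lambda>x. (-1) * \<psi> x"] schwartz_cmult[of \<psi> "-1"] by simp

lemma schwartz_zero: "schwartz (\<lambda>x. 0)"
proof (rule schwartz_coinduct[where S="{\<lambda>x. 0}"])
  show "partial d f \<in> {\<lambda>x. 0}" if "f \<in> {\<lambda>x. 0}" for f :: "'a \<Rightarrow> complex" and d
    using that by (auto simp: partial_def)
qed (auto simp: rapidly_decreasing_def)

lemma schwartz_sum: "(\<And>i. i \<in> I \<Longrightarrow> schwartz (\<phi> i)) \<Longrightarrow> schwartz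
    (\<lambda>x. \<Sum>i\<in>I. \<phi> i x)"
  by (induction I rule: infinite_finite_induct) (auto intro: schwartz_zero schwartz_add)

lemma schwartz_continuous: "schwartz \<phi> \<Longrightarrow> continuous_on A \<phi>"
  by (meson continuous_at_imp_continuous_on differentiable_imp_continuous_within schwartz_differentiable)

lemma schwartz_measurable[measurable_dest]: "schwartz \<phi> \<Longrightarrow> \<phi> \<in> borel_measurable borel"
  by (intro borel_measurable_continuous_onI schwartz_continuous)

lemma rapidly_decreasing_mult:
  assumes "rapidly_decreasing f" "rapidly_decreasing g"
  shows "rapidly_decreasing (\<lambda>x. f x * g x)"
proof -
  obtain C where "\<And>x. (1 + norm x) ^ 0 * norm (g x) \<le> C"
    using rapidly_decreasingD[OF assms(2)] by metis
  then show ?thesis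
    by (intro rapidly_decreasing_bound[OF assms(1), where k=0 and K=C])
       (auto simp: norm_mult mult.commute[of C] intro!: mult_left_mono)
qed

lemma rapidly_decreasing_integrable:
  assumes "rapidly_decreasing f" "f \<in> borel_measurable borel"
  shows "integrable lborel (f :: 'a::euclidean_space \<Rightarrow> complex)"
  using rapidly_decreasingD[OF assms(1), of "2 * DIM('a)"] integrable_decay(1)[OF assms(2)] by metis

lemma rapidly_decreasing_L2:
  assumes "rapidly_decreasing f" "f \<in> borel_measurable borel"
  shows "f \<in> L2"
proof -
  note [measurable] = assms(2)
  have "integrable lborel (\<lambda>x. norm (f x * f x))"
    by (intro integrable_norm rapidly_decreasing_integrable rapidly_decreasing_mult assms) measurable
  then show ?thesis
    using assms(2) by (simp add: L2_def norm_mult power2_eq_square)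
qed

lemma schwartz_L2: "schwartz \<phi> \<Longrightarrow> \<phi> \<in> L2"
  by (intro rapidly_decreasing_L2 schwartz_rapidly_decreasing schwartz_measurable)

lemma integral_partial_eq_0:
  fixes f :: "'a::euclidean_space \<Rightarrow> complex"
  assumes "\<And>x. f differentiable (at x)" "rapidly_decreasing f" "rapidly_decreasing (partial d f)"
    "partial d f \<in> borel_measurable borel"
  shows "(LINT x|lborel. partial d f x) = 0"
proof -
  obtain C where C: "\<And>x. (1 + norm x) ^ (2 * DIM('a)) * norm (f x) \<le> C"
    using rapidly_decreasingD[OF assms(2)] by metis
  obtain C' where C': "\<And>x. (1 + norm x) ^ (2 * DIM('a)) * norm (partial d f x) \<le> C'"
    using rapidly_decreasingD[OF assms(3)] by metis
  have "f \<in> borel_measurable borel"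
    by (intro borel_measurable_continuous_onI continuous_at_imp_continuous_on ballI
        differentiable_imp_continuous_within assms(1))
  then show ?thesis
    by (rule integral_directional_derivative_eq_0[OF has_partial[OF assms(1)] _ assms(4) C C'])
qed

lemma partial_cnj:
  assumes "f differentiable (at x)"
  shows "partial d (\<lambda>x. cnj (f x)) x = cnj (partial d f x)"
  by (intro partialI bounded_linear.has_vector_derivative[OF bounded_linear_cnj] has_partial assms)

lemma borel_measurable_cnj [measurable]: "cnj \<in> borel_measurable borel"
  by (intro borel_measurable_continuous_onI continuous_intros)

lemma schwartz_integration_by_parts:
  assumes f: "schwartz f" and g: "schwartz g" and d: "d \<in> Basis"
  shows "(LINT x|lborel. partial d f x * cnj (g x)) = - (LINT x|lborel. f x * cnj (partial d g x))"
proof -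
  note sd = schwartz_partial[OF _ d]
  note rd = schwartz_rapidly_decreasing
  have cnj_rd: "rapidly_decreasing (\<lambda>x. cnj (h x))" if "schwartz h" for h :: "'a \<Rightarrow> complex"
    by (rule rapidly_decreasing_bound[OF rd[OF that], where k=0 and K=1]) simp
  have cnj_diff: "(\<lambda>x. cnj (h x)) differentiable (at x)" if "schwartz h" for h :: "'a \<Rightarrow>
      complex" and x
    by (rule differentiable_compose[of cnj, OF bounded_linear_imp_differentiable[OF bounded_linear_cnj]
          schwartz_differentiable[OF that]])
  have [measurable]: "f \<in> borel_measurable borel" "g \<in> borel_measurable borel"
    "partial d f \<in> borel_measurable borel" "partial d g \<in> borel_measurable borel"
    using f g sd by (auto intro: schwartz_measurable)
  have eq: "partial d (\<lambda>x. f x * cnj (g x)) = (\<lambda>x. f x * cnj (partial d g x) + partial d f x *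
      cnj (g x))"
    by (rule ext) (simp add: partial_mult cnj_diff f g schwartz_differentiable partial_cnj)
  moreover have "(LINT x|lborel. partial d (\<lambda>x. f x * cnj (g x)) x) = 0"
  proof (rule integral_partial_eq_0)
    show "(\<lambda>x. f x * cnj (g x)) differentiable (at x)" for x
      by (intro differentiable_mult cnj_diff schwartz_differentiable f g)
    show "rapidly_decreasing (\<lambda>x. f x * cnj (g x))"
      by (intro rapidly_decreasing_mult cnj_rd rd f g)
    show "rapidly_decreasing (partial d (\<lambda>x. f x * cnj (g x)))"
      unfolding eq by (intro rapidly_decreasing_add rapidly_decreasing_mult cnj_rd rd sd f g)
    show "partial d (\<lambda>x. f x * cnj (g x)) \<in> borel_measurable borel"
      unfolding eq by measurable
  qed
  moreover have "integrable lborel (\<lambda>x. f x * cnj (partial d g x))" "integrable lborel (\<lambda>x.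
      partial d f x * cnj (g x))"
    by (intro rapidly_decreasing_integrable rapidly_decreasing_mult cnj_rd rd sd f g; measurable)+
  ultimately show ?thesis
    unfolding eq by (simp add: Bochner_Integration.integral_add eq_neg_iff_add_eq_0 add.commute)
qed

section \<open>The space of square integrable functions\<close>

text \<open>Conjugate linear in the second argument, in contrast to the bilinear
  \<open>distribution_of\<close> and \<open>weyl_pairing\<close>; a conjugate of the test function
  appears whenever one passes between them.\<close>

definition l2_inner :: "('a::euclidean_space \<Rightarrow> complex) \<Rightarrow> ('a \<Rightarrow> complex)
    \<Rightarrow> complex" where
  "l2_inner f g = (LINT x|lborel. f x * cnj (g x))"

lemma L2_measurable[measurable_dest]: "f \<in> L2 \<Longrightarrow> f \<in> borel_measurable borel"
  by (simp add: L2_def)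

lemma L2_integrable_norm_mult:
  assumes "f \<in> L2" "g \<in> L2"
  shows "integrable lborel (\<lambda>x. norm (f x) * norm (g x))"
proof (rule Bochner_Integration.integrable_bound)
  note [measurable] = L2_measurable[OF assms(1)] L2_measurable[OF assms(2)]
  show "integrable lborel (\<lambda>x. (norm (f x))\<^sup>2 + (norm (g x))\<^sup>2)"
    using assms by (auto simp: L2_def)
  show "(\<lambda>x. norm (f x) * norm (g x)) \<in> borel_measurable lborel"
    by measurable
  have "a * b \<le> a\<^sup>2 + b\<^sup>2" if "0 \<le> a" "0 \<le> b" for a b :: real
    using sum_squares_bound[of a b] mult_nonneg_nonneg[OF that] by linarith
  then show "AE x in lborel. norm (norm (f x) * norm (g x)) \<le> norm ((norm (f x))\<^sup>2 + (norm (g x))\<^sup>2)"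
    by simp
qed

lemma L2_integrable_mult:
  assumes "f \<in> L2" "g \<in> L2"
  shows "integrable lborel (\<lambda>x. f x * g x)"
proof -
  note [measurable] = L2_measurable[OF assms(1)] L2_measurable[OF assms(2)]
  show ?thesis
    by (rule Bochner_Integration.integrable_bound[OF L2_integrable_norm_mult[OF assms]]) (auto simp: norm_mult)
qed

lemma L2_add: "f \<in> L2 \<Longrightarrow> g \<in> L2 \<Longrightarrow> (\<lambda>x. f x + g x) \<in> L2"
proof -
  assume f: "f \<in> L2" and g: "g \<in> L2"
  note [measurable] = L2_measurable[OF f] L2_measurable[OF g]
  have "integrable lborel (\<lambda>x. (norm (f x))\<^sup>2 + 2 * (norm (f x) * norm (g x)) + (norm (g x))\<^sup>2)"
    using f g L2_integrable_norm_mult[OF f g] by (auto simp: L2_def)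
  then have "integrable lborel (\<lambda>x. (norm (f x + g x))\<^sup>2)"
  proof (rule Bochner_Integration.integrable_bound)
    show "AE x in lborel. norm ((norm (f x + g x))\<^sup>2) \<le> norm ((norm (f x))\<^sup>2 + 2 * (norm (f x)
        * norm (g x)) + (norm (g x))\<^sup>2)"
    proof (rule AE_I2)
      fix x
      have "(norm (f x + g x))\<^sup>2 \<le> (norm (f x) + norm (g x))\<^sup>2"
        by (intro power_mono norm_triangle_ineq) auto
      then show "norm ((norm (f x + g x))\<^sup>2) \<le> norm ((norm (f x))\<^sup>2 + 2 * (norm (f x) * norm (g
          x)) + (norm (g x))\<^sup>2)"
        by (simp add: power2_sum)
    qed
  qed measurable
  then show ?thesis by (simp add: L2_def)
qed

lemma L2_cmult: "f \<in> L2 \<Longrightarrow> (\<lambda>x. c * f x) \<in> L2"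
  by (auto simp: L2_def norm_mult power_mult_distrib)

lemma L2_zero: "(\<lambda>x. 0) \<in> L2"
  by (simp add: L2_def)

lemma L2_diff: "f \<in> L2 \<Longrightarrow> g \<in> L2 \<Longrightarrow> (\<lambda>x. f x - g x) \<in> L2"
  using L2_add[of f "\<lambda>x. (-1) * g x"] L2_cmult[of g "-1"] by simp

lemma L2_cnj: "f \<in> L2 \<Longrightarrow> (\<lambda>x. cnj (f x)) \<in> L2"
  by (auto simp: L2_def)

lemma L2_sum: "(\<And>i. i \<in> I \<Longrightarrow> f i \<in> L2) \<Longrightarrow> (\<lambda>x.
    \<Sum>i\<in>I. f i x) \<in> L2"
  by (induction I rule: infinite_finite_induct) (auto intro: L2_zero L2_add)

lemmas L2_intros = L2_add L2_cmult L2_zero L2_diff L2_cnj L2_sum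

lemma integrable_l2_inner: "f \<in> L2 \<Longrightarrow> g \<in> L2 \<Longrightarrow> integrable lborel
    (\<lambda>x. f x * cnj (g x))"
  by (intro L2_integrable_mult L2_cnj)

lemma l2_inner_add_left: "f \<in> L2 \<Longrightarrow> g \<in> L2 \<Longrightarrow> h \<in> L2
    \<Longrightarrow> l2_inner (\<lambda>x. f x + g x) h = l2_inner f h + l2_inner g h"
  by (simp add: l2_inner_def distrib_right Bochner_Integration.integral_add integrable_l2_inner)

lemma l2_inner_diff_left: "f \<in> L2 \<Longrightarrow> g \<in> L2 \<Longrightarrow> h \<in> L2
    \<Longrightarrow> l2_inner (\<lambda>x. f x - g x) h = l2_inner f h - l2_inner g h"
  by (simp add: l2_inner_def left_diff_distrib Bochner_Integration.integral_diff integrable_l2_inner)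

lemma l2_inner_cmult_left: "l2_inner (\<lambda>x. c * f x) g = c * l2_inner f g"
  by (simp add: l2_inner_def mult.assoc)

lemma l2_inner_zero_left: "l2_inner (\<lambda>x. 0) g = 0"
  by (simp add: l2_inner_def)

lemma l2_inner_sum_left:
  "(\<And>i. i \<in> I \<Longrightarrow> f i \<in> L2) \<Longrightarrow> g \<in> L2 \<Longrightarrow> l2_inner
      (\<lambda>x. \<Sum>i\<in>I. f i x) g = (\<Sum>i\<in>I. l2_inner (f i) g)"
  by (induction I rule: infinite_finite_induct) (auto simp: l2_inner_zero_left l2_inner_add_left L2_sum)

lemma l2_inner_commute: "cnj (l2_inner f g) = l2_inner g f"
proof -
  have "cnj (LINT x|lborel. f x * cnj (g x)) = (LINT x|lborel. cnj (f x * cnj (g x)))"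
    by (rule Bochner_Integration.integral_cnj[symmetric])
  then show ?thesis by (simp add: l2_inner_def mult.commute)
qed

lemma L2_norm_power2: "(L2_norm f)\<^sup>2 = (LINT x|lborel. (norm (f x))\<^sup>2)"
  unfolding L2_norm_def by (rule real_sqrt_pow2) simp

lemma L2_norm_nonneg: "0 \<le> L2_norm f"
  by (simp add: L2_norm_def)

lemma l2_inner_self: "l2_inner f f = complex_of_real ((L2_norm f)\<^sup>2)"
  unfolding L2_norm_power2 l2_inner_def complex_norm_square[symmetric] integral_complex_of_real ..

lemma L2_norm_eq_0:
  assumes "f \<in> L2"
  shows "L2_norm f = 0 \<longleftrightarrow> (AE x in lborel. f x = 0)"
proof -
  have "L2_norm f = 0 \<longleftrightarrow> (LINT x|lborel. (norm (f x))\<^sup>2) = 0"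
    by (simp add: L2_norm_def)
  also have "\<dots> \<longleftrightarrow> (AE x in lborel. (norm (f x))\<^sup>2 = 0)"
    by (rule integral_nonneg_eq_0_iff_AE) (use assms in \<open>auto simp: L2_def\<close>)
  finally show ?thesis by simp
qed

lemma L2_norm_cong_AE:
  assumes "f \<in> L2" "g \<in> L2" "AE x in lborel. f x = g x"
  shows "L2_norm f = L2_norm g"
proof -
  note [measurable] = L2_measurable[OF assms(1)] L2_measurable[OF assms(2)]
  show ?thesis unfolding L2_norm_def
    by (intro arg_cong[where f=sqrt] integral_cong_AE) (use assms(3) in auto)
qed

lemma l2_inner_cong_AE:
  assumes "f \<in> L2" "f' \<in> L2" "g \<in> L2" "AE x in lborel. f x = f' x"
  shows "l2_inner f g = l2_inner f' g"
proof -
  note [measurable] = L2_measurable[OF assms(1)] L2_measurable[OF assms(2)] L2_measurable[OF assms(3)]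
  show ?thesis unfolding l2_inner_def
    by (intro integral_cong_AE) (use assms(4) in auto)
qed

lemma L2_norm_cmult: "L2_norm (\<lambda>x. c * f x) = norm c * L2_norm f"
  by (simp add: L2_norm_def norm_mult power_mult_distrib real_sqrt_mult)

lemma L2_norm_minus_commute: "L2_norm (\<lambda>x. f x - g x) = L2_norm (\<lambda>x. g x - f x)"
  by (simp add: L2_norm_def norm_minus_commute)

lemma L2_norm_cnj: "L2_norm (\<lambda>x. cnj (f x)) = L2_norm f"
  by (simp add: L2_norm_def)

lemma L2_norm_add_power2:
  assumes "f \<in> L2" "g \<in> L2"
  shows "(L2_norm (\<lambda>x. f x + g x))\<^sup>2 = (L2_norm f)\<^sup>2 + 2 * Re (l2_inner f g) + (L2_norm g)\<^sup>2"
proof -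
  note L = L2_intros assms
  have c: "cnj (l2_inner h (\<lambda>x. f x + g x)) = l2_inner f h + l2_inner g h" if "h \<in> L2" for h
    using l2_inner_add_left[OF assms that] by (simp add: l2_inner_commute)
  have "complex_of_real ((L2_norm (\<lambda>x. f x + g x))\<^sup>2) = l2_inner f (\<lambda>x. f x + g x) +
      l2_inner g (\<lambda>x. f x + g x)"
    unfolding l2_inner_self[symmetric] by (rule l2_inner_add_left) (intro L)+
  also have "\<dots> = cnj (l2_inner f f + l2_inner g f) + cnj (l2_inner f g + l2_inner g g)"
    using c[OF assms(1), symmetric] c[OF assms(2), symmetric] by simp
  also have "Re \<dots> = (L2_norm f)\<^sup>2 + 2 * Re (l2_inner f g) + (L2_norm g)\<^sup>2"
    using arg_cong[OF l2_inner_commute[of f g], of Re] by (simp add: l2_inner_self)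
  finally show ?thesis by simp
qed

lemma L2_Cauchy_Schwarz:
  assumes f: "f \<in> L2" and g: "g \<in> L2"
  shows "norm (l2_inner f g) \<le> L2_norm f * L2_norm g"
proof (cases "L2_norm g = 0")
  case True
  then have "AE x in lborel. g x = 0" using L2_norm_eq_0[OF g] by simp
  then have "l2_inner g f = l2_inner (\<lambda>x. 0) f"
    by (intro l2_inner_cong_AE f g L2_zero) auto
  then show ?thesis
    using l2_inner_commute[of g f] True by (simp add: l2_inner_zero_left)
next
  case False
  define B where "B = (L2_norm g)\<^sup>2"
  have B: "0 < B" using False by (simp add: B_def)
  define c where "c = - (l2_inner f g / complex_of_real B)"
  have "0 \<le> (L2_norm (\<lambda>x. f x + c * g x))\<^sup>2" by simp
  also have "\<dots> = (L2_norm f)\<^sup>2 + 2 * Re (l2_inner f (\<lambda>x. c * g x)) + (norm c)\<^sup>2 * B"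
    by (simp add: L2_norm_add_power2 f g L2_intros L2_norm_cmult power_mult_distrib B_def)
  also have "l2_inner f (\<lambda>x. c * g x) = cnj c * l2_inner f g"
    using l2_inner_commute[of "\<lambda>x. c * g x" f] by (simp add: l2_inner_cmult_left l2_inner_commute)
  also have "\<dots> = - complex_of_real ((norm (l2_inner f g))\<^sup>2 / B)"
    unfolding c_def using complex_norm_square[of "l2_inner f g"] by (simp add: mult.commute)
  also have "(norm c)\<^sup>2 * B = (norm (l2_inner f g))\<^sup>2 / B"
    using B by (simp add: c_def norm_divide power_divide power2_eq_square)
  finally have "(norm (l2_inner f g))\<^sup>2 \<le> (L2_norm f)\<^sup>2 * B"
    using B by (simp add: field_simps)
  then have "(norm (l2_inner f g))\<^sup>2 \<le> (L2_norm f * L2_norm g)\<^sup>2"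
    by (simp add: B_def power_mult_distrib)
  then show ?thesis
    by (rule power2_le_imp_le) (simp add: L2_norm_nonneg)
qed

lemma l2_inner_tendsto:
  assumes "\<And>n. f n \<in> L2" "g \<in> L2" "h \<in> L2" "((\<lambda>n. L2_norm (\<lambda>x. f n x - g x))
      \<longlongrightarrow> 0) F"
  shows "((\<lambda>n. l2_inner (f n) h) \<longlongrightarrow> l2_inner g h) F"
proof -
  have "((\<lambda>n. l2_inner (f n) h - l2_inner g h) \<longlongrightarrow> 0) F"
  proof (rule Lim_null_comparison)
    show "\<forall>\<^sub>F n in F. norm (l2_inner (f n) h - l2_inner g h) \<le> L2_norm (\<lambda>x. f n x - g
        x) * L2_norm h"
      using L2_Cauchy_Schwarz[of "\<lambda>x. f _ x - g x" h] assms
      by (intro always_eventually allI) (simp add: l2_inner_diff_left L2_diff)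
    show "((\<lambda>n. L2_norm (\<lambda>x. f n x - g x) * L2_norm h) \<longlongrightarrow> 0) F"
      using tendsto_mult_right[OF assms(4), of "L2_norm h"] by simp
  qed
  then show ?thesis by (simp add: LIM_zero_iff)
qed

text \<open>A rapidly Cauchy subsequence converges almost everywhere; Fatou's lemma identifies its
  pointwise limit as the limit of the whole sequence in norm.\<close>

lemma Riesz_Fischer:
  fixes s :: "nat \<Rightarrow> 'a::euclidean_space \<Rightarrow> complex"
  assumes s: "\<And>n. s n \<in> L2"
    and Cauchy: "\<And>\<epsilon>. 0 < \<epsilon> \<Longrightarrow> \<exists>N. \<forall>m\<ge>N.
        \<forall>n\<ge>N. L2_norm (\<lambda>x. s m x - s n x) < \<epsilon>"
  obtains g where "g \<in> L2" "(\<lambda>n. L2_norm (\<lambda>x. s n x - g x)) \<longlonglongrightarrow> 0"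
proof -
  note [measurable] = L2_measurable[OF s]
  define M where "M k = (SOME N. \<forall>m\<ge>N. \<forall>n\<ge>N. L2_norm (\<lambda>x. s m x - s n x) <
      (1/2) ^ k)" for k :: nat
  have M: "L2_norm (\<lambda>x. s m x - s n x) < (1/2) ^ k" if "m \<ge> M k" "n \<ge> M k" for m n k
    using someI_ex[OF Cauchy[of "(1/2) ^ k"]] that unfolding M_def by auto
  \<comment> \<open>The sum makes \<open>r l\<close> at least \<open>M k\<close> for all
    \<open>l \<ge> k\<close>, so consecutive terms of the subsequence differ by less than
    \<open>(1/2)^k\<close>; the summand \<open>k\<close> makes \<open>r\<close> tend to
    infinity.\<close>
  define r where "r k = (\<Sum>j\<le>k. M j) + k" for k
  have rM: "M k \<le> r l" if "k \<le> l" for k l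
  proof -
    have "M k \<le> (\<Sum>j\<le>l. M j)" using that by (intro member_le_sum) auto
    then show ?thesis by (simp add: r_def)
  qed
  define d where "d k x = s (r (Suc k)) x - s (r k) x" for k x
  have d: "d k \<in> L2" for k unfolding d_def by (intro L2_diff s)
  note [measurable] = L2_measurable[OF d]
  have d_norm: "L2_norm (d k) \<le> (1/2) ^ k" for k
    unfolding d_def using M[OF rM rM, of k "Suc k" k] by simp
  \<comment> \<open>Pairing with a positive function in \<open>L\<^sup>2\<close> turns the bounds on \<open>L2_norm (d k)\<close> into summable \<open>L\<^sup>1\<close> bounds.\<close>
  define h where "h x = complex_of_real (1 / (1 + norm (x::'a)) ^ DIM('a))" for x
  have h_meas: "h \<in> borel_measurable borel"
    unfolding h_def by measurable
  have h: "h \<in> L2"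
    using integrable_polynomial_decay[where 'a='a] h_meas
    by (simp add: L2_def h_def norm_divide norm_power power_divide abs_of_nonneg
        add_nonneg_nonneg power_mult mult.commute flip: of_real_add)
  note [measurable] = L2_measurable[OF h]
  have h0: "norm (h x) > 0" for x
  proof -
    have "0 < (1 + norm x) ^ DIM('a)" by (simp add: add_pos_nonneg)
    then show ?thesis by (simp add: h_def del: of_real_divide of_real_power)
  qed
  have "(\<integral>\<^sup>+x. (suminf (\<lambda>k. ennreal (norm (d k x) * norm (h x)))) \<partial>lborel) =
      (suminf (\<lambda>k. \<integral>\<^sup>+x. ennreal (norm (d k x) * norm (h x)) \<partial>lborel))"
    by (rule nn_integral_suminf) measurable
  also have "\<dots> = (suminf (\<lambda>k. ennreal (LINT x|lborel. norm (d k x) * norm (h x))))"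
    by (subst nn_integral_eq_integral[OF L2_integrable_norm_mult[OF d h]]) auto
  also have "\<dots> \<le> (suminf (\<lambda>k. ennreal ((1/2) ^ k * L2_norm h)))"
  proof (intro suminf_le ennreal_leI summableI)
    fix k
    have nL2: "(\<lambda>x. complex_of_real (norm (f x))) \<in> L2" if "f \<in> L2" for f :: "'a \<Rightarrow> complex"
      using that by (auto simp: L2_def)
    have "(LINT x|lborel. norm (d k x) * norm (h x)) = norm (l2_inner (\<lambda>x. norm (d k x)) (\<lambda>x.
        norm (h x)))"
      unfolding l2_inner_def
      by (simp flip: of_real_mult add: integral_complex_of_real)
    also have "\<dots> \<le> L2_norm (d k) * L2_norm h"
      using L2_Cauchy_Schwarz[OF nL2[OF d] nL2[OF h], of k] by (simp add: L2_norm_def)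
    also have "\<dots> \<le> (1/2) ^ k * L2_norm h"
      by (intro mult_right_mono d_norm L2_norm_nonneg)
    finally show "(LINT x|lborel. norm (d k x) * norm (h x)) \<le> (1/2) ^ k * L2_norm h" .
  qed
  also have "\<dots> < \<infinity>"
  proof -
    have "summable (\<lambda>k. (1/2) ^ k * L2_norm h)"
      by (intro summable_mult2 summable_geometric) simp
    then have "(suminf (\<lambda>k. ennreal ((1/2) ^ k * L2_norm h))) = ennreal (suminf (\<lambda>k. (1/2) ^ k
        * L2_norm h))"
      by (intro suminf_ennreal2) (auto simp: L2_norm_nonneg)
    then show ?thesis by simp
  qed
  finally have "AE x in lborel. (suminf (\<lambda>k. ennreal (norm (d k x) * norm (h x)))) \<noteq> \<infinity>"
    by (intro nn_integral_PInf_AE) auto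
  then have AE: "AE x in lborel. convergent (\<lambda>n. s (r n) x)"
  proof eventually_elim
    case (elim x)
    then have "summable (\<lambda>k. norm (d k x) * norm (h x))"
      by (intro summable_suminf_not_top) auto
    from summable_mult2[OF this, of "inverse (norm (h x))"] have "summable (\<lambda>k. norm (d k x))"
      using h0[of x] by (simp add: mult.assoc)
    then have "convergent (\<lambda>n. \<Sum>k<n. d k x)"
      by (rule summable_norm_cancel[THEN summable_iff_convergent[THEN iffD1]])
    then have "convergent (\<lambda>n. s (r 0) x + (\<Sum>k<n. d k x))"
      by (intro convergent_add convergent_const)
    moreover have "s (r 0) x + (\<Sum>k<n. d k x) = s (r n) x" for n
      unfolding d_def using sum_lessThan_telescope[of "\<lambda>k. s (r k) x" n] by simp
    ultimately show ?case by simp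
  qed
  define g where "g x = lim (\<lambda>n. s (r n) x)" for x
  have g[measurable]: "g \<in> borel_measurable borel"
    unfolding g_def by measurable
  have lim: "AE x in lborel. (\<lambda>n. s (r n) x) \<longlonglongrightarrow> g x"
    using AE by eventually_elim (simp add: g_def convergent_LIMSEQ_iff)
  have r_ge: "n \<le> r n" for n by (simp add: r_def)
  \<comment> \<open>Formulated with the nonnegative integral because \<open>s m - g\<close> is not
    yet known to be square integrable; this follows from the bound.\<close>
  have fatou: "(\<integral>\<^sup>+x. ennreal ((norm (s m x - g x))\<^sup>2) \<partial>lborel) \<le> ennreal
      (\<epsilon>\<^sup>2)"
    if \<epsilon>: "0 < \<epsilon>" and N: "\<And>n. n \<ge> N \<Longrightarrow> L2_norm (\<lambda>x. s m x - s
        n x) \<le> \<epsilon>" for m N \<epsilon>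
  proof -
    have "(\<integral>\<^sup>+x. ennreal ((norm (s m x - g x))\<^sup>2) \<partial>lborel)
        = (\<integral>\<^sup>+x. liminf (\<lambda>k. ennreal ((norm (s m x - s (r k) x))\<^sup>2)) \<partial>lborel)"
    proof (rule nn_integral_cong_AE)
      show "AE x in lborel. ennreal ((norm (s m x - g x))\<^sup>2) = liminf (\<lambda>k. ennreal ((norm (s m x
          - s (r k) x))\<^sup>2))"
        using lim
      proof eventually_elim
        case (elim x)
        have "(\<lambda>k. ennreal ((norm (s m x - s (r k) x))\<^sup>2)) \<longlonglongrightarrow> ennreal
            ((norm (s m x - g x))\<^sup>2)"
          by (intro tendsto_intros elim)
        then show ?case
          by (rule lim_imp_Liminf[OF trivial_limit_sequentially, symmetric])
      qed
    qed
    also have "\<dots> \<le> liminf (\<lambda>k. \<integral>\<^sup>+x. ennreal ((norm (s m x - s (r k)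
        x))\<^sup>2) \<partial>lborel)"
      by (rule nn_integral_liminf) measurable
    also have "\<dots> \<le> ennreal (\<epsilon>\<^sup>2)"
    proof (rule Liminf_le)
      show "\<forall>\<^sub>F k in sequentially. (\<integral>\<^sup>+x. ennreal ((norm (s m x - s (r k)
          x))\<^sup>2) \<partial>lborel) \<le> ennreal (\<epsilon>\<^sup>2)"
        unfolding eventually_sequentially
      proof (intro exI[of _ N] allI impI)
        fix k assume "k \<ge> N"
        have "(\<integral>\<^sup>+x. ennreal ((norm (s m x - s (r k) x))\<^sup>2) \<partial>lborel) = ennreal
            ((L2_norm (\<lambda>x. s m x - s (r k) x))\<^sup>2)"
          unfolding L2_norm_power2
          by (rule nn_integral_eq_integral) (use L2_diff[OF s s, of m "r k"] in \<open>auto simp: L2_def\<close>)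
        also have "\<dots> \<le> ennreal (\<epsilon>\<^sup>2)"
          using N[of "r k"] \<open>k \<ge> N\<close> r_ge[of k] by (intro ennreal_leI power_mono) (auto simp:
              L2_norm_nonneg)
        finally show "(\<integral>\<^sup>+x. ennreal ((norm (s m x - s (r k) x))\<^sup>2) \<partial>lborel)
            \<le> ennreal (\<epsilon>\<^sup>2)" .
      qed
    qed simp
    finally show ?thesis .
  qed
  have diff: "(\<lambda>x. s m x - g x) \<in> L2 \<and> L2_norm (\<lambda>x. s m x - g x) \<le> \<epsilon>"
    if \<epsilon>: "0 < \<epsilon>" and N: "\<And>n. n \<ge> N \<Longrightarrow> L2_norm (\<lambda>x. s m x - s
        n x) \<le> \<epsilon>" for m N \<epsilon>
  proof
    note le = fatou[OF \<epsilon> N]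
    have "(\<integral>\<^sup>+x. ennreal ((norm (s m x - g x))\<^sup>2) \<partial>lborel) < top"
      by (rule order_le_less_trans[OF le ennreal_less_top])
    then have int: "integrable lborel (\<lambda>x. (norm (s m x - g x))\<^sup>2)"
      by (intro integrableI_nonneg) (auto simp: infinity_ennreal_def)
    then show "(\<lambda>x. s m x - g x) \<in> L2"
      by (simp add: L2_def)
    have "ennreal ((L2_norm (\<lambda>x. s m x - g x))\<^sup>2) \<le> ennreal (\<epsilon>\<^sup>2)"
      unfolding L2_norm_power2 using le by (subst nn_integral_eq_integral[OF int, symmetric]) auto
    then show "L2_norm (\<lambda>x. s m x - g x) \<le> \<epsilon>"
      using \<epsilon> by (auto intro: power2_le_imp_le)
  qed
  have ev: "\<exists>N. \<forall>m\<ge>N. (\<lambda>x. s m x - g x) \<in> L2 \<and> L2_norm (\<lambda>x. s m x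
      - g x) \<le> \<epsilon>" if \<epsilon>: "0 < \<epsilon>" for \<epsilon>
  proof -
    obtain N where N: "\<And>m n. m \<ge> N \<Longrightarrow> n \<ge> N \<Longrightarrow> L2_norm (\<lambda>x.
        s m x - s n x) < \<epsilon>"
      using Cauchy[OF \<epsilon>] by blast
    show ?thesis
      by (intro exI[of _ N] allI impI diff[OF \<epsilon>, where N=N]) (use N in \<open>auto intro: less_imp_le\<close>)
  qed
  show ?thesis
  proof
    obtain N where "(\<lambda>x. s N x - g x) \<in> L2" using ev[of 1] by auto
    from L2_diff[OF s[of N] this] show "g \<in> L2" by simp
    show "(\<lambda>n. L2_norm (\<lambda>x. s n x - g x)) \<longlonglongrightarrow> 0"
    proof (rule LIMSEQ_I)
      fix \<epsilon> :: real assume "0 < \<epsilon>"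
      then obtain N where "\<forall>m\<ge>N. L2_norm (\<lambda>x. s m x - g x) \<le> \<epsilon> / 2"
        using ev[of "\<epsilon> / 2"] by auto
      then show "\<exists>N. \<forall>n\<ge>N. norm (L2_norm (\<lambda>x. s n x - g x) - 0) < \<epsilon>"
        using \<open>0 < \<epsilon>\<close> by (intro exI[of _ N]) (auto simp: abs_of_nonneg L2_norm_nonneg
            intro: order_le_less_trans)
    qed
  qed
qed

section \<open>Diagonal operators in an orthonormal basis\<close>

text \<open>Totality is posed as triviality of the orthogonal complement, the form in which the
  Fourier argument yields it. Convergence of expansions is derived from it.\<close>

locale L2_basis =
  fixes e :: "nat \<Rightarrow> 'a::euclidean_space \<Rightarrow> complex"
  assumes e_L2: "e j \<in> L2"
    and orthonormal: "l2_inner (e j) (e k) = (if j = k then 1 else 0)"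
    and total: "f \<in> L2 \<Longrightarrow> (\<And>j. l2_inner f (e j) = 0) \<Longrightarrow> AE x in lborel. f x = 0"
begin

definition coeff :: "('a \<Rightarrow> complex) \<Rightarrow> nat \<Rightarrow> complex" where
  "coeff f j = l2_inner f (e j)"

definition partial_series :: "(nat \<Rightarrow> complex) \<Rightarrow> nat \<Rightarrow> 'a \<Rightarrow>
    complex" where
  "partial_series c N x = (\<Sum>j<N. c j * e j x)"

lemma sum_L2: "(\<lambda>x. \<Sum>j\<in>A. c j * e j x) \<in> L2"
  by (intro L2_sum L2_cmult e_L2)

lemma partial_series_L2: "partial_series c N \<in> L2"
  unfolding partial_series_def[abs_def] by (rule sum_L2)

lemma coeff_add: "f \<in> L2 \<Longrightarrow> g \<in> L2 \<Longrightarrow> coeff (\<lambda>x. f x + g x) j =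
    coeff f j + coeff g j"
  by (simp add: coeff_def l2_inner_add_left e_L2)

lemma coeff_diff: "f \<in> L2 \<Longrightarrow> g \<in> L2 \<Longrightarrow> coeff (\<lambda>x. f x - g x) j =
    coeff f j - coeff g j"
  by (simp add: coeff_def l2_inner_diff_left e_L2)

lemma coeff_cmult: "coeff (\<lambda>x. c * f x) j = c * coeff f j"
  by (simp add: coeff_def l2_inner_cmult_left)

lemma coeff_sum:
  assumes "finite A"
  shows "coeff (\<lambda>x. \<Sum>j\<in>A. c j * e j x) k = (if k \<in> A then c k else 0)"
proof -
  have "coeff (\<lambda>x. \<Sum>j\<in>A. c j * e j x) k = (\<Sum>j\<in>A. c j * (if j = k then 1 else 0))"
    unfolding coeff_def
    by (subst l2_inner_sum_left) (auto intro: L2_cmult e_L2 simp: l2_inner_cmult_left orthonormal)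
  also have "\<dots> = (if k \<in> A then c k else 0)"
    using assms by (simp add: if_distrib cong: if_cong)
  finally show ?thesis .
qed

lemma coeff_partial_series: "coeff (partial_series c N) k = (if k < N then c k else 0)"
  using coeff_sum[of "{..<N}" c k] by (simp add: partial_series_def[abs_def])

lemma inner_sum_right:
  assumes "g \<in> L2"
  shows "l2_inner g (\<lambda>x. \<Sum>j\<in>A. c j * e j x) = (\<Sum>j\<in>A. cnj (c j) * coeff g j)"
proof -
  have "l2_inner (\<lambda>x. \<Sum>j\<in>A. c j * e j x) g = (\<Sum>j\<in>A. c j * l2_inner (e j) g)"
    using assms by (subst l2_inner_sum_left) (auto intro: L2_cmult e_L2 simp: l2_inner_cmult_left)
  then have "cnj (l2_inner (\<lambda>x. \<Sum>j\<in>A. c j * e j x) g) = (\<Sum>j\<in>A. cnj (c j) * cnj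
      (l2_inner (e j) g))"
    by simp
  then show ?thesis by (simp only: l2_inner_commute coeff_def)
qed

lemma L2_norm_sum:
  assumes "finite A"
  shows "(L2_norm (\<lambda>x. \<Sum>j\<in>A. c j * e j x))\<^sup>2 = (\<Sum>j\<in>A. (norm (c j))\<^sup>2)"
proof -
  have "complex_of_real ((L2_norm (\<lambda>x. \<Sum>j\<in>A. c j * e j x))\<^sup>2) = (\<Sum>j\<in>A. cnj (c j) * c j)"
    unfolding l2_inner_self[symmetric] inner_sum_right[OF sum_L2]
    by (intro sum.cong refl) (simp add: coeff_sum assms)
  also have "\<dots> = complex_of_real (\<Sum>j\<in>A. (norm (c j))\<^sup>2)"
    unfolding of_real_sum complex_norm_square by (simp add: mult.commute)
  finally show ?thesis by (simp only: of_real_eq_iff)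
qed

lemma L2_norm_diff_partial_series:
  assumes f: "f \<in> L2"
  shows "(L2_norm (\<lambda>x. f x - partial_series (coeff f) N x))\<^sup>2 = (L2_norm f)\<^sup>2 - (\<Sum>j<N.
      (norm (coeff f j))\<^sup>2)"
proof -
  let ?p = "partial_series (coeff f) N" and ?r = "\<lambda>x. f x - partial_series (coeff f) N x"
  have r: "?r \<in> L2" by (intro L2_diff f partial_series_L2)
  have "coeff ?r j = 0" if "j < N" for j
    using that by (simp add: coeff_diff f partial_series_L2 coeff_partial_series)
  then have "l2_inner ?r ?p = 0"
    using inner_sum_right[OF r, of "coeff f" "{..<N}"] by (simp add: partial_series_def[abs_def])
  then have "(L2_norm f)\<^sup>2 = (L2_norm ?r)\<^sup>2 + (L2_norm ?p)\<^sup>2"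
    using L2_norm_add_power2[OF r partial_series_L2[of "coeff f" N]] by simp
  then show ?thesis
    using L2_norm_sum[of "{..<N}" "coeff f"] by (simp add: partial_series_def[abs_def])
qed

lemma summable_coeff:
  assumes "f \<in> L2"
  shows "summable (\<lambda>j. (norm (coeff f j))\<^sup>2)"
proof (rule summableI_nonneg_bounded)
  show "(\<Sum>j<N. (norm (coeff f j))\<^sup>2) \<le> (L2_norm f)\<^sup>2" for N
    using L2_norm_diff_partial_series[OF assms, of N] zero_le_power2[of "L2_norm (\<lambda>x. f x -
        partial_series (coeff f) N x)"]
    by linarith
qed simp

lemma series_exists:
  assumes "summable (\<lambda>j. (norm (c j))\<^sup>2)"
  shows "\<exists>g. g \<in> L2 \<and> (\<lambda>N. L2_norm (\<lambda>x. partial_series c N x - g x))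
      \<longlonglongrightarrow> 0"
proof -
  have norm: "(L2_norm (\<lambda>x. partial_series c m x - partial_series c n x))\<^sup>2 =
      (\<Sum>j\<in>{n..<m}. (norm (c j))\<^sup>2)"
    if "n \<le> m" for m n
  proof -
    have "partial_series c m x - partial_series c n x = (\<Sum>j\<in>{n..<m}. c j * e j x)" for x
      unfolding partial_series_def lessThan_atLeast0 using that sum_diff_nat_ivl[of 0 n m "\<lambda>j. c j * e j x"]
      by simp
    then show ?thesis by (simp add: L2_norm_sum)
  qed
  have "\<exists>N. \<forall>m\<ge>N. \<forall>n\<ge>N. L2_norm (\<lambda>x. partial_series c m x -
      partial_series c n x) < \<epsilon>" if \<epsilon>: "0 < \<epsilon>" for \<epsilon>
  proof -
    obtain N where N: "\<And>m n. m \<ge> N \<Longrightarrow> norm (\<Sum>j\<in>{m..<n}. (norm (c j))\<^sup>2)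
        < \<epsilon>\<^sup>2"
      using assms \<epsilon> unfolding summable_Cauchy by (meson zero_less_power)
    have "L2_norm (\<lambda>x. partial_series c m x - partial_series c n x) < \<epsilon>" if "n \<ge> N" "n
        \<le> m" for m n
    proof (rule power_less_imp_less_base)
      show "(L2_norm (\<lambda>x. partial_series c m x - partial_series c n x)) ^ 2 < \<epsilon> ^ 2"
        using N[OF that(1), of m] norm[OF that(2)] by (simp add: sum_nonneg)
    qed (use \<epsilon> in simp)
    then show ?thesis
      by (intro exI[of _ N] allI impI) (metis L2_norm_minus_commute linorder_le_cases)
  qed
  from Riesz_Fischer[of "partial_series c", OF partial_series_L2 this]
  obtain g where "g \<in> L2" "(\<lambda>N. L2_norm (\<lambda>x. partial_series c N x - g x))
      \<longlonglongrightarrow> 0" .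
  then show ?thesis by blast
qed

text \<open>A representative of the \<open>L2\<close> limit, determined up to a null set only; it is
  accessed through its coefficients or almost everywhere.\<close>

definition series :: "(nat \<Rightarrow> complex) \<Rightarrow> 'a \<Rightarrow> complex" where
  "series c = (SOME g. g \<in> L2 \<and> (\<lambda>N. L2_norm (\<lambda>x. partial_series c N x - g x))
      \<longlonglongrightarrow> 0)"

lemma
  assumes "summable (\<lambda>j. (norm (c j))\<^sup>2)"
  shows series_L2: "series c \<in> L2"
    and series_tendsto: "(\<lambda>N. L2_norm (\<lambda>x. partial_series c N x - series c x))
        \<longlonglongrightarrow> 0"
  using someI_ex[OF series_exists[OF assms]] unfolding series_def by auto

lemma coeff_series:
  assumes "summable (\<lambda>j. (norm (c j))\<^sup>2)"
  shows "coeff (series c) k = c k"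
proof -
  have "(\<lambda>N. coeff (partial_series c N) k) \<longlonglongrightarrow> coeff (series c) k"
    unfolding coeff_def
    by (intro l2_inner_tendsto series_tendsto series_L2 partial_series_L2 e_L2 assms)
  moreover have "(\<lambda>N. coeff (partial_series c N) k) \<longlonglongrightarrow> c k"
    by (rule tendsto_eventually)
       (auto intro!: exI[of _ "Suc k"] simp: coeff_partial_series eventually_sequentially)
  ultimately show ?thesis
    by (rule LIMSEQ_unique)
qed

lemma AE_eq_coeffI:
  assumes "f \<in> L2" "g \<in> L2" "\<And>j. coeff f j = coeff g j"
  shows "AE x in lborel. f x = g x"
proof -
  have "AE x in lborel. f x - g x = 0"
    using assms by (intro total L2_diff) (simp_all add: coeff_diff flip: coeff_def)
  then show ?thesis by simp
qed

text \<open>The sum of the expansion exists by completeness and has the same coefficients as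
  \<open>f\<close>; by totality the two agree almost everywhere.\<close>

lemma partial_series_tendsto:
  assumes f: "f \<in> L2"
  shows "(\<lambda>N. L2_norm (\<lambda>x. partial_series (coeff f) N x - f x)) \<longlonglongrightarrow> 0"
proof -
  note s = summable_coeff[OF f]
  have "AE x in lborel. series (coeff f) x = f x"
    by (intro AE_eq_coeffI series_L2 s f) (simp add: coeff_series s)
  then have "L2_norm (\<lambda>x. partial_series (coeff f) N x - f x) = L2_norm (\<lambda>x. partial_series
      (coeff f) N x - series (coeff f) x)" for N
    by (intro L2_norm_cong_AE L2_diff partial_series_L2 series_L2 s f) auto
  then show ?thesis using series_tendsto[OF s] by simp
qed

lemma Parseval:
  assumes f: "f \<in> L2"
  shows "(\<lambda>j. (norm (coeff f j))\<^sup>2) sums (L2_norm f)\<^sup>2"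
proof -
  have "(\<lambda>N. (L2_norm f)\<^sup>2 - (L2_norm (\<lambda>x. partial_series (coeff f) N x - f x))\<^sup>2)
      \<longlonglongrightarrow> (L2_norm f)\<^sup>2 - 0\<^sup>2"
    by (intro tendsto_intros partial_series_tendsto f)
  moreover have "(\<Sum>j<N. (norm (coeff f j))\<^sup>2) = (L2_norm f)\<^sup>2 - (L2_norm (\<lambda>x.
      partial_series (coeff f) N x - f x))\<^sup>2" for N
    using L2_norm_diff_partial_series[OF f, of N] L2_norm_minus_commute[of f "partial_series (coeff f) N"] by simp
  ultimately show ?thesis by (simp add: sums_def)
qed

lemma Parseval_inner:
  assumes f: "f \<in> L2" and g: "g \<in> L2"
  shows "(\<lambda>j. coeff f j * cnj (coeff g j)) sums l2_inner f g"
proof -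
  have "(\<lambda>N. l2_inner (partial_series (coeff f) N) g) \<longlonglongrightarrow> l2_inner f g"
    by (intro l2_inner_tendsto partial_series_L2 f g partial_series_tendsto)
  moreover have "l2_inner (partial_series (coeff f) N) g = (\<Sum>j<N. coeff f j * cnj (coeff g j))" for N
  proof -
    have "cnj (l2_inner g (partial_series (coeff f) N)) = (\<Sum>j<N. coeff f j * cnj (coeff g j))"
      unfolding partial_series_def[abs_def] inner_sum_right[OF g] by simp
    then show ?thesis by (simp only: l2_inner_commute)
  qed
  ultimately show ?thesis by (simp add: sums_def)
qed

lemma L2_norm_eq_coeffI:
  assumes "f \<in> L2" "g \<in> L2" "\<And>j. norm (coeff f j) = norm (coeff g j)"
  shows "L2_norm f = L2_norm g"
proof -
  have "(L2_norm f)\<^sup>2 = (L2_norm g)\<^sup>2"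
    using sums_unique2[OF Parseval[OF assms(1)]] Parseval[OF assms(2)] assms(3) by simp
  then show ?thesis
    by (simp add: L2_norm_nonneg)
qed

text \<open>The Riesz representation theorem: the representing vector has the coefficients
  \<open>cnj (T (e j))\<close>, and only their square summability has to be shown.\<close>

lemma bounded_functional_eq_inner:
  fixes T :: "('a \<Rightarrow> complex) \<Rightarrow> complex"
  assumes add: "\<And>f g. f \<in> L2 \<Longrightarrow> g \<in> L2 \<Longrightarrow> T (\<lambda>x. f x + g x)
      = T f + T g"
    and cmult: "\<And>c f. f \<in> L2 \<Longrightarrow> T (\<lambda>x. c * f x) = c * T f"
    and bound: "\<And>f. f \<in> L2 \<Longrightarrow> norm (T f) \<le> K * L2_norm f"
  obtains g where "g \<in> L2" "\<And>f. f \<in> L2 \<Longrightarrow> T f = l2_inner f g"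
proof -
  have zero: "T (\<lambda>x. 0) = 0"
    using cmult[OF L2_zero, of 0] by simp
  have sum: "T (\<lambda>x. \<Sum>j\<in>A. c j * e j x) = (\<Sum>j\<in>A. c j * T (e j))" for A c
    by (induction A rule: infinite_finite_induct) (auto simp: zero add cmult L2_cmult sum_L2 e_L2)
  define c where "c j = cnj (T (e j))" for j
  have "summable (\<lambda>j. (norm (c j))\<^sup>2)"
  proof (rule summableI_nonneg_bounded)
    fix N
    \<comment> \<open>Testing \<open>T\<close> on the truncated representing vector itself yields
      \<open>S\<close>, while the bound yields \<open>K * sqrt S\<close>; hence
      \<open>S \<le> K^2\<close> for every truncation.\<close>
    define S where "S = (\<Sum>j<N. (norm (c j))\<^sup>2)"
    have "0 \<le> S" by (simp add: S_def sum_nonneg)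
    have "T (\<lambda>x. \<Sum>j<N. c j * e j x) = complex_of_real S"
      unfolding sum S_def of_real_sum complex_norm_square by (simp add: c_def)
    then have "S \<le> K * L2_norm (\<lambda>x. \<Sum>j<N. c j * e j x)"
      using bound[OF sum_L2[of c "{..<N}"]] \<open>0 \<le> S\<close> by simp
    then have "S\<^sup>2 \<le> (K * L2_norm (\<lambda>x. \<Sum>j<N. c j * e j x))\<^sup>2"
      using \<open>0 \<le> S\<close> by (rule power_mono)
    also have "\<dots> = K\<^sup>2 * S"
      by (simp add: power_mult_distrib L2_norm_sum S_def)
    finally have "S \<le> K\<^sup>2"
      using \<open>0 \<le> S\<close> by (cases "S = 0") (auto simp: power2_eq_square)
    then show "(\<Sum>j<N. (norm (c j))\<^sup>2) \<le> K\<^sup>2" by (simp add: S_def)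
  qed simp
  note s = this
  show ?thesis
  proof
    show "series c \<in> L2" by (rule series_L2[OF s])
    fix f :: "'a \<Rightarrow> complex" assume f: "f \<in> L2"
    have "(\<lambda>N. T (partial_series (coeff f) N) - T f) \<longlonglongrightarrow> 0"
    proof (rule Lim_null_comparison)
      have "T (\<lambda>x. h x - f x) = T h - T f" if "h \<in> L2" for h
        using add[OF that L2_cmult[OF f, of "-1"]] cmult[OF f, of "-1"] by simp
      then show "\<forall>\<^sub>F N in sequentially. norm (T (partial_series (coeff f) N) - T f)
          \<le> K * L2_norm (\<lambda>x. partial_series (coeff f) N x - f x)"
        using bound[OF L2_diff[OF partial_series_L2 f]] partial_series_L2
        by (intro always_eventually allI) metis
      show "(\<lambda>N. K * L2_norm (\<lambda>x. partial_series (coeff f) N x - f x)) \<longlonglongrightarrow> 0"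
        using tendsto_mult_left[OF partial_series_tendsto[OF f], of K] by simp
    qed
    moreover have "T (partial_series (coeff f) N) = (\<Sum>j<N. coeff f j * cnj (coeff (series c) j))" for N
      unfolding partial_series_def[abs_def] sum coeff_series[OF s] by (simp add: c_def)
    ultimately have "(\<lambda>j. coeff f j * cnj (coeff (series c) j)) sums T f"
      by (simp add: sums_def LIM_zero_iff)
    then show "T f = l2_inner f (series c)"
      using Parseval_inner[OF f series_L2[OF s]] sums_unique2 by blast
  qed
qed

end

section \<open>Diagonal operators and the unitary groups formed by them\<close>

context L2_basis
begin

text \<open>For bounded \<open>m\<close> this is a bounded operator, but linear only almost
  everywhere, since \<open>series\<close> picks a representative.\<close>

definition diagonal :: "(nat \<Rightarrow> complex) \<Rightarrow> ('a \<Rightarrow> complex) \<Rightarrow> 'a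
    \<Rightarrow> complex" where
  "diagonal m f = series (\<lambda>j. m j * coeff f j)"

lemma
  assumes f: "f \<in> L2" and m: "\<And>j. norm (m j) \<le> K"
  shows diagonal_L2: "diagonal m f \<in> L2"
    and coeff_diagonal: "coeff (diagonal m f) j = m j * coeff f j"
proof -
  have "summable (\<lambda>j. K\<^sup>2 * (norm (coeff f j))\<^sup>2)"
    by (intro summable_mult summable_coeff f)
  then have s: "summable (\<lambda>j. (norm (m j * coeff f j))\<^sup>2)"
    by (rule summable_comparison_test[rotated])
       (auto simp: norm_mult power_mult_distrib intro!: exI[of _ 0] mult_right_mono power_mono m)
  show "diagonal m f \<in> L2" "coeff (diagonal m f) j = m j * coeff f j"
    unfolding diagonal_def by (rule series_L2[OF s], rule coeff_series[OF s])
qed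

text \<open>Dominated convergence (Tannery) for the Parseval series. The filter is arbitrary because
  the lemma serves both \<open>t \<rightarrow> 0\<close> and limits of sequences.\<close>

lemma L2_norm_tendsto_0_coeff:
  assumes g: "\<And>t. g t \<in> L2" and "F \<noteq> bot"
    and lim: "\<And>j. ((\<lambda>t. coeff (g t) j) \<longlongrightarrow> 0) F"
    and bound: "\<And>t j. norm (coeff (g t) j) \<le> M j" and M: "summable (\<lambda>j. (M j)\<^sup>2)"
  shows "((\<lambda>t. L2_norm (g t)) \<longlongrightarrow> 0) F"
proof -
  have "((\<lambda>t. suminf (\<lambda>j. (norm (coeff (g t) j))\<^sup>2)) \<longlongrightarrow> suminf
      (\<lambda>j::nat. 0 :: real)) F"
  proof (rule tannerys_theorem[THEN conjunct2, THEN conjunct2])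
    show "((\<lambda>t. (norm (coeff (g t) j))\<^sup>2) \<longlongrightarrow> 0) F" for j
      using tendsto_power[OF tendsto_norm[OF lim[of j]], of 2] by simp
    show "\<forall>\<^sub>F (j, t) in at_top \<times>\<^sub>F F. norm ((norm (coeff (g t) j))\<^sup>2) \<le> (M
        j)\<^sup>2"
      using bound by (intro always_eventually) (auto intro!: power_mono)
  qed (use M \<open>F \<noteq> bot\<close> in auto)
  also have "(\<lambda>t. suminf (\<lambda>j. (norm (coeff (g t) j))\<^sup>2)) = (\<lambda>t. (L2_norm (g t))\<^sup>2)"
    using sums_unique[OF Parseval[OF g]] by (rule ext[OF sym])
  finally have "((\<lambda>t. sqrt ((L2_norm (g t))\<^sup>2)) \<longlongrightarrow> sqrt 0) F"
    by (intro tendsto_real_sqrt) simp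
  then show ?thesis by (simp add: L2_norm_nonneg)
qed

definition evolution :: "(nat \<Rightarrow> real) \<Rightarrow> real \<Rightarrow> ('a \<Rightarrow> complex)
    \<Rightarrow> 'a \<Rightarrow> complex" where
  "evolution \<omega> t = diagonal (\<lambda>j. exp (\<i> * complex_of_real (t * \<omega> j)))"

lemma
  assumes "f \<in> L2"
  shows evolution_L2: "evolution \<omega> t f \<in> L2"
    and coeff_evolution: "coeff (evolution \<omega> t f) j = exp (\<i> * complex_of_real (t * \<omega> j)) * coeff f j"
  unfolding evolution_def using assms by (auto intro!: diagonal_L2[where K=1] coeff_diagonal[where K=1])

lemma norm_iexp_minus_one: "norm (exp (\<i> * complex_of_real x) - 1) \<le> \<bar>x\<bar>"
  using iexp_approx1[of x 0] by simp

lemma unitary_group_evolution: "unitary_group (evolution \<omega>)"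
  unfolding unitary_group_def
proof (intro conjI allI ballI)
  fix t and f :: "'a \<Rightarrow> complex" assume f: "f \<in> L2"
  show "evolution \<omega> t f \<in> L2" by (rule evolution_L2[OF f])
  show "L2_norm (evolution \<omega> t f) = L2_norm f"
    by (rule L2_norm_eq_coeffI[OF evolution_L2[OF f] f]) (simp add: coeff_evolution[OF f] norm_mult)
next
  fix t a b and f g :: "'a \<Rightarrow> complex" assume L: "f \<in> L2" "g \<in> L2"
  show "AE x in lborel. evolution \<omega> t (\<lambda>x. a * f x + b * g x) x = a * evolution \<omega> t f x +
      b * evolution \<omega> t g x"
    by (rule AE_eq_coeffI)
       (simp_all add: L L2_add L2_cmult evolution_L2 coeff_evolution coeff_add coeff_cmult algebra_simps)
next
  fix f :: "'a \<Rightarrow> complex" assume f: "f \<in> L2"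
  show "AE x in lborel. evolution \<omega> 0 f x = f x"
    by (rule AE_eq_coeffI) (simp_all add: f evolution_L2 coeff_evolution)
next
  fix s t and f :: "'a \<Rightarrow> complex" assume f: "f \<in> L2"
  show "AE x in lborel. evolution \<omega> (s + t) f x = evolution \<omega> s (evolution \<omega> t f) x"
    by (rule AE_eq_coeffI)
       (simp_all add: f evolution_L2 coeff_evolution distrib_left distrib_right exp_add)
next
  fix f :: "'a \<Rightarrow> complex" assume f: "f \<in> L2"
  show "((\<lambda>t. L2_norm (\<lambda>x. evolution \<omega> t f x - f x)) \<longlongrightarrow> 0) (at 0)"
  proof (rule L2_norm_tendsto_0_coeff)
    show "(\<lambda>x. evolution \<omega> t f x - f x) \<in> L2" for t
      by (intro L2_diff evolution_L2 f)
    have c: "coeff (\<lambda>x. evolution \<omega> t f x - f x) j = (exp (\<i> * complex_of_real (t * \<omega>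
        j)) - 1) * coeff f j" for t j
      by (simp add: coeff_diff evolution_L2 f coeff_evolution algebra_simps)
    show "((\<lambda>t. coeff (\<lambda>x. evolution \<omega> t f x - f x) j) \<longlongrightarrow> 0) (at 0)" for j
      unfolding c by (auto intro!: tendsto_eq_intros)
    show "norm (coeff (\<lambda>x. evolution \<omega> t f x - f x) j) \<le> 2 * norm (coeff f j)" for t j
    proof -
      have "norm (exp (\<i> * complex_of_real (t * \<omega> j)) - 1) \<le> 2"
        by (rule order_trans[OF norm_triangle_ineq4]) simp
      then show ?thesis unfolding c norm_mult by (rule mult_right_mono) simp
    qed
    show "summable (\<lambda>j. (2 * norm (coeff f j))\<^sup>2)"
      unfolding power_mult_distrib by (intro summable_mult summable_coeff f)
  qed simp
qed

lemma difference_quotient_iexp: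
  "((\<lambda>t. (exp (\<i> * complex_of_real (t * l)) - 1) / complex_of_real t) \<longlongrightarrow> \<i> *
      complex_of_real l) (at 0)"
proof -
  have "((\<lambda>t. exp (\<i> * (complex_of_real t * complex_of_real l))) has_vector_derivative \<i> *
      complex_of_real l) (at 0)"
    by (rule has_vector_derivative_complex_of_real) (auto intro!: derivative_eq_intros)
  then show ?thesis
    unfolding has_vector_derivative_iff_tendsto by (simp add: scaleR_conv_of_real field_simps)
qed

text \<open>Both graphs are the set of pairs in \<open>L2\<close> with
  \<open>coeff g j = \<i> * \<omega> j * coeff f j\<close>. That the basis consists of Schwartz
  functions makes their span a core, which is what essential skew-adjointness amounts to
  here.\<close>

lemma generator_graph_evolution:
  assumes schwartz_e: "\<And>j. schwartz (e j)"
    and A_L2: "\<And>\<phi>. schwartz \<phi> \<Longrightarrow> A \<phi> \<in> L2"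
    and coeff_A: "\<And>\<phi> j. schwartz \<phi> \<Longrightarrow> coeff (A \<phi>) j = \<i> * complex_of_real
        (\<omega> j) * coeff \<phi> j"
  shows "generator_graph (evolution \<omega>) = closure_graph A"
proof (intro equalityI subsetI)
  define q where "q f g t = (\<lambda>x. (evolution \<omega> t f x - f x) / complex_of_real t - g x)" for f g t
  have q_L2: "q f g t \<in> L2" and coeff_q: "coeff (q f g t) j =
      (exp (\<i> * complex_of_real (t * \<omega> j)) - 1) / complex_of_real t * coeff f j - coeff g j"
    if L: "f \<in> L2" "g \<in> L2" for f g t j
  proof -
    have q: "q f g t = (\<lambda>x. inverse (complex_of_real t) * (evolution \<omega> t f x - f x) - g x)"
      by (auto simp: q_def divide_inverse mult.commute)
    show "q f g t \<in> L2" unfolding q by (intro L2_diff L2_cmult evolution_L2 L)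
    show "coeff (q f g t) j = (exp (\<i> * complex_of_real (t * \<omega> j)) - 1) / complex_of_real t * coeff f
        j - coeff g j"
      unfolding q by (simp add: coeff_diff coeff_cmult L2_diff L2_cmult evolution_L2 L coeff_evolution)
         (simp add: divide_inverse algebra_simps)
  qed
  have q_lim: "((\<lambda>t. coeff (q f g t) j) \<longlongrightarrow> \<i> * complex_of_real (\<omega> j) *
      coeff f j - coeff g j) (at 0)"
    if L: "f \<in> L2" "g \<in> L2" for f g j
    unfolding coeff_q[OF L] by (intro tendsto_intros difference_quotient_iexp)
  show "p \<in> closure_graph A" if p: "p \<in> generator_graph (evolution \<omega>)" for p
  proof -
    obtain f g where fg: "p = (f, g)" by (cases p)
    with p have L: "f \<in> L2" "g \<in> L2" and lim: "((\<lambda>t. L2_norm (q f g t)) \<longlongrightarrow> 0) (at 0)"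
      by (auto simp: generator_graph_def q_def)
    have g: "coeff g j = \<i> * complex_of_real (\<omega> j) * coeff f j" for j
    proof -
      have "((\<lambda>t. coeff (q f g t) j) \<longlongrightarrow> coeff (\<lambda>x. 0) j) (at 0)"
        unfolding coeff_def using lim by (intro l2_inner_tendsto q_L2 L L2_zero e_L2) simp
      then have "((\<lambda>t. coeff (q f g t) j) \<longlongrightarrow> 0) (at 0)"
        by (simp add: coeff_def l2_inner_zero_left)
      from tendsto_unique[OF _ this q_lim[OF L]] show ?thesis by simp
    qed
    \<comment> \<open>The approximating sequence consists of the partial sums of \<open>f\<close>:
      they are Schwartz functions, and \<open>A\<close> sends each of them to the corresponding
      partial sum of \<open>g\<close>.\<close>
    have sch: "schwartz (partial_series (coeff f) N)" for N
      unfolding partial_series_def[abs_def] by (intro schwartz_sum schwartz_cmult schwartz_e)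
    have "AE x in lborel. A (partial_series (coeff f) N) x = partial_series (coeff g) N x" for N
      by (rule AE_eq_coeffI) (simp_all add: A_L2 sch partial_series_L2 coeff_A coeff_partial_series g)
    then have "L2_norm (\<lambda>x. A (partial_series (coeff f) N) x - g x) = L2_norm (\<lambda>x.
        partial_series (coeff g) N x - g x)" for N
      by (intro L2_norm_cong_AE L2_diff A_L2 sch partial_series_L2 L) auto
    then show ?thesis
      unfolding fg closure_graph_def using L partial_series_tendsto
      by (auto intro!: exI[of _ "partial_series (coeff f)"] sch A_L2)
  qed
  show "p \<in> generator_graph (evolution \<omega>)" if p: "p \<in> closure_graph A" for p
  proof -
    obtain f g where fg: "p = (f, g)" by (cases p)
    with p obtain \<phi> where L: "f \<in> L2" "g \<in> L2" and \<phi>: "\<And>j. schwartz (\<phi> j)"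
      and lim: "(\<lambda>j. L2_norm (\<lambda>x. \<phi> j x - f x)) \<longlonglongrightarrow> 0" "(\<lambda>j.
          L2_norm (\<lambda>x. A (\<phi> j) x - g x)) \<longlonglongrightarrow> 0"
      by (auto simp: closure_graph_def)
    have g: "coeff g j = \<i> * complex_of_real (\<omega> j) * coeff f j" for j
    proof (rule LIMSEQ_unique)
      show "(\<lambda>n. coeff (A (\<phi> n)) j) \<longlonglongrightarrow> coeff g j"
        unfolding coeff_def by (intro l2_inner_tendsto lim A_L2 \<phi> L e_L2)
      have "(\<lambda>n. coeff (\<phi> n) j) \<longlonglongrightarrow> coeff f j"
        unfolding coeff_def by (intro l2_inner_tendsto lim schwartz_L2 \<phi> L e_L2)
      then show "(\<lambda>n. coeff (A (\<phi> n)) j) \<longlonglongrightarrow> \<i> * complex_of_real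
          (\<omega> j) * coeff f j"
        unfolding coeff_A[OF \<phi>] by (rule tendsto_mult_left)
    qed
    have "((\<lambda>t. L2_norm (q f g t)) \<longlongrightarrow> 0) (at 0)"
    proof (rule L2_norm_tendsto_0_coeff)
      show "((\<lambda>t. coeff (q f g t) j) \<longlongrightarrow> 0) (at 0)" for j
        using q_lim[OF L, of j] by (simp add: g)
      show "norm (coeff (q f g t) j) \<le> 2 * norm (coeff g j)" for t j
      proof -
        \<comment> \<open>A bound uniform in \<open>t\<close>, which turns into the square summable
          majorant \<open>2 * norm (coeff g j)\<close>. It covers \<open>t = 0\<close>, where the
          quotient is 0 by convention.\<close>
        have "norm ((exp (\<i> * complex_of_real (t * \<omega> j)) - 1) / complex_of_real t) \<le>
            \<bar>\<omega> j\<bar>"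
          using norm_iexp_minus_one[of "t * \<omega> j"] by (simp add: norm_divide divide_le_eq abs_mult mult.commute)
        then have "norm ((exp (\<i> * complex_of_real (t * \<omega> j)) - 1) / complex_of_real t * coeff f j)
            \<le> \<bar>\<omega> j\<bar> * norm (coeff f j)"
          unfolding norm_mult by (rule mult_right_mono) simp
        also have "\<dots> = norm (coeff g j)" by (simp add: g norm_mult)
        finally show ?thesis
          unfolding coeff_q[OF L] by (intro order_trans[OF norm_triangle_ineq4]) simp
      qed
      show "summable (\<lambda>j. (2 * norm (coeff g j))\<^sup>2)"
        unfolding power_mult_distrib by (intro summable_mult summable_coeff L)
    qed (use q_L2 L in auto)
    then show ?thesis
      using L by (simp add: fg generator_graph_def q_def)
  qed
qed

lemma is_operator_exp_evolution:
  assumes "\<And>j. schwartz (e j)" "\<And>\<phi>. schwartz \<phi> \<Longrightarrow> A \<phi> \<in> L2"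
    and "\<And>\<phi> j. schwartz \<phi> \<Longrightarrow> coeff (A \<phi>) j = \<i> * complex_of_real
        (\<omega> j) * coeff \<phi> j"
  shows "is_operator_exp A (evolution \<omega> 1)"
  unfolding is_operator_exp_def
  using assms(2) unitary_group_evolution generator_graph_evolution[OF assms] by blast

end

section \<open>Gaussian wave packets and their totality\<close>

text \<open>Unnormalised coherent states of fixed width: the real part of \<open>z\<close> is the
  centre in position, the imaginary part the frequency.\<close>

definition gaussian :: "('n::finite \<Rightarrow> complex) \<Rightarrow> real^'n \<Rightarrow> complex" where
  "gaussian z x = exp (\<Sum>k\<in>UNIV. - (1/2) * complex_of_real (x $ k) ^ 2 + z k * complex_of_real (x $ k))"

lemma gaussian_prod:
  "gaussian z x = (\<Prod>k\<in>UNIV. exp (- (1/2) * complex_of_real (x $ k) ^ 2 + z k * complex_of_real (x $ k)))"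
  by (simp only: gaussian_def exp_sum[OF finite])

lemma gaussian_nonzero: "gaussian z x \<noteq> 0"
  by (simp add: gaussian_def)

lemma gaussian_add: "gaussian (\<lambda>k. z k + w k) x = gaussian z x * exp (\<Sum>k\<in>UNIV. w k *
    complex_of_real (x $ k))"
  by (simp add: gaussian_def exp_add[symmetric] sum.distrib[symmetric] algebra_simps)

lemma cnj_gaussian: "cnj (gaussian z x) = gaussian (\<lambda>k. cnj (z k)) x"
  by (simp add: gaussian_def exp_cnj)

lemma norm_sum_coordinates_le:
  "norm (\<Sum>k\<in>UNIV. z k * complex_of_real ((x :: real^'n::finite) $ k)) \<le> (\<Sum>k\<in>UNIV. norm (z
      k)) * norm x"
  unfolding sum_distrib_right
  by (rule sum_norm_le) (auto simp: norm_mult intro!: mult_left_mono component_le_norm_cart)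

lemma norm_gaussian_le:
  "norm (gaussian z x) \<le> exp ((\<Sum>k\<in>UNIV. norm (z k)) * norm x - (1/2) * (norm x)\<^sup>2)"
proof -
  have "(norm x)\<^sup>2 = (\<Sum>k\<in>UNIV. (x $ k)\<^sup>2)"
    unfolding power2_norm_eq_inner inner_vec_def by (simp add: power2_eq_square)
  then have "(\<Sum>k\<in>UNIV. - (1/2) * complex_of_real (x $ k) ^ 2) = complex_of_real (- (1/2) * (norm x)\<^sup>2)"
    by (simp add: sum_distrib_left sum_negf)
  then have "gaussian z x = exp (complex_of_real (- (1/2) * (norm x)\<^sup>2) + (\<Sum>k\<in>UNIV. z k *
      complex_of_real (x $ k)))"
    unfolding gaussian_def sum.distrib by (rule arg_cong)
  then have "norm (gaussian z x) = exp (- (1/2) * (norm x)\<^sup>2 + Re (\<Sum>k\<in>UNIV. z k *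
      complex_of_real (x $ k)))"
    by simp
  also have "\<dots> \<le> exp ((\<Sum>k\<in>UNIV. norm (z k)) * norm x - (1/2) * (norm x)\<^sup>2)"
    using order_trans[OF complex_Re_le_cmod norm_sum_coordinates_le[of z x]] by simp
  finally show ?thesis .
qed

lemma gaussian_differentiable: "gaussian z differentiable (at x)"
proof -
  have "(\<lambda>x. complex_of_real (x $ k)) differentiable (at x)" for k and x :: "real^'n"
    using differentiable_of_real_inner[of "axis k 1" x] by (simp add: inner_axis)
  then have d: "(\<lambda>x. \<Sum>k\<in>UNIV. - (1/2) * complex_of_real (x $ k) ^ 2 + z k * complex_of_real (x
      $ k)) differentiable (at x)"
    by (intro differentiable_sum differentiable_add differentiable_mult differentiable_power
        differentiable_const ballI finite)
  have "(exp :: complex \<Rightarrow> complex) differentiable (at y)" for y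
    using DERIV_exp has_field_derivative_imp_has_derivative differentiableI by blast
  from differentiable_compose[OF this d] show ?thesis
    by (simp add: gaussian_def[abs_def])
qed

lemma partial_gaussian:
  "partial (axis k 1) (gaussian z) x = (z k - complex_of_real (x $ k)) * gaussian z x"
proof (rule partialI)
  define s where "s t = (\<Sum>j\<in>UNIV. - (1/2) * (complex_of_real (x $ j) + t * (if j = k then 1 else 0)) ^ 2 +
      z j * (complex_of_real (x $ j) + t * (if j = k then 1 else 0)))" for t
  have "(s has_field_derivative (\<Sum>j\<in>UNIV. (z j - complex_of_real (x $ j)) * (if j = k then 1 else 0))) (at 0)"
    unfolding s_def by (auto intro!: derivative_eq_intros sum.cong simp: algebra_simps)
  then have "(s has_field_derivative (z k - complex_of_real (x $ k))) (at 0)"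
    by (simp add: if_distrib cong: if_cong)
  then have "((\<lambda>t. exp (s t)) has_field_derivative (z k - complex_of_real (x $ k)) * exp (s 0)) (at
      (complex_of_real 0))"
    by (auto intro!: derivative_eq_intros)
  from has_vector_derivative_complex_of_real[OF this]
  have "((\<lambda>h. exp (s (complex_of_real h))) has_vector_derivative (z k - complex_of_real (x $ k)) * exp
      (s 0)) (at 0)" .
  moreover have "exp (s (complex_of_real h)) = gaussian z (x + h *\<^sub>R axis k 1)" for h
    unfolding s_def gaussian_def by (intro arg_cong[where f=exp] sum.cong refl) (simp add: axis_def)
  moreover have "exp (s 0) = gaussian z x"
    by (simp add: s_def gaussian_def)
  ultimately show "((\<lambda>h. gaussian z (x + h *\<^sub>R axis k 1)) has_vector_derivative (z k -
      complex_of_real (x $ k)) * gaussian z x) (at 0)"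
    by simp
qed

lemma gaussian_rapidly_decreasing: "rapidly_decreasing (gaussian z)"
  unfolding rapidly_decreasing_def
proof
  fix N
  obtain C where C: "\<And>x::real^'a. (1 + norm x) ^ N * exp ((\<Sum>k\<in>UNIV. norm (z k)) * norm x - (1/2)
      * (norm x)\<^sup>2) \<le> C"
    using gaussian_decay[of "1/2" N "\<Sum>k\<in>UNIV. norm (z k)", where 'a="real^'a"] by auto
  have "(1 + norm x) ^ N * norm (gaussian z x) \<le> C" for x
    by (rule order_trans[OF mult_left_mono[OF norm_gaussian_le] C]) simp
  then show "\<exists>C. \<forall>x. (1 + norm x) ^ N * norm (gaussian z x) \<le> C" by blast
qed

lemma Basis_vecE:
  assumes "d \<in> (Basis :: (real^'n::finite) set)"
  obtains k where "d = axis k 1"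
  using assms by (auto simp: Basis_vec_def)

lemma axis_Basis: "axis k 1 \<in> (Basis :: (real^'n::finite) set)"
  by (auto simp: Basis_vec_def)

lemma schwartz_gaussian: "schwartz (gaussian z)"
proof (rule polynomial_hull_schwartz[where B="{gaussian z}"])
  show "partial d f \<in> polynomial_hull {gaussian z}" if "f \<in> {gaussian z}" and d: "d \<in> Basis" for f d
  proof -
    obtain k where k: "d = axis k 1" using Basis_vecE[OF d] .
    have "partial d f = (\<lambda>x. z k * gaussian z x + (-1) * (complex_of_real (x \<bullet> axis k 1) *
        gaussian z x))"
      using that(1) by (auto simp: k partial_gaussian inner_axis algebra_simps)
    also have "\<dots> \<in> polynomial_hull {gaussian z}"
      by (intro polynomial_hull.add polynomial_hull.scale polynomial_hull.coord polynomial_hull.base axis_Basis) auto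
    finally show ?thesis .
  qed
qed (auto intro: gaussian_differentiable gaussian_rapidly_decreasing polynomial_hull.base)

lemmas gaussian_L2 = schwartz_L2[OF schwartz_gaussian]
lemmas gaussian_measurable[measurable] = schwartz_measurable[OF schwartz_gaussian]

lemma integral_gaussian_mult:
  "(LINT x|lborel. gaussian z x * gaussian w x) =
    (\<Prod>k\<in>UNIV. complex_of_real (sqrt pi) * exp ((z k + w k) ^ 2 / 4))"
proof -
  have "gaussian z x * gaussian w x = (\<Prod>k\<in>UNIV. exp (- 1 * complex_of_real (x $ k) ^ 2 + (z k + w k)
      * complex_of_real (x $ k)))" for x
    unfolding gaussian_prod prod.distrib[symmetric]
    by (intro prod.cong refl) (simp add: exp_add[symmetric] algebra_simps)
  then have "(LINT x|lborel. gaussian z x * gaussian w x) =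
      (\<Prod>k\<in>UNIV. LINT x|lborel. exp (- 1 * complex_of_real x ^ 2 + (z k + w k) * complex_of_real x))"
    using integrable_lborel_prod_vec(2)[of "\<lambda>k x. exp (- 1 * complex_of_real x ^ 2 + (z k + w k) *
        complex_of_real x)"]
      integrable_gaussian[of 1] by simp
  also have "\<dots> = (\<Prod>k\<in>UNIV. complex_of_real (sqrt pi) * exp ((z k + w k) ^ 2 / 4))"
    using gaussian_integral_linear[of 1] gauss_of_1 by simp
  finally show ?thesis .
qed

section \<open>Injectivity of the Fourier transform and totality of the wave packets\<close>

lemma integrable_pair_mult:
  fixes f :: "'a \<Rightarrow> complex" and g :: "'b \<Rightarrow> complex"
  assumes "sigma_finite_measure M" "sigma_finite_measure N" and f: "integrable M f" and g: "integrable N g"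
  shows "integrable (M \<Otimes>\<^sub>M N) (\<lambda>(x, y). f x * g y)"
proof -
  interpret M: sigma_finite_measure M by fact
  interpret N: sigma_finite_measure N by fact
  interpret pair_sigma_finite M N ..
  note [measurable] = borel_measurable_integrable[OF f] borel_measurable_integrable[OF g]
  show ?thesis
    by (rule Fubini_integrable) (use f g in \<open>auto simp: norm_mult\<close>)
qed

text \<open>Boxes are stable under intersection and generate the Borel sets, and the sets over which
  \<open>g\<close> integrates to 0 form a Dynkin system; \<open>total\<close> is what closes it
  under complements. Real and imaginary parts are then treated separately.\<close>

lemma integral_eq_0_imp_AE_eq_0:
  fixes g :: "'a::euclidean_space \<Rightarrow> complex"
  assumes g: "integrable lborel g" and total: "(LINT x|lborel. g x) = 0"
    and box: "\<And>l u. (LINT x:box l u|lborel. g x) = 0"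
  shows "AE x in lborel. g x = 0"
proof -
  have int: "set_integrable lborel A g" if "A \<in> sets borel" for A
    unfolding set_integrable_def using that g by (intro integrable_mult_indicator) auto
  have A: "(LINT x:A|lborel. g x) = 0" if "A \<in> sigma_sets UNIV (range (\<lambda>(a, b). box a b))" for A
  proof (rule sigma_sets_induct_disjoint[OF _ _ that])
    have sb: "sigma_sets UNIV (range (\<lambda>(a, b). box a b)) = sets (borel :: 'a measure)"
      unfolding borel_eq_box by simp
    show "Int_stable (range (\<lambda>(a, b). box a b :: 'a set))"
      by (auto simp: Int_stable_def box_Int_box)
    show "(LINT x:{}|lborel. g x) = 0" by (simp add: set_lebesgue_integral_def)
    show "(LINT x:A|lborel. g x) = 0" if "A \<in> range (\<lambda>(a, b). box a b)" for A
      using that box by auto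
    show "(LINT x:UNIV - A|lborel. g x) = 0"
      if "A \<in> sigma_sets UNIV (range (\<lambda>(a, b). box a b))" and 0: "(LINT x:A|lborel. g x) = 0" for A
    proof -
      have [measurable]: "A \<in> sets borel" using that(1) by (simp add: sb)
      have "(LINT x:A \<union> (UNIV - A)|lborel. g x) = (LINT x:A|lborel. g x) + (LINT x:UNIV - A|lborel. g x)"
        by (rule set_integral_Un) (auto intro!: int)
      then show ?thesis using 0 total by (simp add: set_lebesgue_integral_def)
    qed
    show "(LINT x:(\<Union>i. A i)|lborel. g x) = 0"
      if d: "disjoint_family A" and "range A \<subseteq> sigma_sets UNIV (range (\<lambda>(a, b). box a b))"
        and 0: "\<And>i. (LINT x:A i|lborel. g x) = 0" for A :: "nat \<Rightarrow> 'a set"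
    proof -
      have m: "A i \<in> sets lborel" for i using that(2) by (auto simp: sb)
      have "(LINT x:(\<Union>i. A i)|lborel. g x) = suminf (\<lambda>i. LINT x:A i|lborel. g x)"
        by (rule lebesgue_integral_countable_add) (use d m in \<open>auto simp: disjoint_family_on_def intro!:
            int\<close>)
      then show ?thesis by (simp add: 0)
    qed
  qed auto
  have A: "(LINT x:A|lborel. g x) = 0" if "A \<in> sets lborel" for A
    using that by (intro A) (simp add: borel_eq_box)
  have part: "AE x in lborel. p (g x) = 0" if p: "bounded_linear p" for p :: "complex \<Rightarrow> real"
  proof (rule density_unique_real)
    show "integrable lborel (\<lambda>x. p (g x))"
      using g by (rule integrable_bounded_linear[OF p])
    show "(LINT x:A|lborel. p (g x)) = (LINT x:A|lborel. 0)" if "A \<in> sets lborel" for A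
    proof -
      have "p (LINT x:A|lborel. g x) = (LINT x|lborel. p (indicator A x *\<^sub>R g x))"
        unfolding set_lebesgue_integral_def
        using int[of A] that by (intro integral_bounded_linear[OF p, symmetric]) (simp add: set_integrable_def)
      then show ?thesis
        using A[OF that] by (simp add: set_lebesgue_integral_def linear_cmul[OF bounded_linear.linear[OF p]]
            linear_0[OF bounded_linear.linear[OF p]])
    qed
  qed simp
  show ?thesis
    using part[OF bounded_linear_Re] part[OF bounded_linear_Im] by eventually_elim (simp add: complex_eq_iff)
qed


lemma borel_measurable_component [measurable (raw)]:
  fixes f :: "'a \<Rightarrow> real^'n::finite"
  assumes "f \<in> borel_measurable M"
  shows "(\<lambda>x. f x $ k) \<in> borel_measurable M"
proof -
  have "(\<lambda>x::real^'n. x $ k) \<in> borel_measurable borel"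
    by (intro borel_measurable_continuous_onI continuous_intros)
  from measurable_compose[OF assms this] show ?thesis .
qed

text \<open>A Gaussian in \<open>x - y\<close> is a superposition of characters with Gaussian
  weight, so after exchanging the integrals each frequency contributes a vanishing Fourier integral
  of \<open>g\<close>.\<close>

lemma fourier_zero_imp_mollification_zero:
  fixes g :: "real^'n::finite \<Rightarrow> complex"
  assumes g: "integrable lborel g"
    and fourier: "\<And>\<xi>. (LINT x|lborel. g x * exp (\<Sum>k\<in>UNIV. \<i> * complex_of_real (\<xi> $ k *
        x $ k))) = 0"
    and \<sigma>: "0 < \<sigma>"
  shows "(LINT x|lborel. g x * gaussian (\<lambda>_. 0) ((x - y) /\<^sub>R \<sigma>)) = 0"
proof -
  note [measurable] = borel_measurable_integrable[OF g]
  \<comment> \<open>Chosen so that the transform \<open>exp (- u^2 / (4 * a))\<close> of the weight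
    is the standard Gaussian at \<open>u / \<sigma>\<close>.\<close>
  define a where "a = complex_of_real (\<sigma>\<^sup>2 / 2)"
  have a: "0 < Re a" "a \<noteq> 0" using \<sigma> by (auto simp: a_def)
  define E where "E u = (\<lambda>\<xi>::real^'n. \<Prod>k\<in>UNIV. exp (- a * complex_of_real (\<xi> $ k) ^ 2
      + \<i> * complex_of_real (u $ k) * complex_of_real (\<xi> $ k)))"
    for u :: "real^'n"
  have E: "integrable lborel (E u)" for u
    unfolding E_def using integrable_gaussian[OF a(1)] by (rule integrable_lborel_prod_vec)
  have E_int: "(LINT \<xi>|lborel. E u \<xi>) = gauss a ^ CARD('n) * gaussian (\<lambda>_. 0) (u /\<^sub>R
      \<sigma>)" for u
  proof -
    have "(LINT \<xi>|lborel. E u \<xi>) = (\<Prod>k\<in>UNIV. gauss a * exp ((\<i> * complex_of_real (u $ k))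
        ^ 2 / (4 * a)))"
      unfolding E_def by (simp only: integrable_lborel_prod_vec(2)[OF integrable_gaussian[OF a(1)]]
          gaussian_integral_linear[OF a(1)])
    also have "\<dots> = gauss a ^ CARD('n) * gaussian (\<lambda>_. 0) (u /\<^sub>R \<sigma>)"
      unfolding gaussian_prod prod.distrib prod_constant using \<sigma>
      by (intro arg_cong2[where f="(*)"] prod.cong arg_cong[where f=exp] refl)
         (simp add: a_def power2_eq_square field_simps)
    finally show ?thesis .
  qed
  have E_split: "E (x - y) \<xi> = E (- y) \<xi> * exp (\<Sum>k\<in>UNIV. \<i> * complex_of_real (\<xi> $ k * x
      $ k))" for x \<xi>
    unfolding E_def exp_sum[OF finite] prod.distrib[symmetric]
    by (intro prod.cong refl) (simp add: exp_add[symmetric] algebra_simps)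
  have "E 0 \<in> borel_measurable borel" "E (- y) \<in> borel_measurable borel"
    using E borel_measurable_integrable by auto
  note [measurable] = this
  have int: "integrable (lborel \<Otimes>\<^sub>M lborel) (\<lambda>(x, \<xi>). g x * E (x - y) \<xi>)"
  proof (rule Bochner_Integration.integrable_bound)
    show "integrable (lborel \<Otimes>\<^sub>M lborel) (\<lambda>(x, \<xi>). g x * E 0 \<xi>)"
      by (rule integrable_pair_mult[OF _ _ g E]) (rule lborel.sigma_finite_measure_axioms)+
    \<comment> \<open>The parameter \<open>u\<close> enters \<open>E\<close> as a phase only, so the
      dominating function does not depend on \<open>x\<close>.\<close>
    have E_norm: "norm (E u \<xi>) = norm (E 0 \<xi>)" for u \<xi>
      by (simp add: E_def norm_mult prod_norm[symmetric])
    show "AE p in lborel \<Otimes>\<^sub>M lborel. norm (case p of (x, \<xi>) \<Rightarrow> g x * E (x - y)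
        \<xi>) \<le> norm (case p of (x, \<xi>) \<Rightarrow> g x * E 0 \<xi>)"
    proof (intro AE_I2)
      fix p :: "(real^'n) \<times> (real^'n)"
      show "norm (case p of (x, \<xi>) \<Rightarrow> g x * E (x - y) \<xi>) \<le> norm (case p of (x, \<xi>)
          \<Rightarrow> g x * E 0 \<xi>)"
        using E_norm[of "fst p - y" "snd p"] by (simp add: norm_mult split_beta)
    qed
    show "(\<lambda>(x, \<xi>). g x * E (x - y) \<xi>) \<in> borel_measurable (lborel \<Otimes>\<^sub>M lborel)"
      unfolding E_def by measurable
  qed
  have "gauss a ^ CARD('n) * (LINT x|lborel. g x * gaussian (\<lambda>_. 0) ((x - y) /\<^sub>R \<sigma>)) =
      (LINT x|lborel. (LINT \<xi>|lborel. g x * E (x - y) \<xi>))"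
  proof -
    have "(LINT \<xi>|lborel. g x * E (x - y) \<xi>) = gauss a ^ CARD('n) * (g x * gaussian (\<lambda>_. 0) ((x
        - y) /\<^sub>R \<sigma>))" for x
      unfolding integral_mult_right_zero E_int by (simp add: mult.left_commute)
    then show ?thesis by (simp only: integral_mult_right_zero)
  qed
  also have "\<dots> = (LINT \<xi>|lborel. (LINT x|lborel. g x * E (x - y) \<xi>))"
    by (rule lborel_pair.Fubini_integral[symmetric]) (use int in simp)
  also have "\<dots> = (LINT \<xi>|lborel. E (- y) \<xi> * (LINT x|lborel. g x * exp (\<Sum>k\<in>UNIV. \<i> *
      complex_of_real (\<xi> $ k * x $ k))))"
    unfolding E_split by (simp add: mult.left_commute flip: integral_mult_right_zero)
  also have "\<dots> = 0" by (simp only: fourier) simp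
  finally show ?thesis
    using gauss_square[OF a(1)] a(2) by auto
qed

text \<open>Averaging the mollification identity over \<open>y\<close> in the box shows that
  \<open>g\<close> is orthogonal to every mollified indicator; these tend to a nonzero multiple of
  the indicator off the boundary.\<close>

lemma fourier_zero_imp_box_integral_zero:
  fixes g :: "real^'n::finite \<Rightarrow> complex"
  assumes g: "integrable lborel g"
    and fourier: "\<And>\<xi>. (LINT x|lborel. g x * exp (\<Sum>k\<in>UNIV. \<i> * complex_of_real (\<xi> $ k *
        x $ k))) = 0"
  shows "(LINT x:box l u|lborel. g x) = 0"
proof -
  note [measurable] = borel_measurable_integrable[OF g]
  define \<sigma> where "\<sigma> m = 1 / (real m + 1)" for m
  have \<sigma>: "0 < \<sigma> m" for m by (simp add: \<sigma>_def)
  have \<sigma>_lim: "\<sigma> \<longlonglongrightarrow> 0" unfolding \<sigma>_def by real_asymp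
  define N :: "real^'n \<Rightarrow> complex" where "N = gaussian (\<lambda>_. 0)"
  have N: "integrable lborel N"
    unfolding N_def by (intro rapidly_decreasing_integrable gaussian_rapidly_decreasing gaussian_measurable)
  note [measurable] = borel_measurable_integrable[OF N]
  define \<kappa> where "\<kappa> x = complex_of_real (indicator (box l u) x)" for x
  have [measurable]: "\<kappa> \<in> borel_measurable borel" unfolding \<kappa>_def by measurable
  have \<kappa>_int: "integrable lborel \<kappa>"
    unfolding \<kappa>_def by (intro integrable_of_real integrable_real_indicator)
      (auto intro!: emeasure_lborel_box_finite[unfolded infinity_ennreal_def])
  have \<kappa>_le: "norm (\<kappa> x) \<le> 1" for x by (simp add: \<kappa>_def indicator_def)
  have N_even: "N (- x) = N x" for x by (simp add: N_def gaussian_def)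
  \<comment> \<open>The scale sits in the argument of \<open>\<kappa>\<close>, so
    \<open>norm (N s)\<close> dominates the integrand for all \<open>m\<close>. The substitution
    \<open>y = x - \<sigma> m *\<^sub>R s\<close> recovers the kernel of the preceding
    lemma.\<close>
  define \<psi> where "\<psi> m x = (LINT s|lborel. N s * \<kappa> (x - \<sigma> m *\<^sub>R s))" for m x
  have \<psi>_meas[measurable]: "\<psi> m \<in> borel_measurable borel" for m
    unfolding \<psi>_def by measurable
  have \<psi>_zero: "(LINT x|lborel. g x * \<psi> m x) = 0" for m
  proof -
    have \<psi>: "\<sigma> m ^ CARD('n) *\<^sub>R \<psi> m x = (LINT y|lborel. N ((x - y) /\<^sub>R \<sigma> m)
        * \<kappa> y)" for x
      using lborel_integral_affine(2)[of "- \<sigma> m" "\<lambda>y. N ((x - y) /\<^sub>R \<sigma> m) *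
          \<kappa> y" x] \<sigma>[of m]
      by (simp add: \<psi>_def)
    have int: "integrable (lborel \<Otimes>\<^sub>M lborel) (\<lambda>(x, y). g x * (N ((x - y) /\<^sub>R
        \<sigma> m) * \<kappa> y))"
    proof (rule Bochner_Integration.integrable_bound)
      show "integrable (lborel \<Otimes>\<^sub>M lborel) (\<lambda>(x, y). g x * \<kappa> y)"
        by (rule integrable_pair_mult[OF _ _ g \<kappa>_int]) (rule lborel.sigma_finite_measure_axioms)+
      have N_le: "norm (N x) \<le> 1" for x
        unfolding N_def by (rule order_trans[OF norm_gaussian_le]) simp
      show "AE p in lborel \<Otimes>\<^sub>M lborel. norm (case p of (x, y) \<Rightarrow> g x * (N ((x - y)
          /\<^sub>R \<sigma> m) * \<kappa> y)) \<le> norm (case p of (x, y) \<Rightarrow> g x * \<kappa> y)"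
      proof (intro AE_I2)
        fix p :: "(real^'n) \<times> (real^'n)"
        have "norm (g (fst p)) * (norm (N ((fst p - snd p) /\<^sub>R \<sigma> m)) * norm (\<kappa> (snd p)))
            \<le> norm (g (fst p)) * (1 * norm (\<kappa> (snd p)))"
          by (intro mult_left_mono mult_right_mono N_le) auto
        then show "norm (case p of (x, y) \<Rightarrow> g x * (N ((x - y) /\<^sub>R \<sigma> m) * \<kappa> y))
            \<le> norm (case p of (x, y) \<Rightarrow> g x * \<kappa> y)"
          by (simp add: norm_mult split_beta)
      qed
    qed measurable
    have "\<sigma> m ^ CARD('n) *\<^sub>R (LINT x|lborel. g x * \<psi> m x) = (LINT x|lborel. g x * (\<sigma> m
        ^ CARD('n) *\<^sub>R \<psi> m x))"
      by simp
    also have "\<dots> = (LINT x|lborel. (LINT y|lborel. g x * (N ((x - y) /\<^sub>R \<sigma> m) * \<kappa> y)))"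
      unfolding \<psi> by simp
    also have "\<dots> = (LINT y|lborel. (LINT x|lborel. g x * (N ((x - y) /\<^sub>R \<sigma> m) * \<kappa> y)))"
      by (rule lborel_pair.Fubini_integral[symmetric]) (use int in simp)
    also have "\<dots> = (LINT y|lborel. (LINT x|lborel. g x * N ((x - y) /\<^sub>R \<sigma> m)) * \<kappa> y)"
      by (simp add: mult.assoc[symmetric])
    also have "\<dots> = 0"
      unfolding N_def using fourier_zero_imp_mollification_zero[OF g fourier \<sigma>] by simp
    finally show ?thesis using \<sigma>[of m] by simp
  qed
  \<comment> \<open>The indicator jumps on the boundary, where pointwise convergence may fail; the
    boundary is a null set.\<close>
  have boundary: "AE x in lborel. x \<in> box l u \<or> x \<notin> cbox l u"
  proof -
    have "emeasure lborel (cbox l u - box l u) = emeasure lborel (cbox l u) - emeasure lborel (box l u)"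
      using emeasure_lborel_box_finite[of l u, unfolded infinity_ennreal_def]
      by (intro emeasure_Diff) (auto simp: box_subset_cbox)
    also have "\<dots> = 0"
      by (simp add: emeasure_lborel_box_eq emeasure_lborel_cbox_eq)
    finally have "cbox l u - box l u \<in> null_sets lborel" by (auto simp: null_sets_def)
    from AE_not_in[OF this] show ?thesis by eventually_elim auto
  qed
  have \<psi>_lim: "(\<lambda>m. \<psi> m x) \<longlonglongrightarrow> \<kappa> x * (LINT s|lborel. N s)" if x:
      "x \<in> box l u \<or> x \<notin> cbox l u" for x
  proof -
    have "(\<lambda>m. \<psi> m x) \<longlonglongrightarrow> (LINT s|lborel. N s * \<kappa> x)"
      unfolding \<psi>_def
    proof (rule integral_dominated_convergence[where w="\<lambda>s. norm (N s)"])
      show "AE s in lborel. (\<lambda>m. N s * \<kappa> (x - \<sigma> m *\<^sub>R s)) \<longlonglongrightarrow>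
          N s * \<kappa> x"
      proof (rule AE_I2)
        fix s
        have lim: "(\<lambda>m. x - \<sigma> m *\<^sub>R s) \<longlonglongrightarrow> x"
          using tendsto_diff[OF tendsto_const[of x] tendsto_scaleR[OF \<sigma>_lim tendsto_const[of s]]] by simp
        have "\<forall>\<^sub>F m in sequentially. \<kappa> (x - \<sigma> m *\<^sub>R s) = \<kappa> x"
          using x
        proof
          assume "x \<in> box l u"
          from topological_tendstoD[OF lim open_box this] show ?thesis
            by eventually_elim (use \<open>x \<in> box l u\<close> in \<open>simp add: \<kappa>_def\<close>)
        next
          assume "x \<notin> cbox l u"
          then have "\<forall>\<^sub>F m in sequentially. x - \<sigma> m *\<^sub>R s \<in> - cbox l u"
            by (intro topological_tendstoD[OF lim]) (auto intro: closed_cbox)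
          then show ?thesis
            by (rule eventually_mono)
               (use \<open>x \<notin> cbox l u\<close> box_subset_cbox[of l u] in \<open>auto simp:
                   \<kappa>_def indicator_def\<close>)
        qed
        then have "(\<lambda>m. \<kappa> (x - \<sigma> m *\<^sub>R s)) \<longlonglongrightarrow> \<kappa> x"
          by (rule tendsto_eventually)
        then show "(\<lambda>m. N s * \<kappa> (x - \<sigma> m *\<^sub>R s)) \<longlonglongrightarrow> N s * \<kappa> x"
          by (rule tendsto_mult_left)
      qed
      show "AE s in lborel. norm (N s * \<kappa> (x - \<sigma> m *\<^sub>R s)) \<le> norm (N s)" for m
        using \<kappa>_le by (auto simp: norm_mult intro!: mult_left_le)
    qed (use N in \<open>auto intro!: integrable_norm\<close>)
    then show ?thesis by (simp add: mult.commute)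
  qed
  have "(\<lambda>m. LINT x|lborel. g x * \<psi> m x) \<longlonglongrightarrow> (LINT x|lborel. g x * (\<kappa>
      x * (LINT s|lborel. N s)))"
  proof (rule integral_dominated_convergence[where w="\<lambda>x. norm (g x) * (LINT s|lborel. norm (N s))"])
    show "AE x in lborel. (\<lambda>m. g x * \<psi> m x) \<longlonglongrightarrow> g x * (\<kappa> x * (LINT
        s|lborel. N s))"
      using boundary by eventually_elim (intro tendsto_mult_left \<psi>_lim)
    show "AE x in lborel. norm (g x * \<psi> m x) \<le> norm (g x) * (LINT s|lborel. norm (N s))" for m
    proof (rule AE_I2)
      fix x
      have "norm (\<psi> m x) \<le> (LINT s|lborel. norm (N s))"
        unfolding \<psi>_def
      proof (rule Bochner_Integration.integral_norm_bound_integral)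
        show le: "norm (N s * \<kappa> (x - \<sigma> m *\<^sub>R s)) \<le> norm (N s)" for s
          using \<kappa>_le by (auto simp: norm_mult intro!: mult_left_le)
        show "integrable lborel (\<lambda>s. N s * \<kappa> (x - \<sigma> m *\<^sub>R s))"
          by (rule Bochner_Integration.integrable_bound[OF N]) (use le in auto)
      qed (use N in auto)
      then show "norm (g x * \<psi> m x) \<le> norm (g x) * (LINT s|lborel. norm (N s))"
        unfolding norm_mult by (rule mult_left_mono) simp
    qed
    show "integrable lborel (\<lambda>x. norm (g x) * (LINT s|lborel. norm (N s)))"
      by (intro integrable_mult_left integrable_norm g)
  qed measurable
  then have "(LINT x|lborel. g x * (\<kappa> x * (LINT s|lborel. N s))) = 0"
    unfolding \<psi>_zero using LIMSEQ_unique tendsto_const by blast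
  then have "(LINT x|lborel. g x * \<kappa> x) * (LINT s|lborel. N s) = 0"
    by (simp add: mult.assoc[symmetric])
  moreover have "(LINT s|lborel. N s) \<noteq> 0"
  proof -
    have "(LINT s|lborel. N s) = gauss (1/2) ^ CARD('n)"
      using integrable_lborel_prod_vec(2)[of "\<lambda>k::'n. \<lambda>x. exp (- (1/2) * complex_of_real x ^ 2)"]
        integrable_gaussian[of "1/2" 0] by (simp add: N_def gaussian_prod gauss_def)
    then show ?thesis using gauss_square[of "1/2"] by auto
  qed
  moreover have "(LINT x|lborel. g x * \<kappa> x) = (LINT x:box l u|lborel. g x)"
    unfolding set_lebesgue_integral_def \<kappa>_def
    by (intro Bochner_Integration.integral_cong refl) (simp add: scaleR_conv_of_real mult.commute)
  ultimately show ?thesis by simp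
qed

text \<open>For purely imaginary parameters the packets are a fixed Gaussian times characters, so
  the Fourier transform of the integrable function \<open>f * gaussian 0\<close> vanishes; the
  Gaussian factor has no zeros.\<close>

theorem gaussian_total:
  fixes f :: "real^'n::finite \<Rightarrow> complex"
  assumes f: "f \<in> L2" and orth: "\<And>z. (LINT x|lborel. f x * gaussian z x) = 0"
  shows "AE x in lborel. f x = 0"
proof -
  define g where "g x = f x * gaussian (\<lambda>_. 0) x" for x
  have g: "integrable lborel g"
    unfolding g_def by (intro L2_integrable_mult f gaussian_L2)
  have fourier: "(LINT x|lborel. g x * exp (\<Sum>k\<in>UNIV. \<i> * complex_of_real (\<xi> $ k * x $ k))) = 0"
      for \<xi>
    using orth[of "\<lambda>k. \<i> * complex_of_real (\<xi> $ k)"] gaussian_add[of "\<lambda>_. 0"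
        "\<lambda>k. \<i> * complex_of_real (\<xi> $ k)"]
    by (simp add: g_def mult.assoc)
  have "(LINT x|lborel. g x) = 0"
    using fourier[of 0] by simp
  then have "AE x in lborel. g x = 0"
    using g fourier_zero_imp_box_integral_zero[OF g fourier] by (intro integral_eq_0_imp_AE_eq_0)
  then show ?thesis
    by eventually_elim (simp add: g_def gaussian_nonzero)
qed

section \<open>Displaced Hermite functions\<close>

text \<open>The physicists' Hermite polynomials \<open>H_n\<close> translated to
  \<open>H_n (x - c / 2)\<close>; \<open>c\<close> will be twice the displacement in
  position.\<close>

primrec hermite_poly :: "complex \<Rightarrow> nat \<Rightarrow> complex poly" where
  "hermite_poly c 0 = 1"
| "hermite_poly c (Suc n) = [:- c, 2:] * hermite_poly c n - pderiv (hermite_poly c n)"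

lemma pderiv_hermite_poly: "pderiv (hermite_poly c n) = smult (2 * of_nat n) (hermite_poly c (n - 1))"
proof (induction n)
  case (Suc n)
  show ?case
  proof (cases n)
    case (Suc m)
    have "pderiv (hermite_poly c (Suc n)) = smult 2 (hermite_poly c n) + [:- c, 2:] * pderiv (hermite_poly c n)
        - pderiv (pderiv (hermite_poly c n))"
      by (simp add: pderiv_diff pderiv_mult pderiv_pCons pderiv_smult)
    also have "\<dots> = smult 2 (hermite_poly c n) + smult (2 * of_nat n) ([:- c, 2:] * hermite_poly c m -
        pderiv (hermite_poly c m))"
      unfolding Suc.IH by (simp add: Suc pderiv_smult smult_diff_right)
    also have "\<dots> = smult 2 (hermite_poly c n) + smult (2 * of_nat n) (hermite_poly c n)"
      by (simp add: Suc)
    finally show ?thesis by (simp add: smult_add_left[symmetric] algebra_simps)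
  qed (simp add: pderiv_pCons)
qed simp

lemma schwartz_component: "schwartz \<phi> \<Longrightarrow> schwartz (\<lambda>x. complex_of_real (x $ k) * \<phi> x)"
  using schwartz_coord[of \<phi> "axis k 1"] by (simp add: axis_Basis inner_axis)

lemma schwartz_poly_component:
  "schwartz \<phi> \<Longrightarrow> schwartz (\<lambda>x. poly p (complex_of_real (x $ k)) * \<phi> x)"
proof (induction p)
  case 0
  then show ?case by (simp add: schwartz_zero)
next
  case (pCons a p)
  have "schwartz (\<lambda>x. a * \<phi> x + complex_of_real (x $ k) * (poly p (complex_of_real (x $ k)) * \<phi> x))"
    by (intro schwartz_add schwartz_cmult schwartz_component pCons)
  then show ?case by (simp add: algebra_simps)
qed

lemma schwartz_prod_poly_component:
  "schwartz \<phi> \<Longrightarrow> schwartz (\<lambda>x. (\<Prod>k\<in>A. poly (p k) (complex_of_real (x $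
      k))) * \<phi> x)"
proof (induction A rule: infinite_finite_induct)
  case (insert k A)
  then show ?case
    using schwartz_poly_component[of "\<lambda>x. (\<Prod>k\<in>A. poly (p k) (complex_of_real (x $ k))) *
        \<phi> x" "p k" k]
    by (simp add: mult.assoc)
qed auto

lemma l2_inner_cmult_right: "l2_inner f (\<lambda>x. c * g x) = cnj c * l2_inner f g"
proof -
  have "cnj (l2_inner (\<lambda>x. c * g x) f) = cnj c * cnj (l2_inner g f)"
    by (simp add: l2_inner_cmult_left)
  then show ?thesis by (simp only: l2_inner_commute)
qed

section \<open>Ladder operators and displaced Hermite functions\<close>

text \<open>The usual factor \<open>1 / sqrt 2\<close> is left out of the ladder operators. Their
  commutator is therefore 2, and the number operators have the eigenvalues
  \<open>2 * \<alpha> k\<close>.\<close>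

definition raise :: "('n::finite \<Rightarrow> complex) \<Rightarrow> 'n \<Rightarrow> (real^'n \<Rightarrow>
    complex) \<Rightarrow> real^'n \<Rightarrow> complex" where
  "raise \<zeta> k \<phi> x = complex_of_real (x $ k) * \<phi> x - partial (axis k 1) \<phi> x - \<zeta> k * \<phi> x"

definition lower :: "('n::finite \<Rightarrow> complex) \<Rightarrow> 'n \<Rightarrow> (real^'n \<Rightarrow>
    complex) \<Rightarrow> real^'n \<Rightarrow> complex" where
  "lower \<zeta> k \<phi> x = complex_of_real (x $ k) * \<phi> x + partial (axis k 1) \<phi> x - cnj (\<zeta>
      k) * \<phi> x"

lemma schwartz_partial_axis:
  fixes \<phi> :: "real^'n::finite \<Rightarrow> complex"
  shows "schwartz \<phi> \<Longrightarrow> schwartz (partial (axis k 1) \<phi>)"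
  by (rule schwartz_partial[OF _ axis_Basis])

lemma schwartz_raise: "schwartz \<phi> \<Longrightarrow> schwartz (raise \<zeta> k \<phi>)"
  unfolding raise_def[abs_def]
  by (intro schwartz_diff schwartz_component schwartz_partial_axis schwartz_cmult)

lemma schwartz_lower: "schwartz \<phi> \<Longrightarrow> schwartz (lower \<zeta> k \<phi>)"
  unfolding lower_def[abs_def]
  by (intro schwartz_diff schwartz_add schwartz_component schwartz_partial_axis schwartz_cmult)

text \<open>Integration by parts reverses the sign of the derivative and conjugation takes
  \<open>\<zeta> k\<close> to \<open>cnj (\<zeta> k)\<close>: the ladder operators are adjoint to
  each other on Schwartz functions.\<close>

lemma l2_inner_raise:
  assumes f: "schwartz f" and g: "schwartz g"
  shows "l2_inner (raise \<zeta> k f) g = l2_inner f (lower \<zeta> k g)"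
proof -
  note L = schwartz_L2[OF schwartz_component] schwartz_L2[OF schwartz_partial_axis] schwartz_L2[OF
      schwartz_cmult] schwartz_L2
  have i: "integrable lborel (\<lambda>x. complex_of_real (x $ k) * f x * cnj (g x))"
    "integrable lborel (\<lambda>x. partial (axis k 1) f x * cnj (g x))"
    "integrable lborel (\<lambda>x. f x * cnj (partial (axis k 1) g x))"
    "integrable lborel (\<lambda>x. \<zeta> k * f x * cnj (g x))"
    using L f g by (auto intro!: integrable_l2_inner)
  have "l2_inner (raise \<zeta> k f) g = (LINT x|lborel. complex_of_real (x $ k) * f x * cnj (g x))
      - (LINT x|lborel. partial (axis k 1) f x * cnj (g x)) - (LINT x|lborel. \<zeta> k * f x * cnj (g x))"
    unfolding l2_inner_def raise_def left_diff_distrib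
    by (simp add: i Bochner_Integration.integral_diff Bochner_Integration.integrable_diff)
  also have "\<dots> = (LINT x|lborel. complex_of_real (x $ k) * f x * cnj (g x))
      + (LINT x|lborel. f x * cnj (partial (axis k 1) g x)) - (LINT x|lborel. \<zeta> k * f x * cnj (g x))"
    using schwartz_integration_by_parts[OF f g axis_Basis] by simp
  also have "\<dots> = (LINT x|lborel. complex_of_real (x $ k) * f x * cnj (g x)
      + f x * cnj (partial (axis k 1) g x) - \<zeta> k * f x * cnj (g x))"
    using i by (simp add: Bochner_Integration.integral_diff Bochner_Integration.integral_add
        Bochner_Integration.integrable_add)
  also have "\<dots> = l2_inner f (lower \<zeta> k g)"
    unfolding l2_inner_def lower_def by (intro Bochner_Integration.integral_cong refl) (simp add: algebra_simps)
  finally show ?thesis .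
qed

lemma l2_inner_lower:
  assumes "schwartz f" "schwartz g"
  shows "l2_inner (lower \<zeta> k f) g = l2_inner f (raise \<zeta> k g)"
  using l2_inner_raise[OF assms(2,1), of \<zeta> k] l2_inner_commute by metis

text \<open>
  The weight is the Gaussian with parameter \<open>cnj \<zeta>\<close>, which every \<open>lower \<zeta> k\<close> annihilates; it carries
  both the displacement \<open>Re \<zeta>\<close> in position and the phase given by \<open>Im \<zeta>\<close>.
\<close>

definition hermite :: "('n::finite \<Rightarrow> complex) \<Rightarrow> ('n \<Rightarrow> nat) \<Rightarrow>
    real^'n \<Rightarrow> complex" where
  "hermite \<zeta> \<alpha> x = (\<Prod>k\<in>UNIV. poly (hermite_poly (\<zeta> k + cnj (\<zeta> k)) (\<alpha>
      k)) (complex_of_real (x $ k))) * gaussian (\<lambda>k. cnj (\<zeta> k)) x"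

lemma hermite_0: "hermite \<zeta> (\<lambda>_. 0) = gaussian (\<lambda>k. cnj (\<zeta> k))"
  by (rule ext) (simp add: hermite_def)

lemma schwartz_hermite: "schwartz (hermite \<zeta> \<alpha>)"
  unfolding hermite_def[abs_def] by (intro schwartz_prod_poly_component schwartz_gaussian)

lemmas hermite_L2 = schwartz_L2[OF schwartz_hermite]

lemma partial_hermite:
  "partial (axis k 1) (hermite \<zeta> \<alpha>) x = 2 * of_nat (\<alpha> k) * hermite \<zeta> (\<alpha>(k :=
      \<alpha> k - 1)) x
     + (cnj (\<zeta> k) - complex_of_real (x $ k)) * hermite \<zeta> \<alpha> x"
proof -
  define p where "p j = hermite_poly (\<zeta> j + cnj (\<zeta> j))" for j
  \<comment> \<open>Along the line through \<open>x\<close> in direction \<open>axis k 1\<close>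
    only the factor with index \<open>k\<close> and the Gaussian vary; \<open>R\<close> collects the
    constant rest.\<close>
  define R where "R = (\<Prod>j\<in>UNIV - {k}. poly (p j (\<alpha> j)) (complex_of_real (x $ j)))"
  define G where "G = gaussian (\<lambda>k. cnj (\<zeta> k))"
  have split: "hermite \<zeta> \<beta> y = poly (p k (\<beta> k)) (complex_of_real (y $ k)) * R * G y"
    if "\<And>j. j \<noteq> k \<Longrightarrow> \<beta> j = \<alpha> j \<and> y $ j = x $ j" for \<beta> y
  proof -
    have "(\<Prod>j\<in>UNIV. poly (p j (\<beta> j)) (complex_of_real (y $ j))) = poly (p k (\<beta> k))
        (complex_of_real (y $ k)) *
      (\<Prod>j\<in>UNIV - {k}. poly (p j (\<beta> j)) (complex_of_real (y $ j)))"
      by (rule prod.remove) auto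
    also have "(\<Prod>j\<in>UNIV - {k}. poly (p j (\<beta> j)) (complex_of_real (y $ j))) = R"
      unfolding R_def by (intro prod.cong refl) (use that in auto)
    finally show ?thesis by (simp add: hermite_def p_def G_def)
  qed
  have line: "hermite \<zeta> \<alpha> (x + h *\<^sub>R axis k 1) = poly (p k (\<alpha> k)) (complex_of_real (x
      $ k) + complex_of_real h) * R * G (x + h *\<^sub>R axis k 1)" for h
    using split[of \<alpha> "x + h *\<^sub>R axis k 1"] by (simp add: axis_def)
  have "((\<lambda>h. poly (p k (\<alpha> k)) (complex_of_real (x $ k) + complex_of_real h) * R) has_vector_derivative
      poly (pderiv (p k (\<alpha> k))) (complex_of_real (x $ k)) * R) (at 0)"
    by (rule has_vector_derivative_complex_of_real)
       (auto intro!: derivative_eq_intros DERIV_chain2[OF poly_DERIV])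
  from has_vector_derivative_mult[OF this has_partial[OF gaussian_differentiable], of "\<lambda>k. cnj (\<zeta>
      k)" x "axis k 1"]
  have "((\<lambda>h. hermite \<zeta> \<alpha> (x + h *\<^sub>R axis k 1)) has_vector_derivative
      poly (p k (\<alpha> k)) (complex_of_real (x $ k)) * R * ((cnj (\<zeta> k) - complex_of_real (x $ k)) * G x)
      + poly (pderiv (p k (\<alpha> k))) (complex_of_real (x $ k)) * R * G x) (at 0)"
    unfolding line G_def by (simp add: partial_gaussian)
  from partialI[OF this] show ?thesis
    using split[of \<alpha> x] split[of "\<alpha>(k := \<alpha> k - 1)" x]
    by (simp add: p_def pderiv_hermite_poly algebra_simps)
qed

lemma lower_hermite: "lower \<zeta> k (hermite \<zeta> \<alpha>) x = 2 * of_nat (\<alpha> k) * hermite \<zeta>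
    (\<alpha>(k := \<alpha> k - 1)) x"
  by (simp add: lower_def partial_hermite algebra_simps)

lemma raise_hermite: "raise \<zeta> k (hermite \<zeta> \<alpha>) x = hermite \<zeta> (\<alpha>(k := Suc
    (\<alpha> k))) x"
proof -
  define p where "p j = hermite_poly (\<zeta> j + cnj (\<zeta> j))" for j
  define R where "R = (\<Prod>j\<in>UNIV - {k}. poly (p j (\<alpha> j)) (complex_of_real (x $ j)))"
  have split: "hermite \<zeta> (\<alpha>(k := m)) x = poly (p k m) (complex_of_real (x $ k)) * R * gaussian
      (\<lambda>k. cnj (\<zeta> k)) x" for m
  proof -
    have "(\<Prod>j\<in>UNIV. poly (p j ((\<alpha>(k := m)) j)) (complex_of_real (x $ j))) = poly (p k m)
        (complex_of_real (x $ k)) *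
      (\<Prod>j\<in>UNIV - {k}. poly (p j ((\<alpha>(k := m)) j)) (complex_of_real (x $ j)))"
      by (subst prod.remove[of UNIV k]) auto
    also have "(\<Prod>j\<in>UNIV - {k}. poly (p j ((\<alpha>(k := m)) j)) (complex_of_real (x $ j))) = R"
      unfolding R_def by (intro prod.cong refl) auto
    finally show ?thesis by (simp add: hermite_def p_def)
  qed
  show ?thesis
    unfolding raise_def partial_hermite using split[of "\<alpha> k"] split[of "Suc (\<alpha> k)"] split[of
        "\<alpha> k - 1"]
    by (simp add: p_def pderiv_hermite_poly algebra_simps)
qed

text \<open>Adding the two ladder operators cancels the derivative. The resulting three-term
  recurrence keeps polynomial multiples inside the span of Hermite functions.\<close>

lemma component_hermite:
  "complex_of_real (x $ k) * hermite \<zeta> \<alpha> x = (1/2) * hermite \<zeta> (\<alpha>(k := Suc (\<alpha> k))) x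
     + of_nat (\<alpha> k) * hermite \<zeta> (\<alpha>(k := \<alpha> k - 1)) x + ((\<zeta> k + cnj (\<zeta> k))
         / 2) * hermite \<zeta> \<alpha> x"
proof -
  have "raise \<zeta> k \<phi> x + lower \<zeta> k \<phi> x = 2 * (complex_of_real (x $ k) * \<phi> x) -
      (\<zeta> k + cnj (\<zeta> k)) * \<phi> x" for \<phi>
    by (simp add: raise_def lower_def algebra_simps)
  moreover have "X = (1/2) * A + (1/2) * B + Z / 2 * H" if "A + B = 2 * X - Z * H" for A B X Z H :: complex
  proof -
    have "X = (A + B + Z * H) / 2" using that by simp
    then show ?thesis by (simp add: add_divide_distrib)
  qed
  ultimately have "complex_of_real (x $ k) * \<phi> x = (1/2) * raise \<zeta> k \<phi> x + (1/2) * lower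
      \<zeta> k \<phi> x + (\<zeta> k + cnj (\<zeta> k)) / 2 * \<phi> x" for \<phi>
    by blast
  from this[of "hermite \<zeta> \<alpha>"] show ?thesis
    unfolding raise_hermite lower_hermite by simp
qed

lemma raise_lower_hermite:
  "raise \<zeta> k (lower \<zeta> k (hermite \<zeta> \<alpha>)) = (\<lambda>x. 2 * of_nat (\<alpha> k) *
      hermite \<zeta> \<alpha> x)"
proof
  fix x
  let ?h = "hermite \<zeta> (\<alpha>(k := \<alpha> k - 1))"
  have l: "lower \<zeta> k (hermite \<zeta> \<alpha>) = (\<lambda>x. 2 * of_nat (\<alpha> k) * ?h x)"
    by (rule ext) (rule lower_hermite)
  have "raise \<zeta> k (\<lambda>x. c * ?h x) x = c * raise \<zeta> k ?h x" for c
    unfolding raise_def partial_cmult[OF schwartz_differentiable[OF schwartz_hermite]] by (simp add: algebra_simps)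
  then have "raise \<zeta> k (lower \<zeta> k (hermite \<zeta> \<alpha>)) x = 2 * of_nat (\<alpha> k) * hermite
      \<zeta> (\<alpha>(k := Suc (\<alpha> k - 1))) x"
    unfolding l by (simp add: raise_hermite)
  then show "raise \<zeta> k (lower \<zeta> k (hermite \<zeta> \<alpha>)) x = 2 * of_nat (\<alpha> k) * hermite
      \<zeta> \<alpha> x"
    \<comment> \<open>For \<open>\<alpha> k = 0\<close> the truncated subtraction gives the wrong
      index \<open>Suc 0\<close>, but the factor \<open>\<alpha> k\<close> vanishes.\<close>
    by (cases "\<alpha> k = 0") auto
qed

lemma l2_inner_raise_lower:
  assumes "schwartz f"
  shows "l2_inner (raise \<zeta> k (lower \<zeta> k f)) (hermite \<zeta> \<alpha>) = 2 * of_nat (\<alpha> k) *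
      l2_inner f (hermite \<zeta> \<alpha>)"
proof -
  have "l2_inner (raise \<zeta> k (lower \<zeta> k f)) (hermite \<zeta> \<alpha>) = l2_inner f (raise \<zeta> k
      (lower \<zeta> k (hermite \<zeta> \<alpha>)))"
    using assms by (simp add: l2_inner_raise l2_inner_lower schwartz_raise schwartz_lower schwartz_hermite)
  also have "\<dots> = 2 * of_nat (\<alpha> k) * l2_inner f (hermite \<zeta> \<alpha>)"
    unfolding raise_lower_hermite l2_inner_cmult_right by simp
  finally show ?thesis .
qed

text \<open>Distinct multi-indices differ in some \<open>k\<close> and so are separated by the
  eigenvalues of the symmetric operator
  \<open>raise \<zeta> k \<circ> lower \<zeta> k\<close>.\<close>

lemma hermite_orthogonal:
  assumes "\<alpha> \<noteq> \<beta>"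
  shows "l2_inner (hermite \<zeta> \<alpha>) (hermite \<zeta> \<beta>) = 0"
proof -
  obtain k where k: "\<alpha> k \<noteq> \<beta> k" using assms by auto
  have "2 * of_nat (\<alpha> k) * l2_inner (hermite \<zeta> \<alpha>) (hermite \<zeta> \<beta>) = 2 * of_nat
      (\<beta> k) * l2_inner (hermite \<zeta> \<alpha>) (hermite \<zeta> \<beta>)"
    using l2_inner_raise_lower[OF schwartz_hermite, of \<zeta> k \<zeta> \<alpha> \<beta>]
    by (simp only: raise_lower_hermite l2_inner_cmult_left)
  then show ?thesis using k by simp
qed

text \<open>\<open>gaussian z\<close> is an eigenvector of \<open>lower \<zeta> k\<close> with
  eigenvalue \<open>z k - cnj (\<zeta> k)\<close>. Each raising operator in the Hermite function,
  moved to the left as a lowering one, produces this factor; the induction is on the total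
  degree.\<close>

lemma l2_inner_gaussian_hermite:
  "l2_inner (gaussian z) (hermite \<zeta> \<alpha>) = (\<Prod>k\<in>UNIV. (z k - cnj (\<zeta> k)) ^ \<alpha> k)
      * l2_inner (gaussian z) (gaussian (\<lambda>k. cnj (\<zeta> k)))"
proof (induction "\<Sum>k\<in>UNIV. \<alpha> k" arbitrary: \<alpha>)
  case 0
  then have "\<alpha> = (\<lambda>_. 0)" by auto
  then show ?case by (simp add: hermite_0)
next
  case (Suc m)
  then obtain k where k: "\<alpha> k > 0" by (metis gr0I sum.neutral nat.distinct(1))
  define \<beta> where "\<beta> = \<alpha>(k := \<alpha> k - 1)"
  have \<alpha>: "\<alpha> = \<beta>(k := Suc (\<beta> k))" using k by (auto simp: \<beta>_def)
  have "(\<Sum>j\<in>UNIV. \<alpha> j) = \<alpha> k + (\<Sum>j\<in>UNIV - {k}. \<alpha> j)" "(\<Sum>j\<in>UNIV.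
      \<beta> j) = \<beta> k + (\<Sum>j\<in>UNIV - {k}. \<alpha> j)"
    by (simp_all add: sum.remove[of UNIV k] \<beta>_def)
  then have m: "m = (\<Sum>j\<in>UNIV. \<beta> j)" using Suc.hyps(2) k by (simp add: \<beta>_def)
  have low: "lower \<zeta> k (gaussian z) = (\<lambda>x. (z k - cnj (\<zeta> k)) * gaussian z x)"
    by (rule ext) (simp add: lower_def partial_gaussian algebra_simps)
  have "hermite \<zeta> \<alpha> = raise \<zeta> k (hermite \<zeta> \<beta>)"
    by (rule ext) (simp add: raise_hermite \<alpha>)
  then have "l2_inner (gaussian z) (hermite \<zeta> \<alpha>) = l2_inner (lower \<zeta> k (gaussian z))
      (hermite \<zeta> \<beta>)"
    by (simp add: l2_inner_lower schwartz_gaussian schwartz_hermite)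
  also have "\<dots> = (z k - cnj (\<zeta> k)) * ((\<Prod>j\<in>UNIV. (z j - cnj (\<zeta> j)) ^ \<beta> j) *
      l2_inner (gaussian z) (gaussian (\<lambda>k. cnj (\<zeta> k))))"
    unfolding low l2_inner_cmult_left using Suc.hyps(1)[OF m] by simp
  also have "(z k - cnj (\<zeta> k)) * ((\<Prod>j\<in>UNIV. (z j - cnj (\<zeta> j)) ^ \<beta> j) * c) =
      (\<Prod>j\<in>UNIV. (z j - cnj (\<zeta> j)) ^ \<alpha> j) * c" for c
    by (subst (1 2) prod.remove[of UNIV k]) (auto simp: \<alpha> intro!: prod.cong)
  finally show ?case .
qed

lemma l2_inner_gaussian:
  "l2_inner (gaussian z) (gaussian w) = (\<Prod>k\<in>UNIV. complex_of_real (sqrt pi) * exp ((z k + cnj (w k))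
      ^ 2 / 4))"
  unfolding l2_inner_def cnj_gaussian by (rule integral_gaussian_mult)

lemma hermite_norm_pos: "0 < L2_norm (hermite \<zeta> \<alpha>)"
proof -
  \<comment> \<open>With this choice all factors \<open>z k - cnj (\<zeta> k)\<close> are 1, so a
    single packet has nonzero inner product with every Hermite function.\<close>
  define z where "z k = cnj (\<zeta> k) + 1" for k
  have "l2_inner (gaussian z) (hermite \<zeta> \<alpha>) \<noteq> 0"
    by (simp add: l2_inner_gaussian_hermite l2_inner_gaussian z_def)
  then have "0 < L2_norm (gaussian z) * L2_norm (hermite \<zeta> \<alpha>)"
    using L2_Cauchy_Schwarz[OF gaussian_L2[of z] hermite_L2[of \<zeta> \<alpha>]] by (meson less_le_trans
        zero_less_norm_iff)
  then show ?thesis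
    using L2_norm_nonneg[of "hermite \<zeta> \<alpha>"] by (cases "L2_norm (hermite \<zeta> \<alpha>) = 0") auto
qed

text \<open>Every packet is the Gaussian weight of the basis times the exponential of a linear form.
  Expanding this exponential reduces orthogonality to packets to orthogonality to polynomial
  multiples of the weight.\<close>

lemma hermite_total:
  assumes f: "f \<in> L2" and orth: "\<And>\<alpha>. l2_inner f (hermite \<zeta> \<alpha>) = 0"
  shows "AE x in lborel. f x = 0"
proof (rule gaussian_total[OF f])
  fix z
  note [measurable] = L2_measurable[OF f]
  \<comment> \<open>Conjugated because \<open>f\<close> is placed in the second slot of
    \<open>l2_inner\<close>: \<open>cnj (gaussian z x)\<close> is the weight times
    \<open>exp (l x)\<close>.\<close>
  define w where "w k = cnj (z k - \<zeta> k)" for k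
  define l where "l x = (\<Sum>k\<in>UNIV. w k * complex_of_real (x $ k))" for x :: "real^'a"
  have [measurable]: "l \<in> borel_measurable borel" unfolding l_def by measurable
  have sch: "schwartz (\<lambda>x. l x ^ m * hermite \<zeta> \<alpha> x)" for m \<alpha>
  proof (induction m)
    case (Suc m)
    have "schwartz (\<lambda>x. \<Sum>k\<in>UNIV. w k * (complex_of_real (x $ k) * (l x ^ m * hermite \<zeta>
        \<alpha> x)))"
      by (intro schwartz_sum schwartz_cmult schwartz_component Suc)
    then show ?case by (simp add: l_def sum_distrib_right mult.assoc)
  qed (simp add: schwartz_hermite)
  note L = schwartz_L2[OF sch]
  \<comment> \<open>One factor \<open>l\<close> is rewritten by the three-term recurrence, which
    changes the multi-index; hence the induction over all \<open>\<alpha>\<close> at once.\<close>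
  have zero: "l2_inner (\<lambda>x. l x ^ m * hermite \<zeta> \<alpha> x) f = 0" for m \<alpha>
  proof (induction m arbitrary: \<alpha>)
    case 0
    then show ?case using l2_inner_commute[of f "hermite \<zeta> \<alpha>"] orth[of \<alpha>] by simp
  next
    case (Suc m)
    have eq: "l x ^ Suc m * hermite \<zeta> \<alpha> x = (\<Sum>k\<in>UNIV. w k * ((1/2) * (l x ^ m * hermite
        \<zeta> (\<alpha>(k := Suc (\<alpha> k))) x)
        + of_nat (\<alpha> k) * (l x ^ m * hermite \<zeta> (\<alpha>(k := \<alpha> k - 1)) x) + ((\<zeta> k +
            cnj (\<zeta> k)) / 2) * (l x ^ m * hermite \<zeta> \<alpha> x)))" for x
    proof -
      have "l x ^ Suc m * hermite \<zeta> \<alpha> x = (\<Sum>k\<in>UNIV. w k * (l x ^ m * (complex_of_real (x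
          $ k) * hermite \<zeta> \<alpha> x)))"
        by (simp add: l_def sum_distrib_right sum_distrib_left mult_ac)
      also have "\<dots> = (\<Sum>k\<in>UNIV. w k * ((1/2) * (l x ^ m * hermite \<zeta> (\<alpha>(k := Suc
          (\<alpha> k))) x)
        + of_nat (\<alpha> k) * (l x ^ m * hermite \<zeta> (\<alpha>(k := \<alpha> k - 1)) x) + ((\<zeta> k +
            cnj (\<zeta> k)) / 2) * (l x ^ m * hermite \<zeta> \<alpha> x)))"
        by (intro sum.cong refl, simp only: component_hermite) (simp add: algebra_simps)
      finally show ?thesis .
    qed
    have comb: "l2_inner (\<lambda>x. c * (c1 * g1 x + c2 * g2 x + c3 * g3 x)) f =
        c * (c1 * l2_inner g1 f + c2 * l2_inner g2 f + c3 * l2_inner g3 f)"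
      if "g1 \<in> L2" "g2 \<in> L2" "g3 \<in> L2" for c c1 c2 c3 g1 g2 g3
      by (simp only: l2_inner_cmult_left l2_inner_add_left L2_add L2_cmult that f)
    show ?case
      unfolding eq
      by (subst l2_inner_sum_left) (auto intro!: L2_add L2_cmult L f sum.neutral simp only: comb[OF L L L] Suc, simp)
  qed
  define h where "h = hermite \<zeta> (\<lambda>_. 0)"
  have [measurable]: "h \<in> borel_measurable borel" unfolding h_def by (rule schwartz_measurable[OF schwartz_hermite])
  have cnj_h: "cnj (gaussian z x) = h x * exp (l x)" for x
  proof -
    have "cnj (gaussian z x) = gaussian (\<lambda>k. cnj (\<zeta> k) + w k) x"
      unfolding cnj_gaussian by (simp add: w_def)
    then show ?thesis unfolding gaussian_add by (simp add: h_def hermite_0 l_def)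
  qed
  define W where "W = (\<Sum>k\<in>UNIV. norm (w k))"
  have l_le: "norm (l x) \<le> W * norm x" for x
    unfolding l_def W_def by (rule norm_sum_coordinates_le)
  \<comment> \<open>A single square integrable majorant of all partial sums of the exponential
    series times the weight: Gaussian decay beats the factor
    \<open>exp (W * norm x)\<close>.\<close>
  define d where "d x = h x * complex_of_real (exp (W * norm x))" for x
  have [measurable]: "d \<in> borel_measurable borel" unfolding d_def by measurable
  have "rapidly_decreasing d"
    unfolding rapidly_decreasing_def
  proof
    fix N
    define K where "K = (\<Sum>k\<in>UNIV. norm (cnj (\<zeta> k)))"
    obtain C where C: "\<And>x::real^'a. (1 + norm x) ^ N * exp ((K + W) * norm x - (1/2) * (norm x)\<^sup>2) \<le> C"
      using gaussian_decay[of "1/2" N "K + W", where 'a="real^'a"] by auto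
    have "(1 + norm x) ^ N * norm (d x) \<le> C" for x
    proof -
      have "norm (d x) \<le> exp (K * norm x - (1/2) * (norm x)\<^sup>2) * exp (W * norm x)"
        using norm_gaussian_le[of "\<lambda>k. cnj (\<zeta> k)" x] by (simp add: d_def h_def hermite_0 norm_mult K_def)
      also have "\<dots> = exp ((K + W) * norm x - (1/2) * (norm x)\<^sup>2)"
        by (simp add: exp_add[symmetric] algebra_simps)
      finally show ?thesis by (intro order_trans[OF mult_left_mono C]) auto
    qed
    then show "\<exists>C. \<forall>x. (1 + norm x) ^ N * norm (d x) \<le> C" by blast
  qed
  then have d: "d \<in> L2" by (rule rapidly_decreasing_L2) measurable
  have "(\<lambda>M. LINT x|lborel. (\<Sum>m<M. l x ^ m /\<^sub>R fact m) * h x * cnj (f x))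
      \<longlonglongrightarrow> (LINT x|lborel. exp (l x) * h x * cnj (f x))"
  proof (rule integral_dominated_convergence[where w="\<lambda>x. norm (d x) * norm (f x)"])
    show "integrable lborel (\<lambda>x. norm (d x) * norm (f x))"
      by (rule L2_integrable_norm_mult[OF d f])
    show "AE x in lborel. (\<lambda>M. (\<Sum>m<M. l x ^ m /\<^sub>R fact m) * h x * cnj (f x))
        \<longlonglongrightarrow> exp (l x) * h x * cnj (f x)"
      using exp_converges[of "l _"] by (intro AE_I2 tendsto_mult_right) (simp add: sums_def)
    show "AE x in lborel. norm ((\<Sum>m<M. l x ^ m /\<^sub>R fact m) * h x * cnj (f x)) \<le> norm (d x) *
        norm (f x)" for M
    proof (rule AE_I2)
      fix x
      have "norm (\<Sum>m<M. l x ^ m /\<^sub>R fact m) \<le> (\<Sum>m<M. norm (l x) ^ m /\<^sub>R fact m)"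
        by (rule sum_norm_le) (simp add: norm_power)
      also have "\<dots> \<le> (suminf (\<lambda>m. norm (l x) ^ m /\<^sub>R fact m))"
        by (rule sum_le_suminf) (auto simp: summable_exp)
      also have "\<dots> = exp (norm (l x))" by (simp add: exp_def)
      also have "\<dots> \<le> exp (W * norm x)" using l_le by simp
      finally have "norm (\<Sum>m<M. l x ^ m /\<^sub>R fact m) * norm (h x) \<le> exp (W * norm x) * norm (h x)"
        by (rule mult_right_mono) simp
      then show "norm ((\<Sum>m<M. l x ^ m /\<^sub>R fact m) * h x * cnj (f x)) \<le> norm (d x) * norm (f x)"
        using mult_right_mono[of _ _ "norm (f x)"] by (simp add: norm_mult d_def mult.commute[of "norm (h x)"])
    qed
  qed measurable
  moreover have "(LINT x|lborel. (\<Sum>m<M. l x ^ m /\<^sub>R fact m) * h x * cnj (f x)) = 0" for M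
  proof -
    have "(\<Sum>m<M. l x ^ m /\<^sub>R fact m) * h x = (\<Sum>m<M. complex_of_real (inverse (fact m)) * (l x ^
        m * h x))" for x
      by (simp add: sum_distrib_right scaleR_conv_of_real mult.assoc)
    then show ?thesis
      using l2_inner_sum_left[of "{..<M}" "\<lambda>m x. complex_of_real (inverse (fact m)) * (l x ^ m * h x)" f]
      by (simp add: l2_inner_def[symmetric] l2_inner_cmult_left L2_cmult L f zero h_def)
  qed
  ultimately have "(LINT x|lborel. exp (l x) * h x * cnj (f x)) = 0"
    by (simp add: LIMSEQ_const_iff)
  then have "cnj (LINT x|lborel. f x * gaussian z x) = 0"
    unfolding Bochner_Integration.integral_cnj[symmetric] by (simp add: cnj_h mult_ac)
  then show "(LINT x|lborel. f x * gaussian z x) = 0" by simp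
qed

text \<open>\<open>L2_basis\<close> numbers its vectors by naturals. Bijectivity of this enumeration
  of the countable set of multi-indices is all that matters.\<close>

definition multi_index :: "nat \<Rightarrow> 'n::finite \<Rightarrow> nat" where
  "multi_index = from_nat_into UNIV"

lemma bij_multi_index: "bij (multi_index :: nat \<Rightarrow> 'n::finite \<Rightarrow> nat)"
proof -
  have "infinite (UNIV :: ('n \<Rightarrow> nat) set)"
  proof
    assume "finite (UNIV :: ('n \<Rightarrow> nat) set)"
    then have "finite (range (\<lambda>m::nat. \<lambda>_::'n. m))" by (rule finite_subset[rotated]) simp
    then show False by (subst (asm) finite_image_iff) (auto simp: inj_on_def fun_eq_iff)
  qed
  then show ?thesis
    unfolding multi_index_def by (intro bij_betw_from_nat_into) auto
qed

definition hermite_basis :: "('n::finite \<Rightarrow> complex) \<Rightarrow> nat \<Rightarrow> real^'n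
    \<Rightarrow> complex" where
  "hermite_basis \<zeta> j x = inverse (complex_of_real (L2_norm (hermite \<zeta> (multi_index j)))) * hermite
      \<zeta> (multi_index j) x"

lemma schwartz_hermite_basis: "schwartz (hermite_basis \<zeta> j)"
  unfolding hermite_basis_def[abs_def] by (intro schwartz_cmult schwartz_hermite)

lemma l2_inner_hermite_basis:
  "l2_inner f (hermite_basis \<zeta> j) = inverse (complex_of_real (L2_norm (hermite \<zeta> (multi_index j))))
      * l2_inner f (hermite \<zeta> (multi_index j))"
  unfolding hermite_basis_def[abs_def] l2_inner_cmult_right by simp

interpretation hermite_basis: L2_basis "hermite_basis \<zeta>" for \<zeta> :: "'n::finite \<Rightarrow> complex"
proof
  show "hermite_basis \<zeta> j \<in> L2" for j by (rule schwartz_L2[OF schwartz_hermite_basis])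
  show "l2_inner (hermite_basis \<zeta> j) (hermite_basis \<zeta> k) = (if j = k then 1 else 0)" for j k
  proof -
    have eq: "l2_inner (hermite_basis \<zeta> j) (hermite_basis \<zeta> k) = inverse (complex_of_real (L2_norm
        (hermite \<zeta> (multi_index k)))) *
       (inverse (complex_of_real (L2_norm (hermite \<zeta> (multi_index j)))) * l2_inner (hermite \<zeta>
           (multi_index j)) (hermite \<zeta> (multi_index k)))"
      unfolding l2_inner_hermite_basis by (simp add: hermite_basis_def[abs_def] l2_inner_cmult_left)
    show ?thesis
    proof (cases "j = k")
      case True
      then show ?thesis
        unfolding eq using hermite_norm_pos[of \<zeta> "multi_index k"] by (simp add: l2_inner_self
            power2_eq_square field_simps)
    next
      case False
      then have "multi_index j \<noteq> (multi_index k :: 'n \<Rightarrow> nat)"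
        using bij_is_inj[OF bij_multi_index] by (auto dest: injD)
      then show ?thesis unfolding eq using False by (simp add: hermite_orthogonal)
    qed
  qed
  show "AE x in lborel. f x = 0" if f: "f \<in> L2" and orth: "\<And>j. l2_inner f (hermite_basis \<zeta> j) = 0" for f
  proof (rule hermite_total[OF f])
    fix \<alpha> :: "'n \<Rightarrow> nat"
    obtain j where "\<alpha> = multi_index j" using bij_is_surj[OF bij_multi_index] by (metis surjD)
    then show "l2_inner f (hermite \<zeta> \<alpha>) = 0"
      using orth[of j] hermite_norm_pos[of \<zeta> \<alpha>] by (simp add: l2_inner_hermite_basis)
  qed
qed

section \<open>The Weyl quantization of the quadratic symbol\<close>

lemma count_list_replicate: "count_list (replicate n x) y = (if y = x then n else 0)"
  by (induction n) auto

text \<open>Makes the choice of an enumeration in \<open>multi_partial\<close> unique when a single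
  direction occurs, as in every monomial of the symbol.\<close>

lemma count_list_eq_replicate:
  assumes "\<forall>j. count_list ks j = (if j = k then n else 0)"
  shows "ks = replicate n k"
proof -
  have "set ks \<subseteq> {k}"
    using assms count_list_0_iff by (metis singleton_iff subsetI)
  then have "ks = replicate (length ks) k"
    by (auto simp: replicate_length_same subset_eq)
  moreover from this have "length ks = n"
    using assms count_list_replicate[of "length ks" k k] by simp
  ultimately show ?thesis by simp
qed

lemma multi_partial_axis:
  "multi_partial (\<lambda>j. if j = k then n else 0) = iter_partial (replicate n (axis k 1))"
proof -
  have "\<forall>j. count_list (SOME ks. \<forall>j. count_list ks j = (if j = k then n else 0)) j = (if j = k
      then n else 0)"
    by (rule someI[of _ "replicate n k"]) (simp add: count_list_replicate)
  then have "(SOME ks. \<forall>j. count_list ks j = (if j = k then n else 0)) = replicate n k"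
    by (rule count_list_eq_replicate)
  then show ?thesis by (simp add: multi_partial_def)
qed

definition weyl_monomial :: "(('n::finite + 'n) \<Rightarrow>\<^sub>0 nat) \<Rightarrow> (real^'n \<Rightarrow>
    complex) \<Rightarrow> real^'n \<Rightarrow> complex" where
  "weyl_monomial m \<phi> x = \<i> ^ (\<Sum>k\<in>UNIV. Poly_Mapping.lookup m (Inr k)) *
     multi_partial (\<lambda>k. Poly_Mapping.lookup m (Inr k)) (\<lambda>y. x_monomial m (x + (1/2) *\<^sub>R
         y) * \<phi> (x + y)) 0"

lemma weyl_op_superset:
  assumes "finite S" "Poly_Mapping.keys p \<subseteq> S"
  shows "weyl_op p \<phi> x = (\<Sum>m\<in>S. Poly_Mapping.lookup p m * weyl_monomial m \<phi> x)"
proof -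
  have "weyl_op p \<phi> x = (\<Sum>m\<in>Poly_Mapping.keys p. Poly_Mapping.lookup p m * weyl_monomial m \<phi> x)"
    by (simp add: weyl_op_def weyl_monomial_def Let_def mult.assoc)
  also have "\<dots> = (\<Sum>m\<in>S. Poly_Mapping.lookup p m * weyl_monomial m \<phi> x)"
    by (rule sum.mono_neutral_left) (use assms in \<open>auto simp: in_keys_iff\<close>)
  finally show ?thesis .
qed

lemma weyl_op_single: "weyl_op (Poly_Mapping.single m c) \<phi> x = c * weyl_monomial m \<phi> x"
  by (subst weyl_op_superset[of "{m}"]) auto

lemma weyl_op_add: "weyl_op (p + q) \<phi> x = weyl_op p \<phi> x + weyl_op q \<phi> x"
proof -
  let ?S = "Poly_Mapping.keys p \<union> Poly_Mapping.keys q"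
  have "weyl_op r \<phi> x = (\<Sum>m\<in>?S. Poly_Mapping.lookup r m * weyl_monomial m \<phi> x)"
    if "Poly_Mapping.keys r \<subseteq> ?S" for r
    using that by (intro weyl_op_superset) auto
  then show ?thesis
    using Poly_Mapping.keys_add[of p q]
    by (simp add: lookup_add algebra_simps sum.distrib)
qed

lemma weyl_op_sum: "weyl_op (\<Sum>i\<in>A. p i) \<phi> x = (\<Sum>i\<in>A. weyl_op (p i) \<phi> x)"
  by (induction A rule: infinite_finite_induct) (simp_all add: weyl_op_add weyl_op_def[of 0])

lemma weyl_monomial_0:
  fixes \<phi> :: "real^'n::finite \<Rightarrow> complex"
  shows "weyl_monomial 0 \<phi> x = \<phi> x"
  using multi_partial_axis[of "undefined :: 'n" 0] by (simp add: weyl_monomial_def x_monomial_def)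

lemma weyl_monomial_Inl:
  "weyl_monomial (Poly_Mapping.single (Inl k) n) \<phi> x = complex_of_real (x $ k) ^ n * \<phi> x"
  using multi_partial_axis[of k 0]
  by (simp add: weyl_monomial_def x_monomial_def lookup_single when_def if_distrib[of "\<lambda>n. _ ^ n"]
      prod.delta' cong: if_cong)

lemma iter_partial_shift: "iter_partial ds (\<lambda>y. \<phi> (x + y)) = (\<lambda>y. iter_partial ds \<phi> (x + y))"
  by (induction ds) (auto simp: partial_def add.assoc)

lemma weyl_monomial_Inr:
  "weyl_monomial (Poly_Mapping.single (Inr k) n) \<phi> x = \<i> ^ n * iter_partial (replicate n (axis k 1)) \<phi> x"
proof -
  have "(\<lambda>j. Poly_Mapping.lookup (Poly_Mapping.single (Inr k :: 'a + 'a) n) (Inr j)) = (\<lambda>j. if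
      j = k then n else 0)"
    by (auto simp: lookup_single when_def fun_eq_iff)
  then show ?thesis
    by (simp add: weyl_monomial_def multi_partial_axis x_monomial_def lookup_single when_def iter_partial_shift)
qed

text \<open>\<open>weyl_op\<close> is linear but turns products of symbols into Moyal products, so
  the symbol has to be expanded into monomials first.\<close>

lemma quadratic_symbol_eq:
  "quadratic_symbol c u v b = Poly_Mapping.single 0 (\<i> * complex_of_real c) +
     (\<Sum>k\<in>UNIV. Poly_Mapping.single (Poly_Mapping.single (Inl k) 1) (- 2 * \<i> * complex_of_real (v $ k))
       + Poly_Mapping.single (Poly_Mapping.single (Inr k) 1) (2 * \<i> * complex_of_real (u $ k))
       + Poly_Mapping.single (Poly_Mapping.single (Inl k) 2) (\<i> * complex_of_real (b $ k))
       + Poly_Mapping.single (Poly_Mapping.single (Inr k) 2) (\<i> * complex_of_real (b $ k)))"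
proof -
  have sq: "X k ^ 2 = Poly_Mapping.single (Poly_Mapping.single (Inl k) 2) 1"
    "Y k ^ 2 = Poly_Mapping.single (Poly_Mapping.single (Inr k) 2) 1" for k :: 'a
    by (simp_all add: X_def Y_def power2_eq_square mult_single single_add[symmetric] numeral_2_eq_2)
  show ?thesis
    unfolding quadratic_symbol_def sq sum_distrib_left add.assoc sum.distrib[symmetric]
    by (rule arg_cong2[where f="(+)"])
       (auto simp: Const_def X_def Y_def mult_single distrib_left single_uminus[symmetric] algebra_simps
           intro!: sum.cong)
qed

text \<open>No monomial mixes \<open>X\<close> and \<open>Y\<close>, hence no ordering terms arise:
  \<open>X k\<close> acts by multiplication and \<open>Y k\<close> by \<open>\<i>\<close> times the
  partial derivative, whose square gives the minus sign of the second derivative.\<close>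

lemma weyl_op_quadratic_symbol:
  "weyl_op (quadratic_symbol c u v b) \<phi> x = \<i> * complex_of_real c * \<phi> x +
     (\<Sum>k\<in>UNIV. - 2 * \<i> * complex_of_real (v $ k) * (complex_of_real (x $ k) * \<phi> x)
        - 2 * complex_of_real (u $ k) * partial (axis k 1) \<phi> x
        + \<i> * complex_of_real (b $ k) * (complex_of_real (x $ k) ^ 2 * \<phi> x - partial (axis k 1)
            (partial (axis k 1) \<phi>) x))"
  unfolding quadratic_symbol_eq weyl_op_add weyl_op_sum weyl_op_single weyl_monomial_0 weyl_monomial_Inl
      weyl_monomial_Inr
  by (simp add: numeral_2_eq_2 algebra_simps sum.distrib)

lemma partial_component_mult:
  fixes \<phi> :: "real^'n::finite \<Rightarrow> complex"
  assumes "schwartz \<phi>"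
  shows "partial (axis k 1) (\<lambda>x. complex_of_real (x $ k) * \<phi> x) x = \<phi> x + complex_of_real (x
      $ k) * partial (axis k 1) \<phi> x"
  using partial_mult[OF differentiable_of_real_inner[of "axis k 1" x] schwartz_differentiable[OF assms], of "axis k 1"]
    partial_inner[of "axis k 1" "axis k 1" x]
  by (simp add: inner_axis)

lemma raise_lower_expand:
  fixes \<phi> :: "real^'n::finite \<Rightarrow> complex"
  assumes \<phi>: "schwartz \<phi>"
  shows "raise \<zeta> k (lower \<zeta> k \<phi>) x =
    complex_of_real (x $ k) ^ 2 * \<phi> x - partial (axis k 1) (partial (axis k 1) \<phi>) x - \<phi> x
    - (\<zeta> k + cnj (\<zeta> k)) * (complex_of_real (x $ k) * \<phi> x) + (cnj (\<zeta> k) - \<zeta> k) *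
        partial (axis k 1) \<phi> x + \<zeta> k * cnj (\<zeta> k) * \<phi> x"
proof -
  note d = schwartz_differentiable
  note s = schwartz_component schwartz_partial_axis schwartz_cmult schwartz_add \<phi>
  have "lower \<zeta> k \<phi> = (\<lambda>x. (complex_of_real (x $ k) * \<phi> x + partial (axis k 1) \<phi>
      x) + (- cnj (\<zeta> k)) * \<phi> x)"
    by (rule ext) (simp add: lower_def)
  then have "partial (axis k 1) (lower \<zeta> k \<phi>) x = \<phi> x + complex_of_real (x $ k) * partial (axis
      k 1) \<phi> x
      + partial (axis k 1) (partial (axis k 1) \<phi>) x - cnj (\<zeta> k) * partial (axis k 1) \<phi> x"
    by (simp only: partial_add d s partial_component_mult partial_cmult)
       (simp add: algebra_simps)
  then show ?thesis
    by (simp add: raise_def lower_def algebra_simps power2_eq_square)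
qed

text \<open>
  The centre of the symbol is the phase space point \<open>(v/b, - u/b)\<close>; the momentum coordinate \<open>y\<close>
  is quantized by \<open>\<i> d/dx\<close>.
\<close>

definition shift_point :: "real^'n::finite \<Rightarrow> real^'n \<Rightarrow> real^'n \<Rightarrow> 'n
    \<Rightarrow> complex" where
  "shift_point u v b k = Complex (v $ k / b $ k) (- (u $ k / b $ k))"

text \<open>In units of \<open>\<i>\<close>: the value
  \<open>c - \<Sum>k ((u k)^2 + (v k)^2) / b k\<close> of the symbol at its centre, plus the
  oscillator energies with their zero-point part \<open>b k\<close>.\<close>

definition eigenvalue :: "real \<Rightarrow> real^'n::finite \<Rightarrow> real^'n \<Rightarrow> real^'n
    \<Rightarrow> ('n \<Rightarrow> nat) \<Rightarrow> real" where
  "eigenvalue c u v b \<alpha> = c + (\<Sum>k\<in>UNIV. b $ k * (2 * real (\<alpha> k) + 1) - ((u $ k)\<^sup>2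
      + (v $ k)\<^sup>2) / b $ k)"

text \<open>Completing the square: \<open>\<zeta>\<close> is chosen so that the first order terms of
  \<open>raise \<circ> lower\<close> match the linear part of the symbol. The scalar part
  \<open>b k\<close> compensates the commutator, and the quotient compensates
  \<open>\<zeta> k * cnj (\<zeta> k)\<close>.\<close>

lemma weyl_op_quadratic_symbol_ladder:
  fixes \<phi> :: "real^'n::finite \<Rightarrow> complex" and u v b :: "real^'n"
  assumes b: "\<And>k. b $ k \<noteq> 0" and \<phi>: "schwartz \<phi>"
  defines "\<zeta> \<equiv> shift_point u v b"
  shows "weyl_op (quadratic_symbol c u v b) \<phi> x = \<i> * complex_of_real (c + (\<Sum>k\<in>UNIV. b $ k -
      ((u $ k)\<^sup>2 + (v $ k)\<^sup>2) / b $ k)) * \<phi> x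
    + (\<Sum>k\<in>UNIV. \<i> * complex_of_real (b $ k) * raise \<zeta> k (lower \<zeta> k \<phi>) x)"
proof -
  have "- 2 * \<i> * complex_of_real (v $ k) * (complex_of_real (x $ k) * \<phi> x)
        - 2 * complex_of_real (u $ k) * partial (axis k 1) \<phi> x
        + \<i> * complex_of_real (b $ k) * (complex_of_real (x $ k) ^ 2 * \<phi> x - partial (axis k 1)
            (partial (axis k 1) \<phi>) x)
     = \<i> * complex_of_real (b $ k - ((u $ k)\<^sup>2 + (v $ k)\<^sup>2) / b $ k) * \<phi> x + \<i> *
         complex_of_real (b $ k) * raise \<zeta> k (lower \<zeta> k \<phi>) x" for k
  proof -
    define B U V where "B = complex_of_real (b $ k)" "U = complex_of_real (u $ k)" "V = complex_of_real (v $ k)"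
    have B: "B \<noteq> 0" using b by (simp add: B_U_V_def)
    have \<zeta>: "\<zeta> k = (V - \<i> * U) / B" "cnj (\<zeta> k) = (V + \<i> * U) / B"
      using b by (simp_all add: \<zeta>_def shift_point_def B_U_V_def complex_eq_iff)
    have 1: "B * (\<zeta> k + cnj (\<zeta> k)) = 2 * V" "B * (cnj (\<zeta> k) - \<zeta> k) = 2 * \<i> * U" "B *
        (\<zeta> k * cnj (\<zeta> k)) = (U\<^sup>2 + V\<^sup>2) / B"
      unfolding \<zeta>(2) unfolding \<zeta>(1) using B by (simp_all add: field_simps power2_eq_square)
    \<comment> \<open>Expressing \<open>U\<close>, \<open>V\<close> and the quotient through the
      sum, difference and product of \<open>\<zeta> k\<close> and its conjugate makes the identity
      polynomial, with no division by \<open>b k\<close> left.\<close>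
    define r s t q where "r = \<zeta> k + cnj (\<zeta> k)" "s = cnj (\<zeta> k) - \<zeta> k" "t = \<zeta> k *
        cnj (\<zeta> k)" "q = (U\<^sup>2 + V\<^sup>2) / B"
    have 2: "V = B * r / 2" "\<i> * U = B * s / 2" "q = B * t"
      using 1 by (simp_all add: r_s_t_q_def)
    have 3: "U = - \<i> * B * s / 2"
      using arg_cong[OF 2(2), of "\<lambda>w. - \<i> * w"] by simp
    have bq: "complex_of_real (b $ k - ((u $ k)\<^sup>2 + (v $ k)\<^sup>2) / b $ k) = B - q"
      by (simp add: B_U_V_def r_s_t_q_def)
    show ?thesis
      unfolding bq raise_lower_expand[OF \<phi>] B_U_V_def(1)[symmetric] B_U_V_def(2)[symmetric]
          B_U_V_def(3)[symmetric] r_s_t_q_def(1)[symmetric]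
        r_s_t_q_def(2)[symmetric] r_s_t_q_def(3)[symmetric] 3 2(1) 2(3)
      by (simp add: algebra_simps)
  qed
  then show ?thesis
    unfolding weyl_op_quadratic_symbol by (simp add: sum.distrib distrib_left distrib_right sum_distrib_left
        sum_distrib_right)
qed

lemma schwartz_weyl_op_quadratic_symbol:
  assumes "\<And>k. b $ k \<noteq> 0" "schwartz \<phi>"
  shows "schwartz (weyl_op (quadratic_symbol c u v b) \<phi>)"
proof -
  have "weyl_op (quadratic_symbol c u v b) \<phi> = (\<lambda>x. \<i> * complex_of_real (c + (\<Sum>k\<in>UNIV.
      b $ k - ((u $ k)\<^sup>2 + (v $ k)\<^sup>2) / b $ k)) * \<phi> x
    + (\<Sum>k\<in>UNIV. \<i> * complex_of_real (b $ k) * raise (shift_point u v b) k (lower (shift_point u v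
        b) k \<phi>) x))"
    by (rule ext) (rule weyl_op_quadratic_symbol_ladder[OF assms])
  then show ?thesis
    by (simp only:) (intro schwartz_add schwartz_cmult schwartz_sum schwartz_raise schwartz_lower assms)
qed

text \<open>The number operators are symmetric and are moved onto the Hermite function, where they
  are scalars.\<close>

lemma l2_inner_weyl_op_quadratic_symbol:
  fixes \<phi> :: "real^'n::finite \<Rightarrow> complex" and u v b :: "real^'n"
  assumes b: "\<And>k. b $ k \<noteq> 0" and \<phi>: "schwartz \<phi>"
  defines "\<zeta> \<equiv> shift_point u v b"
  shows "l2_inner (weyl_op (quadratic_symbol c u v b) \<phi>) (hermite \<zeta> \<alpha>) =
    \<i> * complex_of_real (eigenvalue c u v b \<alpha>) * l2_inner \<phi> (hermite \<zeta> \<alpha>)"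
proof -
  define c' where "c' = c + (\<Sum>k\<in>UNIV. b $ k - ((u $ k)\<^sup>2 + (v $ k)\<^sup>2) / b $ k)"
  have A: "weyl_op (quadratic_symbol c u v b) \<phi> = (\<lambda>x. \<i> * complex_of_real c' * \<phi> x
    + (\<Sum>k\<in>UNIV. \<i> * complex_of_real (b $ k) * raise \<zeta> k (lower \<zeta> k \<phi>) x))"
    unfolding \<zeta>_def c'_def by (rule ext) (rule weyl_op_quadratic_symbol_ladder[OF b \<phi>])
  note L = schwartz_L2[OF \<phi>] schwartz_L2[OF schwartz_raise[OF schwartz_lower[OF \<phi>]]] hermite_L2
  have "l2_inner (weyl_op (quadratic_symbol c u v b) \<phi>) (hermite \<zeta> \<alpha>) =
      \<i> * complex_of_real c' * l2_inner \<phi> (hermite \<zeta> \<alpha>)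
      + (\<Sum>k\<in>UNIV. \<i> * complex_of_real (b $ k) * (2 * of_nat (\<alpha> k) * l2_inner \<phi> (hermite
          \<zeta> \<alpha>)))"
    unfolding A by (simp only: l2_inner_add_left l2_inner_sum_left l2_inner_cmult_left L2_cmult L2_sum L
        l2_inner_raise_lower[OF \<phi>])
  also have "\<dots> = \<i> * complex_of_real (eigenvalue c u v b \<alpha>) * l2_inner \<phi> (hermite \<zeta>
      \<alpha>)"
    by (simp add: eigenvalue_def c'_def sum.distrib sum_subtractf sum_distrib_left sum_distrib_right algebra_simps)
  finally show ?thesis .
qed

definition star_evolution :: "real \<Rightarrow> real^'n::finite \<Rightarrow> real^'n \<Rightarrow> real^'n
    \<Rightarrow> real \<Rightarrow> (real^'n \<Rightarrow> complex) \<Rightarrow> real^'n \<Rightarrow> complex" where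
  "star_evolution c u v b = L2_basis.evolution (hermite_basis (shift_point u v b)) (\<lambda>j. eigenvalue c u
      v b (multi_index j))"

theorem is_operator_exp_quadratic_symbol:
  assumes "\<And>k. b $ k \<noteq> 0"
  shows "is_operator_exp (weyl_op (quadratic_symbol c u v b)) (star_evolution c u v b 1)"
  unfolding star_evolution_def
proof (rule hermite_basis.is_operator_exp_evolution)
  show "hermite_basis.coeff (shift_point u v b) (weyl_op (quadratic_symbol c u v b) \<phi>) j =
      \<i> * complex_of_real (eigenvalue c u v b (multi_index j)) * hermite_basis.coeff (shift_point u v b) \<phi> j"
    if "schwartz \<phi>" for \<phi> j
    unfolding hermite_basis.coeff_def l2_inner_hermite_basis l2_inner_weyl_op_quadratic_symbol[OF assms that]
    by (simp add: mult_ac)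
qed (use assms in \<open>auto intro: schwartz_hermite_basis schwartz_L2 schwartz_weyl_op_quadratic_symbol\<close>)

section \<open>Cross Wigner functions\<close>

lemma L2_affine:
  fixes f :: "'a::euclidean_space \<Rightarrow> complex"
  assumes f: "f \<in> L2" and c: "c \<noteq> 0"
  shows "(\<lambda>y. f (q + c *\<^sub>R y)) \<in> L2"
    and "(L2_norm (\<lambda>y. f (q + c *\<^sub>R y)))\<^sup>2 = inverse (\<bar>c\<bar> ^ DIM('a)) * (L2_norm
        f)\<^sup>2"
proof -
  note [measurable] = L2_measurable[OF f]
  have m: "(\<lambda>x. (norm (f x))\<^sup>2) \<in> borel_measurable borel" by measurable
  show "(\<lambda>y. f (q + c *\<^sub>R y)) \<in> L2"
    using f lborel_integral_affine(1)[OF c m, of q] by (auto simp: L2_def)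
  show "(L2_norm (\<lambda>y. f (q + c *\<^sub>R y)))\<^sup>2 = inverse (\<bar>c\<bar> ^ DIM('a)) * (L2_norm f)\<^sup>2"
    unfolding L2_norm_power2 using lborel_integral_affine(2)[OF c m, of q] c by (simp add: field_simps)
qed

lemma L2_unimodular:
  assumes f: "f \<in> L2" and e: "e \<in> borel_measurable borel" "\<And>x. norm (e x) = 1"
  shows "(\<lambda>x. e x * f x) \<in> L2" "L2_norm (\<lambda>x. e x * f x) = L2_norm f"
  using f e by (auto simp: L2_def L2_norm_def norm_mult)

definition wigner_const :: "'n::finite itself \<Rightarrow> complex" where
  "wigner_const _ = complex_of_real (1 / (2 * pi) ^ CARD('n))"

lemma cross_wigner_eq:
  fixes \<phi> \<psi> :: "real^'n::finite \<Rightarrow> complex"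
  shows "cross_wigner \<phi> \<psi> (q, t) = wigner_const TYPE('n) *
    (LINT y|lborel. exp (\<i> * complex_of_real (y \<bullet> t)) * \<phi> (q + (1/2) *\<^sub>R y) * \<psi> (q -
        (1/2) *\<^sub>R y))"
  by (simp add: cross_wigner_def wigner_const_def)

text \<open>At a fixed phase space point the integral is, up to a phase, an inner product of dilated
  translates. Each dilation by one half multiplies the squared norm by \<open>2 ^ CARD('n)\<close>,
  and Cauchy-Schwarz gives a bound independent of the point.\<close>

lemma
  fixes \<phi> \<psi> :: "real^'n::finite \<Rightarrow> complex"
  assumes \<phi>: "\<phi> \<in> L2" and \<psi>: "\<psi> \<in> L2"
  shows integrable_cross_wigner:
      "integrable lborel (\<lambda>y. exp (\<i> * complex_of_real (y \<bullet> t)) * \<phi> (q + (1/2)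
          *\<^sub>R y) * \<psi> (q - (1/2) *\<^sub>R y))"
    and norm_cross_wigner_le: "norm (cross_wigner \<phi> \<psi> (q, t)) \<le> norm (wigner_const TYPE('n)) * 2
        ^ CARD('n) * (L2_norm \<phi> * L2_norm \<psi>)"
proof -
  define f g where "f y = exp (\<i> * complex_of_real (y \<bullet> t)) * \<phi> (q + (1/2) *\<^sub>R y)" "g y =
      cnj (\<psi> (q + (- (1/2)) *\<^sub>R y))" for y
  have half: "1/2 \<noteq> (0::real)" "- (1/2) \<noteq> (0::real)" by simp_all
  note \<phi>' = L2_affine[OF \<phi> half(1), of q] and \<psi>' = L2_affine[OF \<psi> half(2), of q]
  have f: "f \<in> L2" "L2_norm f = L2_norm (\<lambda>y. \<phi> (q + (1/2) *\<^sub>R y))"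
    unfolding f_g_def by (rule L2_unimodular; use \<phi>' in simp)+
  have g: "g \<in> L2" "L2_norm g = L2_norm (\<lambda>y. \<psi> (q + (- (1/2)) *\<^sub>R y))"
    unfolding f_g_def using \<psi>'(1) by (auto intro: L2_cnj simp: L2_norm_cnj)
  have norms: "L2_norm f * L2_norm g = 2 ^ CARD('n) * (L2_norm \<phi> * L2_norm \<psi>)"
  proof -
    have "(L2_norm f)\<^sup>2 = 2 ^ CARD('n) * (L2_norm \<phi>)\<^sup>2" "(L2_norm g)\<^sup>2 = 2 ^ CARD('n) *
        (L2_norm \<psi>)\<^sup>2"
      unfolding f(2) g(2) \<phi>'(2) \<psi>'(2) by (simp_all add: power_one_over)
    then have "(L2_norm f * L2_norm g)\<^sup>2 = (2 ^ CARD('n) * (L2_norm \<phi> * L2_norm \<psi>))\<^sup>2"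
      unfolding power_mult_distrib by (simp add: power2_eq_square[of "2 ^ CARD('n)"])
    then show ?thesis
      by (rule power2_eq_imp_eq) (auto simp: L2_norm_nonneg)
  qed
  have eq: "f y * cnj (g y) = exp (\<i> * complex_of_real (y \<bullet> t)) * \<phi> (q + (1/2) *\<^sub>R y) *
      \<psi> (q - (1/2) *\<^sub>R y)" for y
    by (simp add: f_g_def)
  show "integrable lborel (\<lambda>y. exp (\<i> * complex_of_real (y \<bullet> t)) * \<phi> (q + (1/2)
      *\<^sub>R y) * \<psi> (q - (1/2) *\<^sub>R y))"
    using integrable_l2_inner[OF f(1) g(1)] unfolding eq .
  have "norm (l2_inner f g) \<le> 2 ^ CARD('n) * (L2_norm \<phi> * L2_norm \<psi>)"
    using L2_Cauchy_Schwarz[OF f(1) g(1)] unfolding norms .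
  then show "norm (cross_wigner \<phi> \<psi> (q, t)) \<le> norm (wigner_const TYPE('n)) * 2 ^ CARD('n) *
      (L2_norm \<phi> * L2_norm \<psi>)"
    unfolding cross_wigner_eq norm_mult l2_inner_def eq mult.assoc by (rule mult_left_mono) simp
qed

lemma cross_wigner_measurable:
  fixes \<phi> \<psi> :: "real^'n::finite \<Rightarrow> complex"
  assumes [measurable]: "\<phi> \<in> borel_measurable borel" "\<psi> \<in> borel_measurable borel"
  shows "cross_wigner \<phi> \<psi> \<in> borel_measurable borel"
proof -
  have "(\<lambda>p. wigner_const TYPE('n) * (LINT y|lborel. exp (\<i> * complex_of_real (y \<bullet> snd p)) *
      \<phi> (fst p + (1/2) *\<^sub>R y) * \<psi> (fst p - (1/2) *\<^sub>R y)))
      \<in> borel_measurable (borel \<Otimes>\<^sub>M borel)"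
    by measurable
  moreover have "(\<lambda>p. wigner_const TYPE('n) * (LINT y|lborel. exp (\<i> * complex_of_real (y \<bullet>
      snd p)) * \<phi> (fst p + (1/2) *\<^sub>R y) * \<psi> (fst p - (1/2) *\<^sub>R y))) = cross_wigner \<phi> \<psi>"
    using cross_wigner_eq[of \<phi> \<psi>] by (auto simp: fun_eq_iff)
  ultimately show ?thesis by (simp add: borel_prod)
qed

lemma cross_wigner_add_left:
  "\<phi> \<in> L2 \<Longrightarrow> \<phi>' \<in> L2 \<Longrightarrow> \<psi> \<in> L2 \<Longrightarrow>
      cross_wigner (\<lambda>x. \<phi> x + \<phi>' x) \<psi> p = cross_wigner \<phi> \<psi> p + cross_wigner
      \<phi>' \<psi> p"
  by (cases p) (simp add: cross_wigner_eq distrib_left distrib_right Bochner_Integration.integral_add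
      integrable_cross_wigner)

lemma cross_wigner_add_right:
  "\<phi> \<in> L2 \<Longrightarrow> \<psi> \<in> L2 \<Longrightarrow> \<psi>' \<in> L2 \<Longrightarrow>
      cross_wigner \<phi> (\<lambda>x. \<psi> x + \<psi>' x) p = cross_wigner \<phi> \<psi> p + cross_wigner
      \<phi> \<psi>' p"
  by (cases p) (simp add: cross_wigner_eq distrib_left distrib_right Bochner_Integration.integral_add
      integrable_cross_wigner)

lemma cross_wigner_cmult_left: "cross_wigner (\<lambda>x. c * \<phi> x) \<psi> p = c * cross_wigner \<phi> \<psi> p"
proof (cases p)
  case (Pair q t)
  have "exp (\<i> * complex_of_real (y \<bullet> t)) * (c * \<phi> (q + (1/2) *\<^sub>R y)) * \<psi> (q - (1/2)
      *\<^sub>R y) =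
    c * (exp (\<i> * complex_of_real (y \<bullet> t)) * \<phi> (q + (1/2) *\<^sub>R y) * \<psi> (q - (1/2)
        *\<^sub>R y))" for y
    by (simp only: mult_ac)
  then show ?thesis unfolding Pair cross_wigner_eq by (simp only: integral_mult_right_zero mult_ac)
qed

lemma cross_wigner_cmult_right: "cross_wigner \<phi> (\<lambda>x. c * \<psi> x) p = c * cross_wigner \<phi> \<psi> p"
proof (cases p)
  case (Pair q t)
  have "exp (\<i> * complex_of_real (y \<bullet> t)) * \<phi> (q + (1/2) *\<^sub>R y) * (c * \<psi> (q - (1/2)
      *\<^sub>R y)) =
    c * (exp (\<i> * complex_of_real (y \<bullet> t)) * \<phi> (q + (1/2) *\<^sub>R y) * \<psi> (q - (1/2)
        *\<^sub>R y))" for y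
    by (simp only: mult_ac)
  then show ?thesis unfolding Pair cross_wigner_eq by (simp only: integral_mult_right_zero mult_ac)
qed

section \<open>Decay of cross Wigner functions of Schwartz functions\<close>

lemma one_plus_le_mult:
  fixes a b c :: real
  assumes "0 \<le> a" "0 \<le> b" "c \<le> a + b"
  shows "1 + c \<le> (1 + a) * (1 + b)"
proof -
  have "(1 + a) * (1 + b) = 1 + a + b + a * b" by (simp add: algebra_simps)
  then show ?thesis using assms mult_nonneg_nonneg[OF assms(1,2)] by linarith
qed

lemma cross_wigner_integrand_decay:
  fixes \<phi> \<psi> :: "real^'n::finite \<Rightarrow> complex"
  assumes "schwartz \<phi>" "schwartz \<psi>"
  obtains C where "0 \<le> C" "\<And>q y. (1 + norm q) ^ M * ((1 + norm y) ^ N * norm (\<phi> (q + (1/2)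
      *\<^sub>R y) * \<psi> (q - (1/2) *\<^sub>R y))) \<le> C"
proof -
  obtain A where A: "0 \<le> A" "\<And>x. (1 + norm x) ^ (M + N) * norm (\<phi> x) \<le> A"
    using rapidly_decreasingD[OF schwartz_rapidly_decreasing[OF assms(1)]] by metis
  obtain B where B: "0 \<le> B" "\<And>x. (1 + norm x) ^ (M + N) * norm (\<psi> x) \<le> B"
    using rapidly_decreasingD[OF schwartz_rapidly_decreasing[OF assms(2)]] by metis
  have "(1 + norm q) ^ M * ((1 + norm y) ^ N * norm (\<phi> (q + (1/2) *\<^sub>R y) * \<psi> (q - (1/2)
      *\<^sub>R y))) \<le> A * B" for q y
  proof -
    \<comment> \<open>Both \<open>q\<close> and \<open>y\<close> are controlled by the two arguments
      \<open>a\<close> and \<open>b\<close> of the functions, so decay in \<open>a\<close> and in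
      \<open>b\<close> yields decay in \<open>q\<close> and \<open>y\<close> jointly.\<close>
    define a b where "a = q + (1/2) *\<^sub>R y" "b = q - (1/2) *\<^sub>R y"
    have q: "q = (1/2) *\<^sub>R (a + b)" and y: "y = a - b"
      by (simp_all add: a_b_def scaleR_2[symmetric] flip: scaleR_left.add)
    have "norm q \<le> norm a + norm b"
    proof -
      have "norm q \<le> norm (a + b)" unfolding q by simp
      then show ?thesis using norm_triangle_ineq by (rule order_trans)
    qed
    then have 1: "1 + norm q \<le> (1 + norm a) * (1 + norm b)"
      by (intro one_plus_le_mult norm_ge_zero)
    have "norm y \<le> norm a + norm b" unfolding y by (rule norm_triangle_ineq4)
    then have 2: "1 + norm y \<le> (1 + norm a) * (1 + norm b)"
      by (intro one_plus_le_mult norm_ge_zero)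
    have "(1 + norm q) ^ M * (1 + norm y) ^ N \<le> ((1 + norm a) * (1 + norm b)) ^ M * ((1 + norm a) * (1 +
        norm b)) ^ N"
      by (intro mult_mono power_mono 1 2) auto
    then have "((1 + norm q) ^ M * (1 + norm y) ^ N) * norm (\<phi> a * \<psi> b) \<le> (((1 + norm a) * (1 +
        norm b)) ^ M * ((1 + norm a) * (1 + norm b)) ^ N) * norm (\<phi> a * \<psi> b)"
      by (rule mult_right_mono) simp
    also have "\<dots> = ((1 + norm a) ^ (M + N) * norm (\<phi> a)) * ((1 + norm b) ^ (M + N) * norm (\<psi> b))"
      by (simp add: power_add power_mult_distrib norm_mult)
    also have "\<dots> \<le> A * B"
      by (intro mult_mono A B) auto
    finally show ?thesis by (simp add: a_b_def mult.assoc)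
  qed
  then show ?thesis using that[of "A * B"] A B by simp
qed

lemma cross_wigner_decay_position:
  fixes \<phi> \<psi> :: "real^'n::finite \<Rightarrow> complex"
  assumes "schwartz \<phi>" "schwartz \<psi>"
  shows "\<exists>C. \<forall>q t. (1 + norm q) ^ M * norm (cross_wigner \<phi> \<psi> (q, t)) \<le> C"
proof -
  note [measurable] = schwartz_measurable[OF assms(1)] schwartz_measurable[OF assms(2)]
  define D where "D = 2 * DIM(real^'n)"
  obtain C where C: "0 \<le> C" "\<And>q y. (1 + norm q) ^ M * ((1 + norm y) ^ D * norm (\<phi> (q + (1/2)
      *\<^sub>R y) * \<psi> (q - (1/2) *\<^sub>R y))) \<le> C"
    using cross_wigner_integrand_decay[OF assms] by blast
  define K where "K = (LINT x|lborel. 1 / (1 + norm (x::real^'n)) ^ D)"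
  have "(1 + norm q) ^ M * norm (cross_wigner \<phi> \<psi> (q, t)) \<le> norm (wigner_const TYPE('n)) * (C *
      K)" for q t
  proof -
    have q: "0 < (1 + norm q) ^ M" by (simp add: add_pos_nonneg)
    have "norm (LINT y|lborel. exp (\<i> * complex_of_real (y \<bullet> t)) * \<phi> (q + (1/2) *\<^sub>R y) *
        \<psi> (q - (1/2) *\<^sub>R y)) \<le> (C / (1 + norm q) ^ M) * K"
      unfolding K_def D_def
    proof (rule integrable_decay(2))
      fix y
      show "(1 + norm y) ^ (2 * DIM(real^'n)) * norm (exp (\<i> * complex_of_real (y \<bullet> t)) * \<phi> (q
          + (1/2) *\<^sub>R y) * \<psi> (q - (1/2) *\<^sub>R y)) \<le> C / (1 + norm q) ^ M"
        using C(2)[of q y] q by (simp add: pos_le_divide_eq norm_mult D_def mult_ac)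
    qed measurable
    then have "norm (cross_wigner \<phi> \<psi> (q, t)) \<le> norm (wigner_const TYPE('n)) * ((C / (1 + norm q)
        ^ M) * K)"
      unfolding cross_wigner_eq norm_mult by (rule mult_left_mono) simp
    from mult_left_mono[OF this less_imp_le[OF q]]
    have "(1 + norm q) ^ M * norm (cross_wigner \<phi> \<psi> (q, t)) \<le> (1 + norm q) ^ M * (norm
        (wigner_const TYPE('n)) * ((C / (1 + norm q) ^ M) * K))" .
    also have "w * (c * ((C / w) * K)) = c * (C * K)" if "0 < w" for w c
      using that by simp
    note this[OF q]
    finally show ?thesis .
  qed
  then show ?thesis by blast
qed

text \<open>The derivative of the integrand in direction \<open>axis k 1\<close> of \<open>y\<close>
  integrates to 0. The phase contributes \<open>\<i> * t $ k\<close>, the arguments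
  \<open>q + y/2\<close> and \<open>q - y/2\<close> contribute derivatives with factors
  \<open>1/2\<close> and \<open>- 1/2\<close>.\<close>

lemma cross_wigner_momentum:
  fixes \<phi> \<psi> :: "real^'n::finite \<Rightarrow> complex"
  assumes \<phi>: "schwartz \<phi>" and \<psi>: "schwartz \<psi>"
  shows "\<i> * complex_of_real (t $ k) * cross_wigner \<phi> \<psi> (q, t) =
    (1/2) * cross_wigner \<phi> (partial (axis k 1) \<psi>) (q, t) - (1/2) * cross_wigner (partial (axis k 1)
        \<phi>) \<psi> (q, t)"
proof -
  let ?d = "axis k 1 :: real^'n"
  note s = \<phi> \<psi> schwartz_partial_axis[OF \<phi>, of k] schwartz_partial_axis[OF \<psi>, of k]
  note [measurable] = s[THEN schwartz_measurable]
  define F where "F f g y = exp (\<i> * complex_of_real (y \<bullet> t)) * f (q + (1/2) *\<^sub>R y) * g (q -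
      (1/2) *\<^sub>R y)" for f g y
  have int: "integrable lborel (F f g)" if "schwartz f" "schwartz g" for f g
    unfolding F_def by (intro integrable_cross_wigner schwartz_L2 that)
  have [measurable]: "F f g \<in> borel_measurable borel" if "schwartz f" "schwartz g" for f g
    using borel_measurable_integrable[OF int[OF that]] by simp
  have bound: "\<exists>C. \<forall>y. (1 + norm y) ^ (2 * DIM(real^'n)) * norm (F f g y) \<le> C" if fg:
      "schwartz f" "schwartz g" for f g
  proof -
    obtain C where "\<And>q y. (1 + norm q) ^ 0 * ((1 + norm y) ^ (2 * DIM(real^'n)) * norm (f (q + (1/2)
        *\<^sub>R y) * g (q - (1/2) *\<^sub>R y))) \<le> C"
      using cross_wigner_integrand_decay[OF fg] by blast
    then show ?thesis by (auto simp: F_def norm_mult)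
  qed
  have "(LINT y|lborel. \<i> * complex_of_real (t $ k) * F \<phi> \<psi> y + ((1/2) * F (partial ?d \<phi>)
      \<psi> y - (1/2) * F \<phi> (partial ?d \<psi>) y)) = 0"
  proof -
    obtain C C1 C2 where C: "\<And>y. (1 + norm y) ^ (2 * DIM(real^'n)) * norm (F \<phi> \<psi> y) \<le> C"
      "\<And>y. (1 + norm y) ^ (2 * DIM(real^'n)) * norm (F (partial ?d \<phi>) \<psi> y) \<le> C1"
      "\<And>y. (1 + norm y) ^ (2 * DIM(real^'n)) * norm (F \<phi> (partial ?d \<psi>) y) \<le> C2"
      using bound s by meson
    show ?thesis
    proof (rule integral_directional_derivative_eq_0[OF _ _ _ C(1), where d="?d" and C'="\<bar>t $ k\<bar> * C
        + (1/2) * C1 + (1/2) * C2"])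
      fix y :: "real^'n"
      have e: "((\<lambda>h. exp (\<i> * complex_of_real ((y + h *\<^sub>R ?d) \<bullet> t)))
          has_vector_derivative \<i> * complex_of_real (t $ k) * exp (\<i> * complex_of_real (y \<bullet> t))) (at 0)"
      proof -
        have "((\<lambda>h. exp (\<i> * (complex_of_real (y \<bullet> t) + complex_of_real h * complex_of_real
            (t $ k)))) has_vector_derivative \<i> * complex_of_real (t $ k) * exp (\<i> * complex_of_real (y
            \<bullet> t))) (at 0)"
          by (rule has_vector_derivative_complex_of_real) (auto intro!: derivative_eq_intros)
        then show ?thesis by (simp add: inner_add_left inner_axis' mult.commute)
      qed
      have scaled: "((\<lambda>h. f (x + h *\<^sub>R (c *\<^sub>R ?d))) has_vector_derivative c *\<^sub>R
          partial ?d f x) (at 0)" if "schwartz f" for f x and c :: real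
      proof -
        have "((\<lambda>h. f (x + h *\<^sub>R ?d)) \<circ> (\<lambda>h. c * h) has_vector_derivative c
            *\<^sub>R partial ?d f x) (at 0)"
          by (rule vector_diff_chain_at) (auto intro!: derivative_eq_intros has_partial schwartz_differentiable that)
        then show ?thesis by (simp add: o_def mult.commute)
      qed
      have p: "((\<lambda>h. \<phi> (q + (1/2) *\<^sub>R (y + h *\<^sub>R ?d))) has_vector_derivative (1/2) *
          partial ?d \<phi> (q + (1/2) *\<^sub>R y)) (at 0)"
        using scaled[OF \<phi>, of "q + (1/2) *\<^sub>R y" "1/2"] by (simp add: scaleR_add_right algebra_simps
            scaleR_conv_of_real)
      have m: "((\<lambda>h. \<psi> (q - (1/2) *\<^sub>R (y + h *\<^sub>R ?d))) has_vector_derivative - (1/2) *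
          partial ?d \<psi> (q - (1/2) *\<^sub>R y)) (at 0)"
        using scaled[OF \<psi>, of "q - (1/2) *\<^sub>R y" "-(1/2)"] by (simp add: scaleR_add_right
            algebra_simps scaleR_conv_of_real)
      show "((\<lambda>h. F \<phi> \<psi> (y + h *\<^sub>R ?d)) has_vector_derivative
          \<i> * complex_of_real (t $ k) * F \<phi> \<psi> y + ((1/2) * F (partial ?d \<phi>) \<psi> y - (1/2)
              * F \<phi> (partial ?d \<psi>) y)) (at 0)"
        unfolding F_def
        using has_vector_derivative_mult[OF has_vector_derivative_mult[OF e p] m]
        by (simp add: algebra_simps)
      have "norm (\<i> * complex_of_real (t $ k) * F \<phi> \<psi> y + ((1/2) * F (partial ?d \<phi>) \<psi> y
          - (1/2) * F \<phi> (partial ?d \<psi>) y))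
          \<le> \<bar>t $ k\<bar> * norm (F \<phi> \<psi> y) + ((1/2) * norm (F (partial ?d \<phi>) \<psi> y) +
              (1/2) * norm (F \<phi> (partial ?d \<psi>) y))"
        by (intro order_trans[OF norm_triangle_ineq] add_mono order_trans[OF norm_triangle_ineq4]) (auto simp:
            norm_mult)
      from mult_left_mono[OF this, of "(1 + norm y) ^ (2 * DIM(real^'n))"]
      have "(1 + norm y) ^ (2 * DIM(real^'n)) * norm (\<i> * complex_of_real (t $ k) * F \<phi> \<psi> y +
          ((1/2) * F (partial ?d \<phi>) \<psi> y - (1/2) * F \<phi> (partial ?d \<psi>) y))
          \<le> \<bar>t $ k\<bar> * ((1 + norm y) ^ (2 * DIM(real^'n)) * norm (F \<phi> \<psi> y)) + (1/2) *
              ((1 + norm y) ^ (2 * DIM(real^'n)) * norm (F (partial ?d \<phi>) \<psi> y))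
            + (1/2) * ((1 + norm y) ^ (2 * DIM(real^'n)) * norm (F \<phi> (partial ?d \<psi>) y))"
        by (simp add: algebra_simps)
      also have "\<dots> \<le> \<bar>t $ k\<bar> * C + (1/2) * C1 + (1/2) * C2"
        by (intro add_mono mult_left_mono C) auto
      finally show "(1 + norm y) ^ (2 * DIM(real^'n)) * norm (\<i> * complex_of_real (t $ k) * F \<phi> \<psi>
          y + ((1/2) * F (partial ?d \<phi>) \<psi> y - (1/2) * F \<phi> (partial ?d \<psi>) y)) \<le> \<bar>t
          $ k\<bar> * C + (1/2) * C1 + (1/2) * C2" .
    qed (use s in measurable)
  qed
  then have zero: "\<i> * complex_of_real (t $ k) * (LINT y|lborel. F \<phi> \<psi> y) + ((1/2) * (LINT
      y|lborel. F (partial ?d \<phi>) \<psi> y) - (1/2) * (LINT y|lborel. F \<phi> (partial ?d \<psi>) y)) = 0"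
    by (simp add: Bochner_Integration.integral_add Bochner_Integration.integral_diff int s)
  have "wigner_const TYPE('n) * (\<i> * complex_of_real (t $ k) * (LINT y|lborel. F \<phi> \<psi> y)) =
     wigner_const TYPE('n) * ((1/2) * (LINT y|lborel. F \<phi> (partial ?d \<psi>) y) - (1/2) * (LINT y|lborel.
         F (partial ?d \<phi>) \<psi> y))"
  proof -
    have "w * a = w * (c - b)" if "a + (b - c) = 0" for w a b c :: complex
      using that unfolding add_eq_0_iff2 by simp
    then show ?thesis using zero by blast
  qed
  then show ?thesis
    unfolding cross_wigner_eq F_def[symmetric] by (simp add: algebra_simps)
qed

text \<open>Each factor \<open>t $ k\<close> is traded for a derivative of one of the two functions,
  which stay in the Schwartz class; hence the induction over all pairs.\<close>

lemma cross_wigner_decay_momentum: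
  fixes \<phi> \<psi> :: "real^'n::finite \<Rightarrow> complex"
  assumes "schwartz \<phi>" "schwartz \<psi>"
  shows "\<exists>C. \<forall>q t. (1 + norm q) ^ M * (\<bar>t $ k\<bar> ^ N * norm (cross_wigner \<phi> \<psi>
      (q, t))) \<le> C"
  using assms
proof (induction N arbitrary: \<phi> \<psi>)
  case 0
  then show ?case using cross_wigner_decay_position by simp
next
  case (Suc N)
  obtain C1 where C1: "\<And>q t. (1 + norm q) ^ M * (\<bar>t $ k\<bar> ^ N * norm (cross_wigner \<phi>
      (partial (axis k 1) \<psi>) (q, t))) \<le> C1"
    using Suc.IH[OF Suc.prems(1) schwartz_partial_axis[OF Suc.prems(2)]] by blast
  obtain C2 where C2: "\<And>q t. (1 + norm q) ^ M * (\<bar>t $ k\<bar> ^ N * norm (cross_wigner (partial (axis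
      k 1) \<phi>) \<psi> (q, t))) \<le> C2"
    using Suc.IH[OF schwartz_partial_axis[OF Suc.prems(1)] Suc.prems(2)] by blast
  have "(1 + norm q) ^ M * (\<bar>t $ k\<bar> ^ Suc N * norm (cross_wigner \<phi> \<psi> (q, t))) \<le> (1/2) *
      C1 + (1/2) * C2" for q t
  proof -
    define w where "w = (1 + norm q) ^ M * \<bar>t $ k\<bar> ^ N"
    have "\<bar>t $ k\<bar> * norm (cross_wigner \<phi> \<psi> (q, t)) = norm (\<i> * complex_of_real (t $ k) *
        cross_wigner \<phi> \<psi> (q, t))"
      by (simp add: norm_mult)
    also have "\<dots> \<le> (1/2) * norm (cross_wigner \<phi> (partial (axis k 1) \<psi>) (q, t)) + (1/2) *
        norm (cross_wigner (partial (axis k 1) \<phi>) \<psi> (q, t))"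
      unfolding cross_wigner_momentum[OF Suc.prems] by (rule order_trans[OF norm_triangle_ineq4]) (simp add: norm_mult)
    finally have "w * (\<bar>t $ k\<bar> * norm (cross_wigner \<phi> \<psi> (q, t))) \<le>
        w * ((1/2) * norm (cross_wigner \<phi> (partial (axis k 1) \<psi>) (q, t)) + (1/2) * norm (cross_wigner
            (partial (axis k 1) \<phi>) \<psi> (q, t)))"
      by (rule mult_left_mono) (simp add: w_def)
    also have "\<dots> = (1/2) * (w * norm (cross_wigner \<phi> (partial (axis k 1) \<psi>) (q, t))) + (1/2) *
        (w * norm (cross_wigner (partial (axis k 1) \<phi>) \<psi> (q, t)))"
      by (simp add: algebra_simps)
    also have "\<dots> \<le> (1/2) * C1 + (1/2) * C2"
      by (intro add_mono mult_left_mono) (use C1[of q t] C2[of q t] in \<open>simp_all add: w_def mult.assoc\<close>)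
    finally show ?thesis by (simp add: w_def mult_ac)
  qed
  then show ?case by blast
qed

text \<open>The norm is at most \<open>CARD('n)\<close> times the largest coordinate, so decay in
  each coordinate of \<open>t\<close> separately gives decay in \<open>norm t\<close>.\<close>

lemma one_plus_norm_power_le:
  fixes t :: "real^'n::finite"
  shows "(1 + norm t) ^ N \<le> (1 + real CARD('n)) ^ N * (1 + (\<Sum>k\<in>UNIV. \<bar>t $ k\<bar> ^ N))"
proof -
  define m where "m = Max (range (\<lambda>k. \<bar>t $ k\<bar>))"
  have m: "\<bar>t $ k\<bar> \<le> m" for k unfolding m_def by (rule Max_ge) auto
  have "m \<in> range (\<lambda>k. \<bar>t $ k\<bar>)" unfolding m_def by (rule Max_in) auto
  then obtain k where k: "m = \<bar>t $ k\<bar>" by auto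
  have "norm t \<le> (\<Sum>k\<in>UNIV. \<bar>t $ k\<bar>)" by (rule norm_le_l1_cart)
  also have "\<dots> \<le> real CARD('n) * m" using m by (intro sum_bounded_above) auto
  also have "\<dots> \<le> real CARD('n) * max 1 m" by (intro mult_left_mono) auto
  finally have "1 + norm t \<le> (1 + real CARD('n)) * max 1 m"
    by (simp add: distrib_right add_mono)
  then have "(1 + norm t) ^ N \<le> (1 + real CARD('n)) ^ N * max 1 m ^ N"
    unfolding power_mult_distrib[symmetric] by (rule power_mono) simp
  also have "max 1 m ^ N \<le> 1 + (\<Sum>k\<in>UNIV. \<bar>t $ k\<bar> ^ N)"
  proof (cases "m \<le> 1")
    case True
    then show ?thesis by (simp add: max_def sum_nonneg)
  next
    case False
    have "\<bar>t $ k\<bar> ^ N \<le> (\<Sum>k\<in>UNIV. \<bar>t $ k\<bar> ^ N)" by (rule member_le_sum) auto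
    then show ?thesis using False by (simp add: max_def k)
  qed
  finally show ?thesis by (simp add: mult_left_mono)
qed

text \<open>Supplies the dominating function for the limit of the bounded symbols to unimodular
  parameters.\<close>

theorem integrable_cross_wigner_schwartz:
  fixes \<phi> \<psi> :: "real^'n::finite \<Rightarrow> complex"
  assumes "schwartz \<phi>" "schwartz \<psi>"
  shows "integrable lborel (cross_wigner \<phi> \<psi>)"
proof -
  define N where "N = 2 * DIM((real^'n) \<times> (real^'n))"
  have "\<forall>k. \<exists>C. \<forall>q t. (1 + norm q) ^ N * (\<bar>t $ k\<bar> ^ N * norm (cross_wigner
      \<phi> \<psi> (q, t))) \<le> C"
    using cross_wigner_decay_momentum[OF assms] by blast
  then obtain C where C: "\<And>k q t. (1 + norm q) ^ N * (\<bar>t $ k\<bar> ^ N * norm (cross_wigner \<phi>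
      \<psi> (q, t))) \<le> C k"
    by metis
  obtain C0 where C0: "\<And>q t. (1 + norm q) ^ N * norm (cross_wigner \<phi> \<psi> (q, t)) \<le> C0"
    using cross_wigner_decay_position[OF assms] by blast
  have "(1 + norm p) ^ N * norm (cross_wigner \<phi> \<psi> p) \<le> (1 + real CARD('n)) ^ N * (C0 +
      (\<Sum>k\<in>UNIV. C k))" for p
  proof (cases p)
    case (Pair q t)
    define w where "w = norm (cross_wigner \<phi> \<psi> (q, t))"
    have "0 \<le> w" by (simp add: w_def)
    have "norm p \<le> norm q + norm t" unfolding Pair by (rule norm_Pair_le)
    then have "1 + norm p \<le> (1 + norm q) * (1 + norm t)"
      by (intro one_plus_le_mult norm_ge_zero)
    then have "(1 + norm p) ^ N \<le> (1 + norm q) ^ N * (1 + norm t) ^ N"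
      unfolding power_mult_distrib[symmetric] by (rule power_mono) simp
    also have "\<dots> \<le> (1 + norm q) ^ N * ((1 + real CARD('n)) ^ N * (1 + (\<Sum>k\<in>UNIV. \<bar>t $
        k\<bar> ^ N)))"
      by (intro mult_left_mono one_plus_norm_power_le) simp
    finally have "(1 + norm p) ^ N * w \<le> (1 + norm q) ^ N * ((1 + real CARD('n)) ^ N * (1 +
        (\<Sum>k\<in>UNIV. \<bar>t $ k\<bar> ^ N))) * w"
      using \<open>0 \<le> w\<close> by (rule mult_right_mono)
    also have "\<dots> = (1 + real CARD('n)) ^ N * ((1 + norm q) ^ N * w + (\<Sum>k\<in>UNIV. (1 + norm q) ^ N
        * (\<bar>t $ k\<bar> ^ N * w)))"
      by (simp add: algebra_simps sum_distrib_left sum_distrib_right)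
    also have "\<dots> \<le> (1 + real CARD('n)) ^ N * (C0 + (\<Sum>k\<in>UNIV. C k))"
      unfolding w_def by (intro mult_left_mono add_mono sum_mono C C0) auto
    finally show ?thesis by (simp add: w_def Pair)
  qed
  then show ?thesis
    unfolding N_def by (intro integrable_decay(1) cross_wigner_measurable schwartz_measurable assms)
qed

text \<open>The two packets contribute \<open>- q^2 - y^2 / 4\<close> per coordinate, so the
  \<open>y\<close> integral is Gaussian with coefficient \<open>1/4\<close>. Its constant
  \<open>2 * sqrt pi\<close> against \<open>1 / (2 * pi)\<close> leaves
  \<open>1 / sqrt pi\<close>.\<close>

lemma cross_wigner_gaussian:
  "cross_wigner (gaussian z) (gaussian w) (q, t) =
    (\<Prod>k\<in>UNIV. complex_of_real (1 / sqrt pi) *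
      exp (- (complex_of_real (q $ k) ^ 2) + (z k + w k) * complex_of_real (q $ k) + (\<i> * complex_of_real (t
          $ k) + (z k - w k) / 2) ^ 2))"
proof -
  define b where "b k = \<i> * complex_of_real (t $ k) + (z k - w k) / 2" for k
  define c where "c k = exp (- (complex_of_real (q $ k) ^ 2) + (z k + w k) * complex_of_real (q $ k))" for k
  have prod: "exp (\<i> * complex_of_real (y \<bullet> t)) * gaussian z (q + (1/2) *\<^sub>R y) * gaussian w (q
      - (1/2) *\<^sub>R y) =
     (\<Prod>k\<in>UNIV. c k * exp (- (1/4) * complex_of_real (y $ k) ^ 2 + b k * complex_of_real (y $ k)))" for y
    unfolding inner_vec_def of_real_sum sum_distrib_left exp_sum[OF finite] gaussian_prod
        prod.distrib[symmetric] c_def exp_add[symmetric]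
    by (intro prod.cong arg_cong[where f=exp] refl) (simp add: b_def power2_eq_square field_simps)
  have "(LINT y|lborel. exp (\<i> * complex_of_real (y \<bullet> t)) * gaussian z (q + (1/2) *\<^sub>R y) *
      gaussian w (q - (1/2) *\<^sub>R y)) =
     (\<Prod>k\<in>UNIV. c k * (gauss (1/4) * exp (b k ^ 2 / (4 * (1/4)))))"
  proof -
    have r: "0 < Re (1/4)" by simp
    show ?thesis
      unfolding prod
      by (simp only: integrable_lborel_prod_vec(2)[OF integrable_mult_right[OF integrable_gaussian[OF r]]]
         integral_mult_right_zero gaussian_integral_linear[OF r])
  qed
  also have "\<dots> = (\<Prod>k\<in>UNIV. complex_of_real (2 * sqrt pi) * (c k * exp (b k ^ 2)))"
    using gauss_of_real[of "1/4"] by (simp add: real_sqrt_mult mult_ac)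
  finally have "cross_wigner (gaussian z) (gaussian w) (q, t) =
      (\<Prod>k\<in>(UNIV::'a set). complex_of_real (1 / (2 * pi))) * (\<Prod>k\<in>UNIV. complex_of_real (2 *
          sqrt pi) * (c k * exp (b k ^ 2)))"
    unfolding cross_wigner_eq wigner_const_def by (simp add: power_one_over)
  also have "\<dots> = (\<Prod>k\<in>UNIV. complex_of_real (1 / sqrt pi) * (c k * exp (b k ^ 2)))"
    unfolding prod.distrib[symmetric]
  proof (intro prod.cong refl)
    fix k
    have "1 / (2 * pi) * (2 * sqrt pi) = 1 / sqrt pi"
      by (simp add: real_div_sqrt field_simps)
    then have "complex_of_real (1 / (2 * pi)) * complex_of_real (2 * sqrt pi) = complex_of_real (1 / sqrt pi)"
      by (simp only: of_real_mult[symmetric])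
    then show "complex_of_real (1 / (2 * pi)) * (complex_of_real (2 * sqrt pi) * (c k * exp (b k ^ 2))) =
        complex_of_real (1 / sqrt pi) * (c k * exp (b k ^ 2))"
      by (simp only: mult.assoc[symmetric])
  qed
  finally show ?thesis
    by (simp add: c_def b_def exp_add[symmetric])
qed

section \<open>Gaussian symbols\<close>

text \<open>
  For \<open>e = exp(\<i> b)\<close> one has \<open>cayley e = \<i> tan b\<close> and \<open>2 e / (1 + e\<^sup>2) = 1 / cos b\<close>.
  These expressions continue to \<open>norm e < 1\<close>, where the real part of \<open>cayley e\<close> is negative.
\<close>

definition cayley :: "complex \<Rightarrow> complex" where
  "cayley e = (e\<^sup>2 - 1) / (e\<^sup>2 + 1)"

text \<open>The symbol is centred at the phase space point \<open>(a, - s)\<close>;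
  \<open>\<kappa>\<close> will be the exponential of the quadratic symbol at that point.\<close>

definition gaussian_symbol ::
  "complex \<Rightarrow> ('n::finite \<Rightarrow> complex) \<Rightarrow> ('n \<Rightarrow> real) \<Rightarrow>
      ('n \<Rightarrow> real) \<Rightarrow> (real^'n) \<times> (real^'n) \<Rightarrow> complex" where
  "gaussian_symbol \<kappa> e a s = (\<lambda>(q, t). \<kappa> * (\<Prod>k\<in>UNIV. 2 * e k / (1 + (e k)\<^sup>2) *
     exp (cayley (e k) * complex_of_real ((q $ k - a k)\<^sup>2 + (t $ k + s k)\<^sup>2))))"

text \<open>\<open>cayley\<close> is the Cayley transform of \<open>e^2\<close> and takes the unit
  disc to the left half plane: the sign of the real part is that of
  \<open>norm e ^ 4 - 1\<close>.\<close>

lemma Re_cayley: "Re (cayley e) = ((norm e)\<^sup>2 * (norm e)\<^sup>2 - 1) / (norm (e\<^sup>2 + 1))\<^sup>2"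
proof -
  have "Re ((e\<^sup>2 - 1) * cnj (e\<^sup>2 + 1)) = (norm (e\<^sup>2))\<^sup>2 - 1"
    unfolding cmod_power2 by (simp add: algebra_simps power2_eq_square)
  moreover have "cayley e = (e\<^sup>2 - 1) * cnj (e\<^sup>2 + 1) / complex_of_real ((norm (e\<^sup>2 + 1))\<^sup>2)"
    unfolding cayley_def by (subst complex_div_cnj) simp
  ultimately show ?thesis
    by (simp only: Re_divide_of_real norm_power) (simp add: power2_eq_square)
qed

lemma square_ne_minus_one:
  assumes "norm e < 1"
  shows "1 + e\<^sup>2 \<noteq> (0 :: complex)"
proof
  assume "1 + e\<^sup>2 = 0"
  then have "e\<^sup>2 = - 1" by (simp add: add_eq_0_iff)
  then have "(norm e)\<^sup>2 = 1" by (metis norm_minus_cancel norm_one norm_power)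
  with assms norm_ge_zero[of e] show False unfolding power2_eq_1_iff by linarith
qed

lemma Re_cayley_nonpos:
  assumes "norm e \<le> 1"
  shows "Re (cayley e) \<le> 0"
  unfolding Re_cayley using mult_mono[of "(norm e)\<^sup>2" 1 "(norm e)\<^sup>2" 1] assms
  by (intro divide_nonpos_nonneg) (auto simp: power_le_one)

lemma Re_cayley_neg:
  assumes "norm e < 1"
  shows "Re (cayley e) < 0"
proof -
  have "(norm e)\<^sup>2 < 1" using assms by (simp add: power_less_one_iff)
  then have "(norm e)\<^sup>2 * (norm e)\<^sup>2 < 1"
    using mult_le_one[of "(norm e)\<^sup>2" "(norm e)\<^sup>2"] by (smt (verit) mult_left_le zero_le_power2)
  then show ?thesis
    unfolding Re_cayley using square_ne_minus_one[OF assms]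
    by (intro divide_neg_pos) (auto simp: add.commute)
qed

lemma gaussian_symbol_measurable [measurable]: "gaussian_symbol \<kappa> e a s \<in> borel_measurable borel"
proof -
  have "gaussian_symbol \<kappa> e a s \<in> borel_measurable (borel \<Otimes>\<^sub>M borel)"
    unfolding gaussian_symbol_def by measurable
  then show ?thesis by (simp add: borel_prod)
qed

lemma norm_gaussian_symbol_le:
  assumes "\<And>k. norm (e k) \<le> 1"
  shows "norm (gaussian_symbol \<kappa> e a s p) \<le> norm \<kappa> * (\<Prod>k\<in>UNIV. norm (2 * e k / (1 +
      (e k)\<^sup>2)))"
proof (cases p)
  case (Pair q t)
  have "norm (exp (cayley (e k) * complex_of_real ((q $ k - a k)\<^sup>2 + (t $ k + s k)\<^sup>2))) \<le> 1" for k
  proof -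
    have "Re (cayley (e k)) * ((q $ k - a k)\<^sup>2 + (t $ k + s k)\<^sup>2) \<le> 0"
      using Re_cayley_nonpos[OF assms] by (intro mult_nonpos_nonneg) auto
    then show ?thesis by (simp add: Re_power2)
  qed
  then show ?thesis
    unfolding Pair gaussian_symbol_def split norm_mult prod_norm[symmetric]
    by (intro mult_left_mono prod_mono conjI mult_left_le) auto
qed

lemma gaussian_symbol_split:
  "gaussian_symbol \<kappa> e a s (q, t) =
    (\<kappa> * (\<Prod>k\<in>UNIV. 2 * e k / (1 + (e k)\<^sup>2) * exp (cayley (e k) * complex_of_real (a k) ^
        2) * exp (cayley (e k) * complex_of_real (s k) ^ 2)))
    * ((\<Prod>k\<in>UNIV. exp (- (- cayley (e k)) * complex_of_real (q $ k) ^ 2 + (- 2 * cayley (e k) *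
        complex_of_real (a k)) * complex_of_real (q $ k)))
     * (\<Prod>k\<in>UNIV. exp (- (- cayley (e k)) * complex_of_real (t $ k) ^ 2 + (2 * cayley (e k) *
         complex_of_real (s k)) * complex_of_real (t $ k))))"
proof -
  have "exp (cayley (e k) * complex_of_real ((q $ k - a k)\<^sup>2 + (t $ k + s k)\<^sup>2)) =
     exp (cayley (e k) * complex_of_real (a k) ^ 2) * exp (cayley (e k) * complex_of_real (s k) ^ 2)
     * (exp (- (- cayley (e k)) * complex_of_real (q $ k) ^ 2 + (- 2 * cayley (e k) * complex_of_real (a k)) *
         complex_of_real (q $ k))
     * exp (- (- cayley (e k)) * complex_of_real (t $ k) ^ 2 + (2 * cayley (e k) * complex_of_real (s k)) *
         complex_of_real (t $ k)))" for k
    unfolding exp_add[symmetric] by (rule arg_cong[where f=exp]) (simp add: algebra_simps power2_eq_square)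
  then show ?thesis
    unfolding gaussian_symbol_def split by (simp only: prod.distrib mult.assoc)
qed

lemma integrable_gaussian_symbol:
  assumes e: "\<And>k. norm (e k) < 1"
  shows "integrable lborel (gaussian_symbol \<kappa> e a s)"
proof -
  have R: "0 < Re (- cayley (e k))" for k using Re_cayley_neg[OF e] by simp
  have "integrable (lborel \<Otimes>\<^sub>M lborel) (\<lambda>(q :: real^'a, t :: real^'a).
     (\<Prod>k\<in>UNIV. exp (- (- cayley (e k)) * complex_of_real (q $ k) ^ 2 + (- 2 * cayley (e k) *
         complex_of_real (a k)) * complex_of_real (q $ k)))
     * (\<Prod>k\<in>UNIV. exp (- (- cayley (e k)) * complex_of_real (t $ k) ^ 2 + (2 * cayley (e k) *
         complex_of_real (s k)) * complex_of_real (t $ k))))"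
    by (rule integrable_pair_mult[OF _ _ integrable_lborel_prod_vec(1)[OF integrable_gaussian[OF R]]
        integrable_lborel_prod_vec(1)[OF integrable_gaussian[OF R]]])
       (rule lborel.sigma_finite_measure_axioms)+
  from integrable_mult_right[OF this]
  have "integrable (lborel \<Otimes>\<^sub>M lborel) (gaussian_symbol \<kappa> e a s)"
    by (rule back_subst[where P="integrable (lborel \<Otimes>\<^sub>M lborel)"])
       (auto simp only: fun_eq_iff split_paired_All split gaussian_symbol_split)
  then show ?thesis by (simp only: lborel_prod)
qed

text \<open>Position and momentum share the quadratic coefficient \<open>A k\<close>, so only
  \<open>gauss (A k) ^ 2\<close> occurs, and no square root of a complex number. As
  \<open>A k = 2 / ((e k)^2 + 1)\<close>, it cancels the denominator of the symbol's
  prefactor.\<close>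

lemma integral_gaussian_symbol_cross_wigner:
  fixes z w :: "'n::finite \<Rightarrow> complex"
  assumes e: "\<And>k. norm (e k) < 1"
  defines "T \<equiv> \<lambda>k. cayley (e k)"
  shows "(LINT p|lborel. gaussian_symbol \<kappa> e a s p * cross_wigner (gaussian z) (gaussian w) p) =
    \<kappa> * (\<Prod>k\<in>UNIV. e k * complex_of_real (sqrt pi) *
      exp (((z k + w k - 2 * T k * complex_of_real (a k))\<^sup>2 + (\<i> * (z k - w k) + 2 * T k *
          complex_of_real (s k))\<^sup>2) * ((e k)\<^sup>2 + 1) / 8
         + T k * (complex_of_real (a k) ^ 2 + complex_of_real (s k) ^ 2) + (z k - w k)\<^sup>2 / 4))"
proof -
  define A where "A k = 1 - T k" for k
  have A: "0 < Re (A k)" for k using Re_cayley_neg[OF e, of k] by (simp add: A_def T_def)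
  have ne: "(e k)\<^sup>2 + 1 \<noteq> 0" for k using square_ne_minus_one[OF e, of k] by (simp add: add.commute)
  have A_eq: "A k = 2 / ((e k)\<^sup>2 + 1)" for k
    using ne[of k] by (simp add: A_def T_def cayley_def diff_divide_eq_iff field_simps)
  define B where "B k = z k + w k - 2 * T k * complex_of_real (a k)" for k
  define C where "C k = \<i> * (z k - w k) + 2 * T k * complex_of_real (s k)" for k
  define D where "D k = T k * (complex_of_real (a k) ^ 2 + complex_of_real (s k) ^ 2) + (z k - w k)\<^sup>2 / 4" for k
  define f where "f q = (\<Prod>k\<in>UNIV. exp (- A k * complex_of_real (q $ k) ^ 2 + B k * complex_of_real (q
      $ k)))" for q :: "real^'n"
  define g where "g t = (\<Prod>k\<in>UNIV. exp (- A k * complex_of_real (t $ k) ^ 2 + C k * complex_of_real (t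
      $ k)))" for t :: "real^'n"
  define K where "K = \<kappa> * (\<Prod>k\<in>UNIV. 2 * e k / (1 + (e k)\<^sup>2) * complex_of_real (1 / sqrt
      pi) * exp (D k))"
  have f: "integrable lborel f" and g: "integrable lborel g"
    unfolding f_def g_def by (intro integrable_lborel_prod_vec(1) integrable_gaussian A)+
  have fg: "(LINT q|lborel. f q) = (\<Prod>k\<in>UNIV. gauss (A k) * exp ((B k)\<^sup>2 / (4 * A k)))"
    "(LINT t|lborel. g t) = (\<Prod>k\<in>UNIV. gauss (A k) * exp ((C k)\<^sup>2 / (4 * A k)))"
    unfolding f_def g_def by (simp_all only: integrable_lborel_prod_vec(2)[OF integrable_gaussian[OF A]]
        gaussian_integral_linear[OF A])
  have prod: "gaussian_symbol \<kappa> e a s (q, t) * cross_wigner (gaussian z) (gaussian w) (q, t) = K * (f q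
      * g t)" for q t
  proof -
    have "exp (T k * complex_of_real ((q $ k - a k)\<^sup>2 + (t $ k + s k)\<^sup>2)) *
       exp (- (complex_of_real (q $ k) ^ 2) + (z k + w k) * complex_of_real (q $ k) + (\<i> * complex_of_real
           (t $ k) + (z k - w k) / 2) ^ 2) =
       exp (D k) * (exp (- A k * complex_of_real (q $ k) ^ 2 + B k * complex_of_real (q $ k)) * exp (- A k *
           complex_of_real (t $ k) ^ 2 + C k * complex_of_real (t $ k)))" for k
      unfolding exp_add[symmetric] A_def B_def C_def D_def
      by (rule arg_cong[where f=exp]) (simp add: power2_eq_square field_simps)
    then have "2 * e k / (1 + (e k)\<^sup>2) * exp (T k * complex_of_real ((q $ k - a k)\<^sup>2 + (t $ k + s
        k)\<^sup>2)) *
       (complex_of_real (1 / sqrt pi) * exp (- (complex_of_real (q $ k) ^ 2) + (z k + w k) * complex_of_real (q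
           $ k) + (\<i> * complex_of_real (t $ k) + (z k - w k) / 2) ^ 2)) =
       2 * e k / (1 + (e k)\<^sup>2) * complex_of_real (1 / sqrt pi) * exp (D k) *
       (exp (- A k * complex_of_real (q $ k) ^ 2 + B k * complex_of_real (q $ k)) * exp (- A k *
           complex_of_real (t $ k) ^ 2 + C k * complex_of_real (t $ k)))" for k
      by (simp only: mult_ac)
    then show ?thesis
      unfolding gaussian_symbol_def split cross_wigner_gaussian K_def f_def g_def mult.assoc
      by (simp only: prod.distrib[symmetric] mult.assoc T_def)
  qed
  have int: "integrable (lborel \<Otimes>\<^sub>M lborel) (\<lambda>(q, t). f q * g t)"
    by (rule integrable_pair_mult[OF _ _ f g]) (rule lborel.sigma_finite_measure_axioms)+
  have "(LINT p|lborel. gaussian_symbol \<kappa> e a s p * cross_wigner (gaussian z) (gaussian w) p) =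
     (LINT p|(lborel \<Otimes>\<^sub>M lborel). K * (case p of (q, t) \<Rightarrow> f q * g t))"
    unfolding lborel_prod[symmetric] by (rule Bochner_Integration.integral_cong[OF refl]) (auto simp only: prod
        split: prod.split)
  also have "\<dots> = K * (LINT p|(lborel \<Otimes>\<^sub>M lborel). (case p of (q, t) \<Rightarrow> f q * g t))"
    by (rule integral_mult_right_zero)
  also have "(LINT p|(lborel \<Otimes>\<^sub>M lborel). (case p of (q, t) \<Rightarrow> f q * g t)) = (LINT
      q|lborel. (LINT t|lborel. f q * g t))"
    by (rule lborel_pair.integral_fst[symmetric]) (use int in simp)
  also have "\<dots> = (LINT q|lborel. f q) * (LINT t|lborel. g t)"
    by (simp only: integral_mult_right_zero integral_mult_left_zero)
  also have "K * \<dots> = \<kappa> * (\<Prod>k\<in>UNIV. (2 * e k / (1 + (e k)\<^sup>2) * complex_of_real (1 /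
      sqrt pi) * exp (D k)) *
      (gauss (A k) * exp ((B k)\<^sup>2 / (4 * A k)) * (gauss (A k) * exp ((C k)\<^sup>2 / (4 * A k)))))"
    unfolding K_def fg by (simp only: prod.distrib mult.assoc)
  also have "\<dots> = \<kappa> * (\<Prod>k\<in>UNIV. e k * complex_of_real (sqrt pi) * exp (((B k)\<^sup>2 +
      (C k)\<^sup>2) * ((e k)\<^sup>2 + 1) / 8 + D k))"
  proof (rule arg_cong[where f="\<lambda>x. \<kappa> * x"], rule prod.cong[OF refl])
    fix k
    have "(2 * e k / (1 + (e k)\<^sup>2) * complex_of_real (1 / sqrt pi) * exp (D k)) *
      (gauss (A k) * exp ((B k)\<^sup>2 / (4 * A k)) * (gauss (A k) * exp ((C k)\<^sup>2 / (4 * A k)))) =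
      (2 * e k / (1 + (e k)\<^sup>2) * complex_of_real (1 / sqrt pi) * gauss (A k) ^ 2) * (exp (D k) * exp ((B
          k)\<^sup>2 / (4 * A k)) * exp ((C k)\<^sup>2 / (4 * A k)))"
      by (simp only: power2_eq_square mult_ac)
    also have "exp (D k) * exp ((B k)\<^sup>2 / (4 * A k)) * exp ((C k)\<^sup>2 / (4 * A k)) = exp (((B
        k)\<^sup>2 + (C k)\<^sup>2) * ((e k)\<^sup>2 + 1) / 8 + D k)"
      unfolding exp_add[symmetric] A_eq by (rule arg_cong[where f=exp]) (simp add: field_simps)
    also have "2 * e k / (1 + (e k)\<^sup>2) * complex_of_real (1 / sqrt pi) * gauss (A k) ^ 2 = e k *
        complex_of_real (sqrt pi)"
    proof -
      define r where "r = complex_of_real (sqrt pi)"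
      have r: "complex_of_real pi = r * r" "complex_of_real (1 / sqrt pi) = 1 / r" "r \<noteq> 0"
        unfolding r_def of_real_mult[symmetric] by simp_all
      have g: "gauss (A k) ^ 2 = r * r * (1 + (e k)\<^sup>2) / 2"
        by (simp only: gauss_square[OF A] r(1)) (simp add: A_eq add.commute)
      have "2 * c / d * (1 / r) * (r * r * d / 2) = c * r" if "d \<noteq> 0" for c d :: complex
        using that r(3) by simp
      from this[of "1 + (e k)\<^sup>2" "e k"] ne[of k] show ?thesis
        unfolding r(2) g r_def[symmetric] by (simp add: add.commute)
    qed
    finally show "(2 * e k / (1 + (e k)\<^sup>2) * complex_of_real (1 / sqrt pi) * exp (D k)) *
      (gauss (A k) * exp ((B k)\<^sup>2 / (4 * A k)) * (gauss (A k) * exp ((C k)\<^sup>2 / (4 * A k)))) =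
      e k * complex_of_real (sqrt pi) * exp (((B k)\<^sup>2 + (C k)\<^sup>2) * ((e k)\<^sup>2 + 1) / 8 + D k)" .
  qed
  finally show ?thesis
    by (simp add: B_def C_def D_def add.assoc)
qed

text \<open>The seminorm without derivatives and with the integrable weight of exponent
  \<open>2 * DIM('a)\<close> already controls the pairing.\<close>

lemma tempered_distribution_bounded:
  fixes F :: "'a::euclidean_space \<Rightarrow> complex"
  assumes [measurable]: "F \<in> borel_measurable borel" and F: "\<And>x. norm (F x) \<le> K"
  shows "tempered_distribution (distribution_of F)"
  unfolding tempered_distribution_def
proof (intro conjI allI impI)
  have decay: "(1 + norm x) ^ N * norm (F x * \<phi> x) \<le> K * B" if "(1 + norm x) ^ N * norm (\<phi> x)
      \<le> B" for x N \<phi> B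
  proof -
    have "(1 + norm x) ^ N * norm (F x * \<phi> x) = norm (F x) * ((1 + norm x) ^ N * norm (\<phi> x))"
      by (simp add: norm_mult)
    also have "\<dots> \<le> K * B"
      by (rule mult_mono[OF F that]) (use order_trans[OF norm_ge_zero F] in auto)
    finally show ?thesis .
  qed
  have int: "integrable lborel (\<lambda>x. F x * \<phi> x)" if \<phi>: "schwartz \<phi>" for \<phi>
  proof -
    note [measurable] = schwartz_measurable[OF \<phi>]
    obtain C where C: "\<And>x. (1 + norm x) ^ (2 * DIM('a)) * norm (\<phi> x) \<le> C"
      using rapidly_decreasingD[OF schwartz_rapidly_decreasing[OF \<phi>]] by metis
    show ?thesis
    proof (rule integrable_decay(1))
      show "(1 + norm x) ^ (2 * DIM('a)) * norm (F x * \<phi> x) \<le> K * C" for x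
        by (rule decay[OF C])
    qed measurable
  qed
  show "distribution_of F (\<lambda>x. a * \<phi> x + b * \<psi> x) = a * distribution_of F \<phi> + b *
      distribution_of F \<psi>"
    if "schwartz \<phi>" "schwartz \<psi>" for \<phi> \<psi> a b
    using Bochner_Integration.integral_add[OF integrable_mult_right[OF int[OF that(1)], of a]
        integrable_mult_right[OF int[OF that(2)], of b]]
    by (simp add: distribution_of_def distrib_left mult.left_commute)
  show "\<exists>C N. \<forall>\<phi> B. schwartz \<phi> \<longrightarrow>
        (\<forall>ds\<in>lists Basis. length ds \<le> N \<longrightarrow> (\<forall>x. (1 + norm x) ^ N * norm
            (iter_partial ds \<phi> x) \<le> B)) \<longrightarrow>
        norm (distribution_of F \<phi>) \<le> C * B"
  proof (intro exI[of _ "K * (LINT x|lborel. 1 / (1 + norm (x::'a)) ^ (2 * DIM('a)))"] exI[of _ "2 * DIM('a)"]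
      allI impI)
    fix \<phi> :: "'a \<Rightarrow> complex" and B
    assume \<phi>: "schwartz \<phi>" and "\<forall>ds\<in>lists Basis. length ds \<le> 2 * DIM('a)
        \<longrightarrow> (\<forall>x. (1 + norm x) ^ (2 * DIM('a)) * norm (iter_partial ds \<phi> x) \<le> B)"
    then have B: "(1 + norm x) ^ (2 * DIM('a)) * norm (\<phi> x) \<le> B" for x
      by (auto dest: bspec[of _ _ "[]"])
    note [measurable] = schwartz_measurable[OF \<phi>]
    have "norm (LINT x|lborel. F x * \<phi> x) \<le> (K * B) * (LINT x|lborel. 1 / (1 + norm (x::'a)) ^ (2 * DIM('a)))"
    proof (rule integrable_decay(2))
      show "(1 + norm x) ^ (2 * DIM('a)) * norm (F x * \<phi> x) \<le> K * B" for x
        by (rule decay[OF B])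
    qed measurable
    then show "norm (distribution_of F \<phi>) \<le> K * (LINT x|lborel. 1 / (1 + norm (x::'a)) ^ (2 * DIM('a))) * B"
      by (simp add: distribution_of_def mult_ac)
  qed
qed

section \<open>Gaussian symbols as diagonal operators\<close>

context L2_basis
begin

lemma L2_norm_diagonal_le:
  assumes f: "f \<in> L2" and m: "\<And>j. norm (m j) \<le> K" and K: "0 \<le> K"
  shows "L2_norm (diagonal m f) \<le> K * L2_norm f"
proof (rule power2_le_imp_le)
  have "(norm (coeff (diagonal m f) j))\<^sup>2 \<le> K\<^sup>2 * (norm (coeff f j))\<^sup>2" for j
    unfolding coeff_diagonal[OF f m] norm_mult power_mult_distrib
    by (intro mult_right_mono power_mono m) auto
  from sums_le[OF this Parseval[OF diagonal_L2[OF f m]] sums_mult[OF Parseval[OF f]]]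
  show "(L2_norm (diagonal m f))\<^sup>2 \<le> (K * L2_norm f)\<^sup>2"
    by (simp add: power_mult_distrib)
qed (simp add: K L2_norm_nonneg)

lemma diagonal_tendsto:
  assumes f: "f \<in> L2" and m: "\<And>n j. norm (m n j) \<le> K" "\<And>j. norm (m' j) \<le> K"
    and lim: "\<And>j. (\<lambda>n. m n j) \<longlonglongrightarrow> m' j"
  shows "(\<lambda>n. L2_norm (\<lambda>x. diagonal (m n) f x - diagonal m' f x)) \<longlonglongrightarrow> 0"
proof (rule L2_norm_tendsto_0_coeff)
  have c: "coeff (\<lambda>x. diagonal (m n) f x - diagonal m' f x) j = (m n j - m' j) * coeff f j" for n j
    by (simp add: coeff_diff diagonal_L2[OF f m(1)] diagonal_L2[OF f m(2)] coeff_diagonal[OF f m(1)]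
        coeff_diagonal[OF f m(2)] left_diff_distrib)
  show "(\<lambda>x. diagonal (m n) f x - diagonal m' f x) \<in> L2" for n
    by (intro L2_diff diagonal_L2[OF f m(1)] diagonal_L2[OF f m(2)])
  show "(\<lambda>n. coeff (\<lambda>x. diagonal (m n) f x - diagonal m' f x) j) \<longlonglongrightarrow> 0" for j
  proof -
    have "(\<lambda>n. (m n j - m' j) * coeff f j) \<longlonglongrightarrow> (m' j - m' j) * coeff f j"
      by (intro tendsto_intros lim)
    then show ?thesis by (simp add: c)
  qed
  show "norm (coeff (\<lambda>x. diagonal (m n) f x - diagonal m' f x) j) \<le> (K + K) * norm (coeff f j)" for n j
    unfolding c norm_mult
    by (intro mult_right_mono order_trans[OF norm_triangle_ineq4] add_mono m) simp
  show "summable (\<lambda>j. ((K + K) * norm (coeff f j))\<^sup>2)"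
    unfolding power_mult_distrib by (intro summable_mult summable_coeff f)
qed simp

lemma AE_diagonal_add:
  assumes "f \<in> L2" "g \<in> L2" and m: "\<And>j. norm (m j) \<le> K"
  shows "AE x in lborel. diagonal m (\<lambda>x. f x + g x) x = diagonal m f x + diagonal m g x"
  by (rule AE_eq_coeffI)
     (simp_all add: assms L2_add diagonal_L2[OF _ m] coeff_add coeff_diagonal[OF _ m] distrib_left)

lemma AE_diagonal_cmult:
  assumes "f \<in> L2" and m: "\<And>j. norm (m j) \<le> K"
  shows "AE x in lborel. diagonal m (\<lambda>x. c * f x) x = c * diagonal m f x"
  by (rule AE_eq_coeffI)
     (simp_all add: assms L2_cmult diagonal_L2[OF _ m] coeff_cmult coeff_diagonal[OF _ m] mult.left_commute)

end

section \<open>From wave packets to all square integrable functions\<close>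

text \<open>Density of the span of the packets in usable form: \<open>T\<close> is pairing with some
  \<open>g\<close>, whose conjugate is orthogonal to all packets in the bilinear sense. The Riesz
  representation may use the Hermite basis of any displacement.\<close>

lemma bounded_functional_gaussian_eq_0:
  fixes T :: "(real^'n::finite \<Rightarrow> complex) \<Rightarrow> complex"
  assumes add: "\<And>f g. f \<in> L2 \<Longrightarrow> g \<in> L2 \<Longrightarrow> T (\<lambda>x. f x + g x)
      = T f + T g"
    and cmult: "\<And>c f. f \<in> L2 \<Longrightarrow> T (\<lambda>x. c * f x) = c * T f"
    and bound: "\<And>f. f \<in> L2 \<Longrightarrow> norm (T f) \<le> K * L2_norm f"
    and zero: "\<And>z. T (gaussian z) = 0"
    and f: "f \<in> L2"
  shows "T f = 0"
proof -
  obtain g where g: "g \<in> L2" "\<And>f. f \<in> L2 \<Longrightarrow> T f = l2_inner f g"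
    using hermite_basis.bounded_functional_eq_inner[of T K, OF add cmult bound] by blast
  have "AE x in lborel. cnj (g x) = 0"
  proof (rule gaussian_total[OF L2_cnj[OF g(1)]])
    show "(LINT x|lborel. cnj (g x) * gaussian z x) = 0" for z
      using g(2)[OF gaussian_L2, of z] zero[of z] by (simp add: l2_inner_def mult.commute)
  qed
  then have "l2_inner g f = l2_inner (\<lambda>x. 0) f"
    by (intro l2_inner_cong_AE g L2_zero f) auto
  then have "cnj (l2_inner g f) = 0"
    by (simp add: l2_inner_zero_left)
  then show ?thesis using g(2)[OF f] by (simp add: l2_inner_commute)
qed

text \<open>The entries are polynomial in \<open>e\<close>, so they make sense for
  \<open>norm (e k) < 1\<close> as well. The summand 1 in the exponent is the zero-point
  energy.\<close>

definition multiplier :: "complex \<Rightarrow> ('n::finite \<Rightarrow> complex) \<Rightarrow> nat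
    \<Rightarrow> complex" where
  "multiplier \<kappa> e j = \<kappa> * (\<Prod>k\<in>UNIV. e k ^ (2 * multi_index j k + 1))"

lemma norm_multiplier_le:
  assumes "\<And>k. norm (e k) \<le> 1"
  shows "norm (multiplier \<kappa> e j) \<le> norm \<kappa>"
  unfolding multiplier_def norm_mult prod_norm[symmetric] norm_power
  by (intro mult_left_le prod_le_1 conjI power_le_one) (auto simp: assms)

text \<open>Up to normalisation the coefficients of a packet are the powers
  \<open>(z - cnj \<zeta>)^\<alpha>\<close> times its overlap with the ground state. The factor
  \<open>e^(2 * \<alpha>)\<close> is absorbed by multiplying the displacement by \<open>e^2\<close>,
  and the exponential corrects the overlap.\<close>

lemma diagonal_gaussian:
  fixes e \<zeta> z :: "'n::finite \<Rightarrow> complex"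
  assumes e: "\<And>k. norm (e k) \<le> 1"
  defines "z' \<equiv> \<lambda>k. cnj (\<zeta> k) + (e k)\<^sup>2 * (z k - cnj (\<zeta> k))"
  shows "AE x in lborel. hermite_basis.diagonal \<zeta> (multiplier \<kappa> e) (gaussian z) x =
    (\<kappa> * (\<Prod>k\<in>UNIV. e k * exp (((z k + \<zeta> k)\<^sup>2 - (z' k + \<zeta> k)\<^sup>2) / 4)))
        * gaussian z' x"
proof (rule hermite_basis.AE_eq_coeffI[of _ _ \<zeta>])
  note m = norm_multiplier_le[where e=e, OF e]
  show "hermite_basis.diagonal \<zeta> (multiplier \<kappa> e) (gaussian z) \<in> L2"
    by (rule hermite_basis.diagonal_L2[OF gaussian_L2 m])
  show "(\<lambda>x. (\<kappa> * (\<Prod>k\<in>UNIV. e k * exp (((z k + \<zeta> k)\<^sup>2 - (z' k + \<zeta>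
      k)\<^sup>2) / 4))) * gaussian z' x) \<in> L2"
    by (intro L2_cmult gaussian_L2)
  fix j
  define \<alpha> :: "'n \<Rightarrow> nat" where "\<alpha> = multi_index j"
  define c where "c = inverse (complex_of_real (L2_norm (hermite \<zeta> \<alpha>)))"
  have coeff: "hermite_basis.coeff \<zeta> (gaussian y) j = c * (\<Prod>k\<in>UNIV. (y k - cnj (\<zeta> k)) ^
      \<alpha> k * (complex_of_real (sqrt pi) * exp ((y k + \<zeta> k)\<^sup>2 / 4)))" for y
    unfolding hermite_basis.coeff_def l2_inner_hermite_basis l2_inner_gaussian_hermite l2_inner_gaussian prod.distrib
    by (simp add: c_def \<alpha>_def)
  have factor: "e k ^ (2 * \<alpha> k + 1) * ((z k - cnj (\<zeta> k)) ^ \<alpha> k * (complex_of_real (sqrt pi)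
      * exp ((z k + \<zeta> k)\<^sup>2 / 4))) =
     e k * exp (((z k + \<zeta> k)\<^sup>2 - (z' k + \<zeta> k)\<^sup>2) / 4) * ((z' k - cnj (\<zeta> k)) ^
         \<alpha> k * (complex_of_real (sqrt pi) * exp ((z' k + \<zeta> k)\<^sup>2 / 4)))" for k
  proof -
    have "exp ((z k + \<zeta> k)\<^sup>2 / 4) = exp (((z k + \<zeta> k)\<^sup>2 - (z' k + \<zeta> k)\<^sup>2) /
        4) * exp ((z' k + \<zeta> k)\<^sup>2 / 4)"
      unfolding exp_add[symmetric] by (simp add: diff_divide_distrib)
    moreover have "(z' k - cnj (\<zeta> k)) ^ \<alpha> k = e k ^ (2 * \<alpha> k) * (z k - cnj (\<zeta> k)) ^
        \<alpha> k"
      by (simp add: z'_def power_mult_distrib power_mult)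
    ultimately show ?thesis by (simp add: mult_ac)
  qed
  have "multiplier \<kappa> e j * hermite_basis.coeff \<zeta> (gaussian z) j =
    \<kappa> * c * (\<Prod>k\<in>UNIV. e k ^ (2 * \<alpha> k + 1) * ((z k - cnj (\<zeta> k)) ^ \<alpha> k *
        (complex_of_real (sqrt pi) * exp ((z k + \<zeta> k)\<^sup>2 / 4))))"
    unfolding coeff multiplier_def \<alpha>_def[symmetric] prod.distrib by (simp only: mult_ac)
  also have "\<dots> = (\<kappa> * (\<Prod>k\<in>UNIV. e k * exp (((z k + \<zeta> k)\<^sup>2 - (z' k + \<zeta>
      k)\<^sup>2) / 4))) * hermite_basis.coeff \<zeta> (gaussian z') j"
    unfolding coeff factor prod.distrib by (simp only: mult_ac)
  finally have "multiplier \<kappa> e j * hermite_basis.coeff \<zeta> (gaussian z) j =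
    (\<kappa> * (\<Prod>k\<in>UNIV. e k * exp (((z k + \<zeta> k)\<^sup>2 - (z' k + \<zeta> k)\<^sup>2) / 4)))
        * hermite_basis.coeff \<zeta> (gaussian z') j" .
  then show "hermite_basis.coeff \<zeta> (hermite_basis.diagonal \<zeta> (multiplier \<kappa> e) (gaussian z)) j =
    hermite_basis.coeff \<zeta> (\<lambda>x. (\<kappa> * (\<Prod>k\<in>UNIV. e k * exp (((z k + \<zeta>
        k)\<^sup>2 - (z' k + \<zeta> k)\<^sup>2) / 4))) * gaussian z' x) j"
    by (simp only: hermite_basis.coeff_cmult hermite_basis.coeff_diagonal[OF gaussian_L2 m])
qed

lemma integral_diagonal_gaussian:
  fixes e \<zeta> z w :: "'n::finite \<Rightarrow> complex"
  assumes e: "\<And>k. norm (e k) \<le> 1"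
  defines "z' \<equiv> \<lambda>k. cnj (\<zeta> k) + (e k)\<^sup>2 * (z k - cnj (\<zeta> k))"
  shows "(LINT x|lborel. hermite_basis.diagonal \<zeta> (multiplier \<kappa> e) (gaussian z) x * gaussian w x) =
    \<kappa> * (\<Prod>k\<in>UNIV. e k * complex_of_real (sqrt pi) * exp (((z k + \<zeta> k)\<^sup>2 - (z' k +
        \<zeta> k)\<^sup>2 + (z' k + w k)\<^sup>2) / 4))"
proof -
  note [measurable] = L2_measurable[OF hermite_basis.diagonal_L2[OF gaussian_L2 norm_multiplier_le[where e=e, OF e]]]
  define C where "C = \<kappa> * (\<Prod>k\<in>UNIV. e k * exp (((z k + \<zeta> k)\<^sup>2 - (z' k + \<zeta>
      k)\<^sup>2) / 4))"
  have "(LINT x|lborel. hermite_basis.diagonal \<zeta> (multiplier \<kappa> e) (gaussian z) x * gaussian w x) =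
      (LINT x|lborel. C * (gaussian z' x * gaussian w x))"
  proof (rule integral_cong_AE)
    show "AE x in lborel. hermite_basis.diagonal \<zeta> (multiplier \<kappa> e) (gaussian z) x * gaussian w x
        = C * (gaussian z' x * gaussian w x)"
      using diagonal_gaussian[where e=e and \<zeta>=\<zeta> and \<kappa>=\<kappa> and z=z, OF e] unfolding
          C_def z'_def by eventually_elim simp
  qed measurable
  also have "\<dots> = C * (\<Prod>k\<in>UNIV. complex_of_real (sqrt pi) * exp ((z' k + w k)\<^sup>2 / 4))"
    unfolding integral_mult_right_zero integral_gaussian_mult ..
  also have "\<dots> = \<kappa> * (\<Prod>k\<in>UNIV. e k * complex_of_real (sqrt pi) * exp (((z k + \<zeta>
      k)\<^sup>2 - (z' k + \<zeta> k)\<^sup>2 + (z' k + w k)\<^sup>2) / 4))"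
    unfolding C_def mult.assoc prod.distrib[symmetric]
    by (rule arg_cong[where f="\<lambda>x. \<kappa> * x"], rule prod.cong[OF refl]) (simp add:
        add_divide_distrib exp_add)
  finally show ?thesis .
qed

text \<open>Matches the exponent of the phase space integral with that of the diagonal operator, one
  coordinate at a time; \<open>p\<close> and \<open>s\<close> are the two coordinates of the
  displacement.\<close>

lemma gaussian_exponent_identity:
  fixes z w p s e :: complex
  assumes e: "e\<^sup>2 + 1 \<noteq> 0"
  defines "\<zeta> \<equiv> p - \<i> * s" and "\<zeta>' \<equiv> p + \<i> * s"
  defines "z' \<equiv> \<zeta>' + e\<^sup>2 * (z - \<zeta>')"
  shows "((z + w - 2 * cayley e * p)\<^sup>2 + (\<i> * (z - w) + 2 * cayley e * s)\<^sup>2) * (e\<^sup>2 + 1) / 8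
    + cayley e * (p\<^sup>2 + s\<^sup>2) + (z - w)\<^sup>2 / 4 = ((z + \<zeta>)\<^sup>2 - (z' +
        \<zeta>)\<^sup>2 + (z' + w)\<^sup>2) / 4"
proof -
  \<comment> \<open>With \<open>e^2\<close>, \<open>cayley e\<close> and \<open>\<i>\<close> as
    independent variables, subject only to \<open>T * (\<rho> + 1) = \<rho> - 1\<close> and
    \<open>j^2 = - 1\<close>, and with denominators cleared by 8, the claim is one of ideal
    membership.\<close>
  define \<rho> T j where "\<rho> = e\<^sup>2" "T = cayley e" "j = \<i>"
  have T: "T * (\<rho> + 1) = \<rho> - 1" using e by (simp add: \<rho>_T_j_def cayley_def)
  have j: "j\<^sup>2 = - 1" by (simp add: \<rho>_T_j_def)
  have "((z + w - 2 * T * p)\<^sup>2 + (j * (z - w) + 2 * T * s)\<^sup>2) * (\<rho> + 1)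
    + 8 * (T * (p\<^sup>2 + s\<^sup>2)) + 2 * (z - w)\<^sup>2 = 2 * ((z + (p - j * s))\<^sup>2 - ((p + j * s +
        \<rho> * (z - (p + j * s))) + (p - j * s))\<^sup>2 + ((p + j * s + \<rho> * (z - (p + j * s))) + w)\<^sup>2)"
    using T j by algebra
  moreover have "X / 8 + Y + Z / 4 = W / 4" if "X + 8 * Y + 2 * Z = 2 * W" for X Y Z W :: complex
  proof -
    have "W / 4 = (X + 8 * Y + 2 * Z) / 8" using that by simp
    then show ?thesis by (simp add: add_divide_distrib)
  qed
  ultimately show ?thesis
    unfolding \<zeta>_def \<zeta>'_def z'_def \<rho>_T_j_def by blast
qed

text \<open>Integrability of the symbol and the uniform bound on cross Wigner functions control one
  form, contraction of the diagonal operator the other. Their difference \<open>D\<close> is thus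
  bounded in \<open>L2\<close> in each argument and vanishes on packets.\<close>

lemma weyl_gaussian_symbol_strict:
  fixes a s :: "'n::finite \<Rightarrow> real" and e :: "'n \<Rightarrow> complex"
  assumes e: "\<And>k. norm (e k) < 1" and \<phi>: "\<phi> \<in> L2" and \<psi>: "\<psi> \<in> L2"
  defines "\<zeta> \<equiv> \<lambda>k. Complex (a k) (- s k)"
  shows "(LINT p|lborel. gaussian_symbol \<kappa> e a s p * cross_wigner \<phi> \<psi> p) =
    (LINT x|lborel. hermite_basis.diagonal \<zeta> (multiplier \<kappa> e) \<phi> x * \<psi> x)"
proof -
  have e': "norm (e k) \<le> 1" for k using e less_imp_le by blast
  note m = norm_multiplier_le[where e=e, OF e']
  define F where "F = gaussian_symbol \<kappa> e a s"
  define V where "V = hermite_basis.diagonal \<zeta> (multiplier \<kappa> e)"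
  have V: "V f \<in> L2" "L2_norm (V f) \<le> norm \<kappa> * L2_norm f" if "f \<in> L2" for f
    unfolding V_def using hermite_basis.diagonal_L2[OF that m] hermite_basis.L2_norm_diagonal_le[OF that m] by auto
  have F: "integrable lborel F" unfolding F_def by (rule integrable_gaussian_symbol[where e=e, OF e])
  note [measurable] = borel_measurable_integrable[OF F]
  define c where "c = norm (wigner_const TYPE('n)) * 2 ^ CARD('n)"
  have W: "norm (F p * cross_wigner f g p) \<le> norm (F p) * (c * (L2_norm f * L2_norm g))" if "f \<in> L2" "g
      \<in> L2" for f g p
    using norm_cross_wigner_le[OF that, of "fst p" "snd p"] by (simp add: norm_mult c_def mult_left_mono)
  have FW: "integrable lborel (\<lambda>p. F p * cross_wigner f g p)" if fg: "f \<in> L2" "g \<in> L2" for f g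
  proof (rule Bochner_Integration.integrable_bound)
    note [measurable] = cross_wigner_measurable[OF fg[THEN L2_measurable]]
    show "integrable lborel (\<lambda>p. norm (F p) * (c * (L2_norm f * L2_norm g)))"
      by (intro integrable_mult_left integrable_norm F)
    show "(\<lambda>p. F p * cross_wigner f g p) \<in> borel_measurable lborel" by measurable
    show "AE p in lborel. norm (F p * cross_wigner f g p) \<le> norm (norm (F p) * (c * (L2_norm f * L2_norm g)))"
      by (intro AE_I2 order_trans[OF W[OF fg]]) simp
  qed
  define D where "D f g = (LINT p|lborel. F p * cross_wigner f g p) - (LINT x|lborel. V f x * g x)" for f g
  define K where "K = (LINT p|lborel. norm (F p)) * c + norm \<kappa>"
  have Vg: "(LINT x|lborel. V f x * g x) = l2_inner (V f) (\<lambda>x. cnj (g x))" for f g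
    by (simp add: l2_inner_def)
  have int: "integrable lborel (\<lambda>x. V f x * g x)" if "f \<in> L2" "g \<in> L2" for f g
    by (intro L2_integrable_mult V that)
  have D_bound: "norm (D f g) \<le> K * (L2_norm f * L2_norm g)" if fg: "f \<in> L2" "g \<in> L2" for f g
  proof -
    have "norm (LINT p|lborel. F p * cross_wigner f g p) \<le> (LINT p|lborel. norm (F p) * (c * (L2_norm f *
        L2_norm g)))"
      by (rule Bochner_Integration.integral_norm_bound_integral[OF FW[OF fg] _ W[OF fg]]) (intro
          integrable_mult_left integrable_norm F)
    moreover have "norm (LINT x|lborel. V f x * g x) \<le> norm \<kappa> * L2_norm f * L2_norm g"
      unfolding Vg using L2_Cauchy_Schwarz[OF V(1)[OF fg(1)] L2_cnj[OF fg(2)]] mult_right_mono[OF V(2)[OF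
          fg(1)] L2_norm_nonneg[of g]]
      by (simp add: L2_norm_cnj)
    ultimately show ?thesis
      unfolding D_def K_def by (intro order_trans[OF norm_triangle_ineq4]) (simp add: algebra_simps)
  qed
  have D_gaussian: "D (gaussian z) (gaussian w) = 0" for z w
  proof -
    have "(LINT p|lborel. F p * cross_wigner (gaussian z) (gaussian w) p) = (LINT x|lborel. V (gaussian z) x *
        gaussian w x)"
      unfolding F_def V_def integral_gaussian_symbol_cross_wigner[where e=e, OF e]
          integral_diagonal_gaussian[where e=e, OF e']
    proof (rule arg_cong[where f="\<lambda>x. \<kappa> * x"], rule prod.cong[OF refl])
      fix k
      have \<zeta>: "\<zeta> k = complex_of_real (a k) - \<i> * complex_of_real (s k)" "cnj (\<zeta> k) =
          complex_of_real (a k) + \<i> * complex_of_real (s k)"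
        by (simp_all add: \<zeta>_def complex_eq_iff)
      have ne: "(e k)\<^sup>2 + 1 \<noteq> 0" using square_ne_minus_one[OF e, of k] by (simp add: add.commute)
      show "e k * complex_of_real (sqrt pi) *
        exp (((z k + w k - 2 * cayley (e k) * complex_of_real (a k))\<^sup>2 + (\<i> * (z k - w k) + 2 * cayley
            (e k) * complex_of_real (s k))\<^sup>2) * ((e k)\<^sup>2 + 1) / 8
         + cayley (e k) * (complex_of_real (a k) ^ 2 + complex_of_real (s k) ^ 2) + (z k - w k)\<^sup>2 / 4) =
        e k * complex_of_real (sqrt pi) * exp (((z k + \<zeta> k)\<^sup>2 - (cnj (\<zeta> k) + (e k)\<^sup>2 *
            (z k - cnj (\<zeta> k)) + \<zeta> k)\<^sup>2 + (cnj (\<zeta> k) + (e k)\<^sup>2 * (z k - cnj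
            (\<zeta> k)) + w k)\<^sup>2) / 4)"
        unfolding \<zeta>(2) unfolding \<zeta>(1) gaussian_exponent_identity[OF ne] ..
    qed
    then show ?thesis by (simp add: D_def)
  qed
  have D_gaussian_left: "D (gaussian z) g = 0" if "g \<in> L2" for z g
  proof (rule bounded_functional_gaussian_eq_0[where T="D (gaussian z)" and K="K * L2_norm (gaussian z)", OF _
      _ _ D_gaussian that])
    show "D (gaussian z) (\<lambda>x. f x + g x) = D (gaussian z) f + D (gaussian z) g" if fg: "f \<in> L2" "g
        \<in> L2" for f g
      unfolding D_def cross_wigner_add_right[OF gaussian_L2 fg] distrib_left
      by (simp add: Bochner_Integration.integral_add FW int gaussian_L2 fg)
    show "D (gaussian z) (\<lambda>x. c * f x) = c * D (gaussian z) f" if "f \<in> L2" for c f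
      unfolding D_def cross_wigner_cmult_right mult.left_commute[of _ c] integral_mult_right_zero right_diff_distrib ..
    show "norm (D (gaussian z) f) \<le> K * L2_norm (gaussian z) * L2_norm f" if "f \<in> L2" for f
      using D_bound[OF gaussian_L2 that] by (simp add: mult.assoc)
  qed
  \<comment> \<open>The second argument has been extended from packets to all of \<open>L2\<close>
    while the first was a packet; now the first argument is extended with \<open>\<psi>\<close>
    fixed.\<close>
  have "D \<phi> \<psi> = 0"
  proof (rule bounded_functional_gaussian_eq_0[where T="\<lambda>f. D f \<psi>" and K="K * L2_norm \<psi>", OF
      _ _ _ D_gaussian_left[OF \<psi>] \<phi>])
    note \<psi>' = L2_cnj[OF \<psi>]
    show "D (\<lambda>x. f x + g x) \<psi> = D f \<psi> + D g \<psi>" if fg: "f \<in> L2" "g \<in> L2" for f g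
    proof -
      \<comment> \<open>\<open>V\<close> is additive only almost everywhere, which suffices under
        the integral.\<close>
      have "l2_inner (V (\<lambda>x. f x + g x)) (\<lambda>x. cnj (\<psi> x)) = l2_inner (\<lambda>x. V f x + V
          g x) (\<lambda>x. cnj (\<psi> x))"
        unfolding V_def by (intro l2_inner_cong_AE L2_add V[unfolded V_def] fg \<psi>'
            hermite_basis.AE_diagonal_add[OF fg m])
      then show ?thesis
        unfolding D_def Vg cross_wigner_add_left[OF fg \<psi>] distrib_left
        by (simp add: Bochner_Integration.integral_add FW fg \<psi> \<psi>' l2_inner_add_left V)
    qed
    show "D (\<lambda>x. c * f x) \<psi> = c * D f \<psi>" if f: "f \<in> L2" for c f
    proof -
      have "l2_inner (V (\<lambda>x. c * f x)) (\<lambda>x. cnj (\<psi> x)) = l2_inner (\<lambda>x. c * V f x)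
          (\<lambda>x. cnj (\<psi> x))"
        unfolding V_def by (intro l2_inner_cong_AE L2_cmult V[unfolded V_def] f \<psi>'
            hermite_basis.AE_diagonal_cmult[OF f m])
      then show ?thesis
        unfolding D_def Vg cross_wigner_cmult_left mult.left_commute[of _ c] integral_mult_right_zero
            right_diff_distrib l2_inner_cmult_left
        by simp
    qed
    show "norm (D f \<psi>) \<le> K * L2_norm \<psi> * L2_norm f" if "f \<in> L2" for f
      using D_bound[OF that \<psi>] by (simp add: mult_ac)
  qed
  then show ?thesis by (simp add: D_def F_def V_def)
qed

theorem weyl_gaussian_symbol:
  fixes a s :: "'n::finite \<Rightarrow> real" and e :: "'n \<Rightarrow> complex"
  assumes e: "\<And>k. norm (e k) \<le> 1" "\<And>k. (e k)\<^sup>2 \<noteq> - 1" and \<phi>: "schwartz \<phi>"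
      and \<psi>: "schwartz \<psi>"
  defines "\<zeta> \<equiv> \<lambda>k. Complex (a k) (- s k)"
  shows "(LINT p|lborel. gaussian_symbol \<kappa> e a s p * cross_wigner \<phi> \<psi> p) =
    (LINT x|lborel. hermite_basis.diagonal \<zeta> (multiplier \<kappa> e) \<phi> x * \<psi> x)"
proof -
  define r where "r m = 1 - 1 / (real m + 2)" for m
  have r: "0 \<le> r m" "r m < 1" for m by (auto simp: r_def)
  have r_lim: "r \<longlonglongrightarrow> 1" unfolding r_def by real_asymp
  define E where "E m k = complex_of_real (r m) * e k" for m k
  have E_less: "norm (E m k) < 1" for m k
  proof -
    have "norm (E m k) \<le> r m * 1"
      unfolding E_def norm_mult using r e(1) by (intro mult_mono) auto
    then show ?thesis using r by (simp add: order_le_less_trans)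
  qed
  have E_le: "norm (E m k) \<le> 1" for m k using E_less less_imp_le by blast
  have E_lim: "(\<lambda>m. E m k) \<longlonglongrightarrow> e k" for k
    unfolding E_def using tendsto_mult[OF tendsto_of_real[OF r_lim] tendsto_const[of "e k"]] by simp
  have ne: "1 + (e k)\<^sup>2 \<noteq> 0" for k using e(2)[of k] by (simp add: add_eq_0_iff)
  have cay: "(\<lambda>m. cayley (E m k)) \<longlonglongrightarrow> cayley (e k)" for k
    unfolding cayley_def using ne[of k] by (intro tendsto_intros E_lim) (simp add: add.commute)
  have pre: "(\<lambda>m. 2 * E m k / (1 + (E m k)\<^sup>2)) \<longlonglongrightarrow> 2 * e k / (1 + (e
      k)\<^sup>2)" for k
    using ne[of k] by (intro tendsto_intros E_lim)
  \<comment> \<open>Convergent sequences are bounded; convergence rests on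
    \<open>1 + (e k)^2 \<noteq> 0\<close>. The exponentials have modulus at most 1, so this bounds
    all damped symbols by one constant.\<close>
  have "\<exists>C. \<forall>m. norm (2 * E m k / (1 + (E m k)\<^sup>2)) \<le> C" for k
    using convergent_imp_Bseq[OF convergentI[OF pre[of k]]] by (auto simp: Bseq_def)
  then obtain C where C: "\<And>k m. norm (2 * E m k / (1 + (E m k)\<^sup>2)) \<le> C k" by metis
  define M where "M = norm \<kappa> * (\<Prod>k\<in>UNIV. C k)"
  have F_le: "norm (gaussian_symbol \<kappa> (E m) a s p) \<le> M" for m p
    unfolding M_def by (rule order_trans[OF norm_gaussian_symbol_le[where e="E m", OF E_le]]) (intro
        mult_left_mono prod_mono conjI C; simp)
  have F_lim: "(\<lambda>m. gaussian_symbol \<kappa> (E m) a s p) \<longlonglongrightarrow> gaussian_symbol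
      \<kappa> e a s p" for p
    unfolding gaussian_symbol_def by (cases p) (simp only: split, intro tendsto_mult tendsto_const tendsto_prod
        tendsto_exp pre cay)
  have W: "integrable lborel (cross_wigner \<phi> \<psi>)"
    by (rule integrable_cross_wigner_schwartz[OF \<phi> \<psi>])
  note [measurable] = borel_measurable_integrable[OF W]
  have "(\<lambda>m. LINT p|lborel. gaussian_symbol \<kappa> (E m) a s p * cross_wigner \<phi> \<psi> p)
      \<longlonglongrightarrow> (LINT p|lborel. gaussian_symbol \<kappa> e a s p * cross_wigner \<phi> \<psi> p)"
  proof (rule integral_dominated_convergence[where w="\<lambda>p. M * norm (cross_wigner \<phi> \<psi> p)"])
    show "integrable lborel (\<lambda>p. M * norm (cross_wigner \<phi> \<psi> p))"
      by (intro integrable_mult_right integrable_norm W)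
    show "AE p in lborel. (\<lambda>m. gaussian_symbol \<kappa> (E m) a s p * cross_wigner \<phi> \<psi> p)
        \<longlonglongrightarrow> gaussian_symbol \<kappa> e a s p * cross_wigner \<phi> \<psi> p"
      by (intro AE_I2 tendsto_mult_right F_lim)
    show "AE p in lborel. norm (gaussian_symbol \<kappa> (E m) a s p * cross_wigner \<phi> \<psi> p) \<le> M *
        norm (cross_wigner \<phi> \<psi> p)" for m
      unfolding norm_mult by (intro AE_I2 mult_right_mono F_le) simp
  qed measurable
  moreover have "(\<lambda>m. LINT x|lborel. hermite_basis.diagonal \<zeta> (multiplier \<kappa> (E m)) \<phi>
      x * \<psi> x)
      \<longlonglongrightarrow> (LINT x|lborel. hermite_basis.diagonal \<zeta> (multiplier \<kappa> e) \<phi> x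
          * \<psi> x)"
  proof -
    have "(\<lambda>m. multiplier \<kappa> (E m) j) \<longlonglongrightarrow> multiplier \<kappa> e j" for j
      unfolding multiplier_def by (intro tendsto_intros E_lim)
    \<comment> \<open>The damped operators are uniformly bounded and their entries converge, so they
      converge strongly; their pairings with \<open>\<psi>\<close> then converge.\<close>
    from hermite_basis.diagonal_tendsto[OF schwartz_L2[OF \<phi>] norm_multiplier_le[where e="E _", OF E_le]
        norm_multiplier_le[where e=e, OF e(1)] this]
    have "(\<lambda>m. l2_inner (hermite_basis.diagonal \<zeta> (multiplier \<kappa> (E m)) \<phi>)
        (\<lambda>x. cnj (\<psi> x)))
      \<longlonglongrightarrow> l2_inner (hermite_basis.diagonal \<zeta> (multiplier \<kappa> e) \<phi>)
          (\<lambda>x. cnj (\<psi> x))"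
      by (intro l2_inner_tendsto hermite_basis.diagonal_L2[OF schwartz_L2[OF \<phi>] norm_multiplier_le[where
          e="E _", OF E_le]]
          hermite_basis.diagonal_L2[OF schwartz_L2[OF \<phi>] norm_multiplier_le[where e=e, OF e(1)]] L2_cnj
              schwartz_L2[OF \<psi>])
    then show ?thesis by (simp add: l2_inner_def)
  qed
  ultimately show ?thesis
    unfolding weyl_gaussian_symbol_strict[where e="E _", OF E_less schwartz_L2[OF \<phi>] schwartz_L2[OF
        \<psi>]] \<zeta>_def[symmetric]
    by (rule LIMSEQ_unique)
qed

section \<open>Unimodular parameters and the star exponential\<close>

lemma gaussian_symbol_factors:
  fixes b :: real
  assumes "cos b \<noteq> 0"
  defines "e \<equiv> exp (\<i> * complex_of_real b)"
  shows "e\<^sup>2 \<noteq> - 1"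
    and "2 * e / (1 + e\<^sup>2) = inverse (complex_of_real (cos b))"
    and "cayley e = \<i> * complex_of_real (tan b)"
proof -
  define c s where "c = complex_of_real (cos b)" "s = complex_of_real (sin b)"
  have e: "e = c + \<i> * s"
    by (simp add: e_def c_s_def exp_Euler cos_of_real sin_of_real)
  have c: "c \<noteq> 0" using assms(1) by (simp add: c_s_def)
  have s2: "s\<^sup>2 = 1 - c\<^sup>2"
    using sin_squared_eq[of b] unfolding c_s_def by (metis of_real_1 of_real_diff of_real_power)
  \<comment> \<open>The double angle formulas \<open>e^2 + 1 = 2 * cos b * e\<close> and
    \<open>e^2 - 1 = 2 * \<i> * sin b * e\<close>, from which all three claims follow by
    division.\<close>
  have e2: "1 + e\<^sup>2 = 2 * c * e" "e\<^sup>2 - 1 = 2 * \<i> * s * e"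
    using s2 unfolding e by (simp_all add: power2_eq_square algebra_simps)
  have "e \<noteq> 0" by (simp add: e_def)
  then have "1 + e\<^sup>2 \<noteq> 0" unfolding e2 using c by simp
  then show "e\<^sup>2 \<noteq> - 1" by auto
  show "2 * e / (1 + e\<^sup>2) = inverse (complex_of_real (cos b))"
    unfolding e2 c_s_def(1)[symmetric] using c \<open>e \<noteq> 0\<close> by (simp add: field_simps)
  have "cayley e = (2 * \<i> * s * e) / (2 * c * e)"
    unfolding cayley_def e2(1)[symmetric] e2(2)[symmetric] by (simp add: add.commute)
  also have "\<dots> = \<i> * (s / c)" using \<open>e \<noteq> 0\<close> by simp
  finally show "cayley e = \<i> * complex_of_real (tan b)"
    by (simp add: c_s_def tan_def)
qed

lemma cos_nonzero:
  assumes "\<And>m::int. b \<noteq> pi / 2 + pi * of_int m"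
  shows "cos b \<noteq> 0"
proof
  assume "cos b = 0"
  then obtain i :: int where i: "odd i" "b = of_int i * (pi / 2)"
    by (auto simp: cos_zero_iff_int)
  then obtain m where "i = 2 * m + 1" by (auto elim: oddE)
  then have "b = pi / 2 + pi * of_int m" using i(2) by (simp add: field_simps)
  with assms show False by blast
qed

text \<open>Completing the square in the exponent: the terms with
  \<open>tan (b $ k) / (b $ k)^2\<close> belong to the squares around the centre, while the
  remaining \<open>- 1 / b $ k\<close> terms join \<open>c0\<close> in the constant.\<close>

lemma star_exponential_eq_gaussian_symbol:
  fixes c0 :: real and u v b :: "real^'n::finite"
  assumes b: "\<And>k. b $ k \<noteq> 0" and cos: "\<And>k. cos (b $ k) \<noteq> 0"
  shows "(\<lambda>(x, y).
       exp (\<i> * complex_of_real c0)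
       * inverse (complex_of_real (\<Prod>k\<in>UNIV. cos (b $ k)))
       * exp (\<i> * complex_of_real
           (\<Sum>k\<in>UNIV. ((u $ k)\<^sup>2 + (v $ k)\<^sup>2) * (1 / (b $ k)\<^sup>2 * tan (b $ k) - 1 / b $ k)))
       * exp (\<i> * complex_of_real
           (\<Sum>k\<in>UNIV. ((x $ k)\<^sup>2 + (y $ k)\<^sup>2) * tan (b $ k)))
       * exp (2 * \<i> * complex_of_real
           (\<Sum>k\<in>UNIV. 1 / b $ k * tan (b $ k) * (y $ k * u $ k - v $ k * x $ k)))) =
    gaussian_symbol (exp (\<i> * complex_of_real (c0 - (\<Sum>k\<in>UNIV. ((u $ k)\<^sup>2 + (v $ k)\<^sup>2) /
        b $ k))))
      (\<lambda>k. exp (\<i> * complex_of_real (b $ k))) (\<lambda>k. v $ k / b $ k) (\<lambda>k. u $ k / b $ k)"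
proof (rule ext, clarify)
  fix x y :: "real^'n"
  define T where "T k = tan (b $ k)" for k
  have exponent: "c0 + (\<Sum>k\<in>UNIV. ((u $ k)\<^sup>2 + (v $ k)\<^sup>2) * (1 / (b $ k)\<^sup>2 * T k - 1 / b $ k))
     + (\<Sum>k\<in>UNIV. ((x $ k)\<^sup>2 + (y $ k)\<^sup>2) * T k) + 2 * (\<Sum>k\<in>UNIV. 1 / b $ k * T k *
         (y $ k * u $ k - v $ k * x $ k))
     = c0 - (\<Sum>k\<in>UNIV. ((u $ k)\<^sup>2 + (v $ k)\<^sup>2) / b $ k) + (\<Sum>k\<in>UNIV. T k * ((x $ k
         - v $ k / b $ k)\<^sup>2 + (y $ k + u $ k / b $ k)\<^sup>2))"
  proof -
    have sums: "c0 + (\<Sum>k\<in>UNIV. f k) + (\<Sum>k\<in>UNIV. g k) + 2 * (\<Sum>k\<in>UNIV. h k) = c0 -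
        (\<Sum>k\<in>UNIV. p k) + (\<Sum>k\<in>UNIV. q k)"
      if "\<And>k. f k + g k + 2 * h k = - p k + q k" for f g h p q :: "'n \<Rightarrow> real"
    proof -
      have "(\<Sum>k\<in>UNIV. f k + g k + 2 * h k) = (\<Sum>k\<in>UNIV. - p k + q k)"
        by (simp only: that)
      then show ?thesis
        by (simp add: sum.distrib sum_negf sum_subtractf flip: sum_distrib_left)
    qed
    have "((u $ k)\<^sup>2 + (v $ k)\<^sup>2) * (1 / (b $ k)\<^sup>2 * T k - 1 / b $ k) + ((x $ k)\<^sup>2 + (y
        $ k)\<^sup>2) * T k
       + 2 * (1 / b $ k * T k * (y $ k * u $ k - v $ k * x $ k)) = - (((u $ k)\<^sup>2 + (v $ k)\<^sup>2) / b $ k)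
       + T k * ((x $ k - v $ k / b $ k)\<^sup>2 + (y $ k + u $ k / b $ k)\<^sup>2)" for k
      using b[of k] by (simp add: power2_eq_square field_simps)
    from sums[OF this] show ?thesis .
  qed
  have "exp (\<i> * complex_of_real c0)
       * inverse (complex_of_real (\<Prod>k\<in>UNIV. cos (b $ k)))
       * exp (\<i> * complex_of_real (\<Sum>k\<in>UNIV. ((u $ k)\<^sup>2 + (v $ k)\<^sup>2) * (1 / (b $
           k)\<^sup>2 * T k - 1 / b $ k)))
       * exp (\<i> * complex_of_real (\<Sum>k\<in>UNIV. ((x $ k)\<^sup>2 + (y $ k)\<^sup>2) * T k))
       * exp (2 * \<i> * complex_of_real (\<Sum>k\<in>UNIV. 1 / b $ k * T k * (y $ k * u $ k - v $ k * x $ k)))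
     = inverse (complex_of_real (\<Prod>k\<in>UNIV. cos (b $ k))) * exp (\<i> * complex_of_real (c0 +
         (\<Sum>k\<in>UNIV. ((u $ k)\<^sup>2 + (v $ k)\<^sup>2) * (1 / (b $ k)\<^sup>2 * T k - 1 / b $ k))
     + (\<Sum>k\<in>UNIV. ((x $ k)\<^sup>2 + (y $ k)\<^sup>2) * T k) + 2 * (\<Sum>k\<in>UNIV. 1 / b $ k * T k *
         (y $ k * u $ k - v $ k * x $ k))))"
    unfolding of_real_add distrib_left exp_add by (simp add: mult_ac)
  also have "\<dots> = inverse (complex_of_real (\<Prod>k\<in>UNIV. cos (b $ k))) * (exp (\<i> *
      complex_of_real (c0 - (\<Sum>k\<in>UNIV. ((u $ k)\<^sup>2 + (v $ k)\<^sup>2) / b $ k)))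
     * exp (\<i> * complex_of_real (\<Sum>k\<in>UNIV. T k * ((x $ k - v $ k / b $ k)\<^sup>2 + (y $ k + u $ k /
         b $ k)\<^sup>2))))"
    unfolding exponent of_real_add distrib_left exp_add ..
  also have "\<dots> = exp (\<i> * complex_of_real (c0 - (\<Sum>k\<in>UNIV. ((u $ k)\<^sup>2 + (v $ k)\<^sup>2)
      / b $ k))) *
      (\<Prod>k\<in>UNIV. inverse (complex_of_real (cos (b $ k))) * exp (\<i> * complex_of_real (T k) *
          complex_of_real ((x $ k - v $ k / b $ k)\<^sup>2 + (y $ k + u $ k / b $ k)\<^sup>2)))"
    unfolding of_real_sum sum_distrib_left exp_sum[OF finite] of_real_prod prod_inversef[symmetric] prod.distrib
    by (simp only: of_real_mult mult_ac o_def)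
  finally show "exp (\<i> * complex_of_real c0)
       * inverse (complex_of_real (\<Prod>k\<in>UNIV. cos (b $ k)))
       * exp (\<i> * complex_of_real (\<Sum>k\<in>UNIV. ((u $ k)\<^sup>2 + (v $ k)\<^sup>2) * (1 / (b $
           k)\<^sup>2 * tan (b $ k) - 1 / b $ k)))
       * exp (\<i> * complex_of_real (\<Sum>k\<in>UNIV. ((x $ k)\<^sup>2 + (y $ k)\<^sup>2) * tan (b $ k)))
       * exp (2 * \<i> * complex_of_real (\<Sum>k\<in>UNIV. 1 / b $ k * tan (b $ k) * (y $ k * u $ k - v $ k *
           x $ k))) =
      gaussian_symbol (exp (\<i> * complex_of_real (c0 - (\<Sum>k\<in>UNIV. ((u $ k)\<^sup>2 + (v $ k)\<^sup>2)
          / b $ k))))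
      (\<lambda>k. exp (\<i> * complex_of_real (b $ k))) (\<lambda>k. v $ k / b $ k) (\<lambda>k. u $ k / b $ k) (x, y)"
    unfolding gaussian_symbol_def split gaussian_symbol_factors(2,3)[OF cos] T_def .
qed

text \<open>The exponential of an eigenvalue splits into the value at the centre, which becomes
  \<open>\<kappa>\<close>, and the powers of \<open>exp (\<i> * b $ k)\<close> from the oscillator
  energies.\<close>

lemma star_evolution_1_eq_diagonal:
  fixes c0 :: real and u v b :: "real^'n::finite"
  shows "star_evolution c0 u v b 1 = hermite_basis.diagonal (\<lambda>k. Complex (v $ k / b $ k) (- (u $ k / b $ k)))
    (multiplier (exp (\<i> * complex_of_real (c0 - (\<Sum>k\<in>UNIV. ((u $ k)\<^sup>2 + (v $ k)\<^sup>2) / b $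
        k)))) (\<lambda>k. exp (\<i> * complex_of_real (b $ k))))"
proof -
  have "exp (\<i> * complex_of_real (1 * eigenvalue c0 u v b (multi_index j))) =
    multiplier (exp (\<i> * complex_of_real (c0 - (\<Sum>k\<in>UNIV. ((u $ k)\<^sup>2 + (v $ k)\<^sup>2) / b $
        k)))) (\<lambda>k. exp (\<i> * complex_of_real (b $ k))) j" for j
  proof -
    have "(\<Prod>k\<in>UNIV. exp (\<i> * complex_of_real (b $ k)) ^ (2 * multi_index j k + 1)) =
        exp (\<i> * complex_of_real (\<Sum>k\<in>UNIV. b $ k * (2 * real (multi_index j k) + 1)))"
      unfolding of_real_sum sum_distrib_left exp_sum[OF finite] exp_of_nat_mult[symmetric]
      by (intro prod.cong arg_cong[where f=exp] refl) (simp add: algebra_simps)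
    moreover have "eigenvalue c0 u v b (multi_index j) = c0 - (\<Sum>k\<in>UNIV. ((u $ k)\<^sup>2 + (v $
        k)\<^sup>2) / b $ k) + (\<Sum>k\<in>UNIV. b $ k * (2 * real (multi_index j k) + 1))"
      by (simp add: eigenvalue_def sum_subtractf)
    ultimately show ?thesis
      by (simp only: multiplier_def mult_1 of_real_add distrib_left exp_add)
  qed
  moreover have "shift_point u v b = (\<lambda>k. Complex (v $ k / b $ k) (- (u $ k / b $ k)))"
    by (rule ext) (simp add: shift_point_def)
  ultimately show ?thesis
    unfolding star_evolution_def hermite_basis.evolution_def by simp
qed

theorem corollary9p4:
  fixes c0 :: real and u v b :: "real^'n::finite"
  assumes "\<And>k. b $ k \<noteq> 0"
    and "\<And>k (m::int). b $ k \<noteq> pi / 2 + pi * of_int m"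
  shows "is_moyal_star_exp (quadratic_symbol c0 u v b)
    (distribution_of (\<lambda>(x, y).
       exp (\<i> * complex_of_real c0)
       * inverse (complex_of_real (\<Prod>k\<in>UNIV. cos (b $ k)))
       * exp (\<i> * complex_of_real
           (\<Sum>k\<in>UNIV. ((u $ k)\<^sup>2 + (v $ k)\<^sup>2) * (1 / (b $ k)\<^sup>2 * tan (b $ k) - 1 / b $ k)))
       * exp (\<i> * complex_of_real
           (\<Sum>k\<in>UNIV. ((x $ k)\<^sup>2 + (y $ k)\<^sup>2) * tan (b $ k)))
       * exp (2 * \<i> * complex_of_real
           (\<Sum>k\<in>UNIV. 1 / b $ k * tan (b $ k) * (y $ k * u $ k - v $ k * x $ k)))))"
proof -
  have cos: "cos (b $ k) \<noteq> 0" for k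
    by (rule cos_nonzero) (rule assms(2))
  define \<kappa> where "\<kappa> = exp (\<i> * complex_of_real (c0 - (\<Sum>k\<in>UNIV. ((u $ k)\<^sup>2 + (v $ k)\<^sup>2) / b $ k)))"
  define e where "e k = exp (\<i> * complex_of_real (b $ k))" for k
  \<comment> \<open>The excluded values of \<open>b $ k\<close> are exactly those with
    \<open>(e k)^2 = - 1\<close>, where the prefactor of the symbol has its pole.\<close>
  have e: "norm (e k) \<le> 1" "(e k)\<^sup>2 \<noteq> - 1" for k
    using gaussian_symbol_factors(1)[OF cos[of k]] by (simp_all add: e_def)
  define F where "F = gaussian_symbol \<kappa> e (\<lambda>k. v $ k / b $ k) (\<lambda>k. u $ k / b $ k)"
  have "is_moyal_star_exp (quadratic_symbol c0 u v b) (distribution_of F)"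
    unfolding is_moyal_star_exp_def
  proof (intro conjI exI allI impI)
    show "tempered_distribution (distribution_of F)"
      unfolding F_def by (rule tempered_distribution_bounded[OF gaussian_symbol_measurable norm_gaussian_symbol_le[where e=e, OF e(1)]])
    show "is_operator_exp (weyl_op (quadratic_symbol c0 u v b)) (star_evolution c0 u v b 1)"
      by (rule is_operator_exp_quadratic_symbol[OF assms(1)])
    fix \<phi> \<psi> :: "real^'n \<Rightarrow> complex"
    assume "schwartz \<phi>" "schwartz \<psi>"
    then show "weyl_pairing (distribution_of F) \<phi> \<psi> = distribution_of (star_evolution c0 u v b 1 \<phi>) \<psi>"
      unfolding weyl_pairing_def distribution_of_def F_def star_evolution_1_eq_diagonal \<kappa>_def[symmetric] e_def[abs_def, symmetric]
      by (rule weyl_gaussian_symbol[where e=e, OF e])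
  qed
  then show ?thesis
    unfolding star_exponential_eq_gaussian_symbol[OF assms(1) cos] F_def \<kappa>_def e_def[abs_def] .
qed

end
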